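(* Let $H$, $g$, $\phi$, $V$ satisfy Assumptions (A1)--(A5) listed in the context, with exponent $\alpha>1$ as in (A2). Then there exists a weak solution $(m,u)\in L^1(\mathbb{T}^d;\mathbb{R}_0^+)\times W^{1,\alpha}(\mathbb{T}^d)$ to the stationary mean-field game system $$ \begin{cases} -u-H(Du)+g(m)-V=0 & \text{in }\mathbb{T}^d,\\ m-\operatorname{div}\big(mD_pH(Du)\big)-\phi=0 & \text{in }\mathbb{T}^d; \end{cases} $$ that is, for all $(w,v)\in H^{2k}(\mathbb{T}^d;\mathbb{R}_0^+)\times H^{2k}(\mathbb{T}^d)$, $$ \int_{\mathbb{T}^d}\big(-v-H(Dv)+g(w)-V\big)(m-w)\,dx+\int_{\mathbb{T}^d}\big(w-\operatorname{div}(wD_pH(Dv))-\phi\big)(u-v)\,dx\leq 0 . $$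
   Context: $\mathbb{T}^d$ is the $d$-dimensional torus (of unit volume) and $\mathbb{R}_0^+=[0,+\infty)$; $X(\mathbb{T}^d;\mathbb{R}_0^+)$ denotes the functions in $X(\mathbb{T}^d)$ with values in $\mathbb{R}_0^+$. $k\in\mathbb{N}$ is fixed with $2k>\frac d2+3$. The data are $H:\mathbb{R}^d\to\mathbb{R}$, $g:\mathbb{R}_0^+\to\mathbb{R}$, $\phi:\mathbb{T}^d\to\mathbb{R}$, and a continuous potential $V:\mathbb{T}^d\to\mathbb{R}$. A pair $(m,u)\in L^1(\mathbb{T}^d;\mathbb{R}_0^+)\times L^1(\mathbb{T}^d)$ is a weak solution if it satisfies the displayed variational inequality for all $(w,v)\in H^{2k}(\mathbb{T}^d;\mathbb{R}_0^+)\times H^{2k}(\mathbb{T}^d)$. Assumptions: (A1) $H$ is of class $C^2$ and convex; $g$ is a non-negative continuous increasing function; $\phi\in C(\mathbb{T}^d)$, $\phi>0$, and $\int_{\mathbb{T}^d}\phi\,dx=1$. (A2) There exist constants $\alpha>1$ and $C>0$ such that $-H(p)+D_pH(p)\cdot p\geq \frac1C|p|^\alpha-C$ for all $p\in\mathbb{R}^d$. (A3) With $\alpha$ as in (A2), there exists $C>0$ such that $H(p)\geq\frac1C|p|^\alpha-C$ for all $p\in\mathbb{R}^d$. (A4) For each $\delta\in(0,1)$ there exists $C_\delta>0$ such that for all $m\in L^1(\mathbb{T}^d)$ with $m\geq0$, $\int_{\mathbb{T}^d}m\,dx+\int_{\mathbb{T}^d}g(m)\,dx\leq\delta\int_{\mathbb{T}^d}m\,g(m)\,dx+C_\delta$.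 (A5) Whenever $\{m_j\}_{j=1}^\infty\subset L^1(\mathbb{T}^d)$ satisfies $m_j\geq0$ and $\sup_{j}\int_{\mathbb{T}^d}m_jg(m_j)\,dx<\infty$, there is a subsequence that converges weakly in $L^1(\mathbb{T}^d)$ to some $m\in L^1(\mathbb{T}^d)$. *)

theory Defs
  imports "HOL-Analysis.Analysis"
begin

text \<open>
  The torus is \<open>\<real>\<^sup>d / \<int>\<^sup>d\<close> with \<open>d = CARD('n)\<close>: a function on it is a function on \<open>real^'n\<close>
  that is 1-periodic in every coordinate, and integrals are taken over the unit cube.
  The measure is the complete Lebesgue measure, so changing a function on a null set affects
  neither measurability nor integrals.
\<close>

definition periodic :: "(real^'n \<Rightarrow> real) \<Rightarrow> bool" where
  "periodic f \<longleftrightarrow> (\<forall>i x. f (x + axis i 1) = f x)"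

definition torus :: "(real^'n) measure" where
  "torus = lebesgue_on (cbox 0 1)"

definition cont_torus :: "(real^'n \<Rightarrow> real) set" where
  "cont_torus = {f. periodic f \<and> continuous_on UNIV f}"

text \<open>Elements of the function spaces below are representatives, not a.e.-classes.\<close>

definition Lp_torus :: "real \<Rightarrow> (real^'n \<Rightarrow> real) set" where
  "Lp_torus p = {f. periodic f \<and> f \<in> borel_measurable torus \<and>
     integrable torus (\<lambda>x. \<bar>f x\<bar> powr p)}"

definition Linf_torus :: "(real^'n \<Rightarrow> real) set" where
  "Linf_torus = {f. periodic f \<and> f \<in> borel_measurable torus \<and>
     (\<exists>B. AE x in torus. \<bar>f x\<bar> \<le> B)}"

definition nonneg_torus :: "(real^'n \<Rightarrow> real) set" where
  "nonneg_torus = {f. AE x in torus. 0 \<le> f x}"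

text \<open>Weak convergence in \<open>L\<^sup>1\<close>, whose dual is \<open>L\<^sup>\<infinity>\<close>.\<close>

definition weakly_converges_L1 :: "(nat \<Rightarrow> real^'n \<Rightarrow> real) \<Rightarrow> (real^'n \<Rightarrow> real) \<Rightarrow> bool" where
  "weakly_converges_L1 f l \<longleftrightarrow>
     (\<forall>\<psi> \<in> Linf_torus. (\<lambda>j. \<integral>x. f j x * \<psi> x \<partial>torus) \<longlonglongrightarrow> (\<integral>x. l x * \<psi> x \<partial>torus))"

definition partial_deriv :: "'n \<Rightarrow> (real^'n \<Rightarrow> real) \<Rightarrow> real^'n \<Rightarrow> real" where
  "partial_deriv i f x = frechet_derivative f (at x) (axis i 1)"

definition gradient :: "(real^'n \<Rightarrow> real) \<Rightarrow> real^'n \<Rightarrow> real^'n" where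
  "gradient f x = (\<chi> i. partial_deriv i f x)"

text \<open>
  A multi-index is written as the list of its directions: the multi-index \<open>a\<close> corresponds to any
  list that contains each \<open>i\<close> exactly \<open>a i\<close> times, and its order is the length of the list.
  For functions of class \<open>C\<^sup>k\<close> the arrangement of a list of length at most \<open>k\<close> is irrelevant.
\<close>

definition multi_deriv :: "'n list \<Rightarrow> (real^'n \<Rightarrow> real) \<Rightarrow> real^'n \<Rightarrow> real" where
  "multi_deriv js f = foldr partial_deriv js f"

definition class_C :: "nat \<Rightarrow> (real^'n \<Rightarrow> real) \<Rightarrow> bool" where
  "class_C k f \<longleftrightarrow>
     (\<forall>js. length js < k \<longrightarrow> (\<forall>x. multi_deriv js f differentiable (at x))) \<and>
     (\<forall>js. length js \<le> k \<longrightarrow> continuous_on UNIV (multi_deriv js f))"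

definition test_torus :: "(real^'n \<Rightarrow> real) set" where
  "test_torus = {\<psi>. periodic \<psi> \<and> (\<forall>k. class_C k \<psi>)}"

definition is_weak_deriv :: "'n list \<Rightarrow> (real^'n \<Rightarrow> real) \<Rightarrow> (real^'n \<Rightarrow> real) \<Rightarrow> bool" where
  "is_weak_deriv js f h \<longleftrightarrow>
     (\<forall>\<psi> \<in> test_torus.
        (\<integral>x. f x * multi_deriv js \<psi> x \<partial>torus) = (-1) ^ length js * (\<integral>x. h x * \<psi> x \<partial>torus))"

definition sobolev_torus :: "nat \<Rightarrow> real \<Rightarrow> (real^'n \<Rightarrow> real) set" where
  "sobolev_torus k p =
     {f \<in> Lp_torus p. \<forall>js. length js \<le> k \<longrightarrow> (\<exists>h \<in> Lp_torus p. is_weak_deriv js f h)}"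

text \<open>
  A representative of the weak derivative, which is unique a.e. when it exists; the value is
  unspecified if there is no weak derivative in \<open>L\<^sup>1\<close>.
\<close>

definition weak_partial :: "'n \<Rightarrow> (real^'n \<Rightarrow> real) \<Rightarrow> real^'n \<Rightarrow> real" where
  "weak_partial i f = (SOME h. h \<in> Lp_torus 1 \<and> is_weak_deriv [i] f h)"

definition weak_gradient :: "(real^'n \<Rightarrow> real) \<Rightarrow> real^'n \<Rightarrow> real^'n" where
  "weak_gradient f x = (\<chi> i. weak_partial i f x)"

definition weak_div :: "(real^'n \<Rightarrow> real^'n) \<Rightarrow> real^'n \<Rightarrow> real" where
  "weak_div F x = (\<Sum>i\<in>UNIV. weak_partial i (\<lambda>y. F y $ i) x)"

text \<open>
  When \<open>2 * k > d / 2 + 3\<close> and \<open>H\<close> is of class \<open>C\<^sup>2\<close>, the test functions \<open>w\<close> and \<open>v\<close> agree a.e.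
  with functions of class \<open>C\<^sup>3\<close>. Hence \<open>w D\<^sub>pH(Dv)\<close> agrees a.e. with a field of class \<open>C\<^sup>1\<close>, its
  weak divergence exists, and all integrands are integrable.
\<close>

definition weak_solution ::
  "nat \<Rightarrow> (real^'n \<Rightarrow> real) \<Rightarrow> (real \<Rightarrow> real) \<Rightarrow> (real^'n \<Rightarrow> real) \<Rightarrow> (real^'n \<Rightarrow> real) \<Rightarrow>
   (real^'n \<Rightarrow> real) \<Rightarrow> (real^'n \<Rightarrow> real) \<Rightarrow> bool" where
  "weak_solution k H g \<phi> V m u \<longleftrightarrow>
     m \<in> Lp_torus 1 \<inter> nonneg_torus \<and> u \<in> Lp_torus 1 \<and>
     (\<forall>w \<in> sobolev_torus (2 * k) 2 \<inter> nonneg_torus. \<forall>v \<in> sobolev_torus (2 * k) 2.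
        (\<integral>x. (- v x - H (weak_gradient v x) + g (w x) - V x) * (m x - w x) \<partial>torus) +
        (\<integral>x. (w x - weak_div (\<lambda>y. w y *\<^sub>R gradient H (weak_gradient v y)) x - \<phi> x)
               * (u x - v x) \<partial>torus) \<le> 0)"

end

theory Submission imports Defs begin

text \<open>
  The variational inequality is affine in the unknown pair \<open>(m, u)\<close>: with the monotone operator
  \<open>A(w, v) = (- v - H(Dv) + g(w) - V, w - div(w D\<^sub>pH(Dv)) - \<phi>)\<close> it says that the pairing of
  \<open>A(w, v)\<close> with \<open>(m, u) - (w, v)\<close> is non-positive for every test pair. Hence no partial differential
  equation has to be solved. It suffices to satisfy finitely many of these inequalities up to an
  error, with a bound that does not depend on which ones, and then to use compactness.

  Finitely many inequalities (\<open>finite_system_admissible\<close>). By a minimax argument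
  (\<open>finite_convex_system\<close>) it is enough to satisfy every weighted mean of the inequalities by some pair
  from a fixed convex bounded family. The weighted mean \<open>z\<close> of the test pairs works by monotonicity,
  but it may lie outside the family. The energy estimate (\<open>energy_estimate\<close>), which pairs
  \<open>A(w, v)\<close> with \<open>(w, v) - (\<phi>, 0)\<close>, decides between two cases. If the weighted energy is
  non-negative, \<open>(\<phi>, 0)\<close> works. If it is negative, \<open>z\<close> has controlled density and gradient, and if the
  mean of its value function is large, adding a constant to \<open>\<phi>\<close> or subtracting one gives a pair that
  works
  (\<open>weighted_admissible\<close>).

  Compactness (\<open>nested_convex_L1_limit\<close>). The family is convex and uniformly integrable. This follows
  from the Poincare inequality for \<open>u\<close>, from \<open>\<alpha> > 1\<close> for \<open>Du\<close>, and from the superlinear growth of \<open>g\<close>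
  for \<open>m\<close>. Minimising a strictly convex functional of linear growth subject to more and more
  inequalities yields a sequence that converges strongly in \<open>L\<^sup>1\<close>, and its limit satisfies all the
  inequalities (\<open>exists_minty_solution\<close>). Fatou's lemma puts \<open>u\<close> and its weak gradient in \<open>L\<^sup>\<alpha>\<close>.

  Test functions. So far \<open>w\<close> is of class \<open>C\<^sup>1\<close> and \<open>v\<close> of class \<open>C\<^sup>2\<close>. A function in \<open>H\<^bsup>2k\<^esup>\<close> with
  \<open>2k > d/2 + 3\<close> has Fourier coefficients that remain summable after multiplication by the squared
  frequency. It is therefore a uniform limit of trigonometric polynomials together with its derivatives
  up to second order (\<open>sobolev_trigonometric_approximation\<close>), and the inequality passes to the limit by
  dominated convergence (\<open>minty_solution_weak_solution\<close>).
\<close>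

section \<open>Integration on the torus\<close>

lemma integrable_torus_continuous:
  fixes f :: "real^'n \<Rightarrow> 'b::euclidean_space"
  assumes "continuous_on (cbox 0 1) f"
  shows "integrable torus f"
  using continuous_imp_integrable[OF assms] by (simp add: torus_def)

lemma integral_torus_eq:
  fixes f :: "real^'n \<Rightarrow> 'b::euclidean_space"
  assumes "integrable torus f"
  shows "(\<integral>x. f x \<partial>torus) = integral (cbox 0 1) f"
  using lebesgue_integral_eq_integral[of "cbox 0 1" f] assms by (simp add: torus_def)

lemma space_torus [simp]: "space torus = cbox 0 1"
  by (simp add: torus_def)

lemma content_unit_cube: "measure lborel (cbox 0 1 :: (real^'n) set) = 1"
proof -
  have "cbox 0 1 \<noteq> ({} :: (real^'n) set)" by (auto simp: interval_ne_empty_cart)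
  thus ?thesis by (subst content_cbox_cart) auto
qed

lemma emeasure_torus: "emeasure (torus :: (real^'n) measure) (cbox 0 1) = 1"
proof -
  have "emeasure lborel (cbox 0 1 :: (real^'n) set) = ennreal (measure lborel (cbox 0 1 :: (real^'n) set))"
    by (rule emeasure_eq_ennreal_measure) (use emeasure_lborel_cbox_finite[of 0 "1::real^'n"] in auto)
  thus ?thesis
    by (simp add: torus_def emeasure_restrict_space content_unit_cube)
qed

interpretation torus: finite_measure "torus :: (real^'n) measure"
  by standard (simp add: emeasure_torus)

lemma measure_torus [simp]: "measure (torus :: (real^'n) measure) (cbox 0 1) = 1"
  by (simp add: measure_def emeasure_torus)

lemma integral_torus_const [simp]: "(\<integral>x. c \<partial>(torus :: (real^'n) measure)) = (c::real)"
  by simp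

lemma integrable_torus_const [simp]: "integrable torus (\<lambda>x. c)"
  by (rule torus.integrable_const)

lemma AE_torus_cube: "AE x in torus. x \<in> cbox 0 1"
  using AE_space[of torus] by simp

lemma periodic_add_axis: "periodic f \<Longrightarrow> f (x + axis i 1) = f x"
  by (simp add: periodic_def)

lemma periodic_translate: "periodic f \<Longrightarrow> periodic (\<lambda>x. f (x + h))"
  unfolding periodic_def by (metis add.assoc add.commute)

text \<open>Shifting the cube by \<open>t \<ge> 0\<close> in one direction removes a slab at one face and adds its
  translate by one period at the opposite face.\<close>

lemma integral_cube_shift_axis_nonneg:
  fixes f :: "real^'n \<Rightarrow> real"
  assumes f: "continuous_on UNIV f" "periodic f" and t: "t \<ge> 0"
  shows "integral (cbox 0 1) (\<lambda>x. f (x + t *\<^sub>R axis i 1)) = integral (cbox 0 1) f"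
proof -
  define e :: "real^'n" where "e = axis i 1"
  have e: "e \<in> Basis" by (simp add: e_def axis_in_Basis_iff)
  have en: "x \<bullet> e = x $ i" for x by (simp add: e_def inner_axis)
  have eni: "e $ j = (if j = i then 1 else 0)" for j by (simp add: e_def axis_def)
  have mem: "x \<in> cbox a b \<longleftrightarrow> a$i \<le> x$i \<and> x$i \<le> b$i \<and> (\<forall>j. j \<noteq> i \<longrightarrow> a$j \<le> x$j \<and> x$j \<le> b$j)"
    for x a b :: "real^'n"
    unfolding mem_box_cart by metis
  define B where "B = cbox 0 (1 + t *\<^sub>R e)"
  have int: "f integrable_on cbox a b" for a b
    by (rule integrable_continuous) (use f in \<open>auto intro: continuous_on_subset\<close>)
  have B1: "B \<inter> {x. x \<bullet> e \<le> 1} = cbox 0 1"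
    unfolding set_eq_iff Int_iff B_def mem using t by (auto simp: en eni)
  have B2: "B \<inter> {x. x \<bullet> e \<ge> 1} = cbox e (1 + t *\<^sub>R e)"
    unfolding set_eq_iff Int_iff B_def mem using t by (auto simp: en eni)
  have B3: "B \<inter> {x. x \<bullet> e \<le> t} = cbox 0 (1 + t *\<^sub>R e - e)"
    unfolding set_eq_iff Int_iff B_def mem using t by (auto simp: en eni)
  have B4: "B \<inter> {x. x \<bullet> e \<ge> t} = cbox (t *\<^sub>R e) (1 + t *\<^sub>R e)"
    unfolding set_eq_iff Int_iff B_def mem using t by (auto simp: en eni)
  have s1: "integral B f = integral (cbox 0 1) f + integral (cbox e (1 + t *\<^sub>R e)) f"
    using integral_split[OF int e, of 0 "1 + t *\<^sub>R e" 1] B1 B2 by (simp add: B_def)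
  have s2: "integral B f = integral (cbox 0 (1 + t *\<^sub>R e - e)) f + integral (cbox (t *\<^sub>R e) (1 + t *\<^sub>R e)) f"
    using integral_split[OF int e, of 0 "1 + t *\<^sub>R e" t] B3 B4 by (simp add: B_def)
  have s3: "integral (cbox e (1 + t *\<^sub>R e)) f = integral (cbox 0 (1 + t *\<^sub>R e - e)) f"
    using integral_shift_cbox[of e e "1 + t *\<^sub>R e" f] periodic_add_axis[OF f(2), of _ i]
    by (simp add: e_def)
  have s4: "integral (cbox 0 1) (\<lambda>x. f (x + t *\<^sub>R e)) = integral (cbox (t *\<^sub>R e) (1 + t *\<^sub>R e)) f"
    using integral_shift_cbox[of "t *\<^sub>R e" "t *\<^sub>R e" "1 + t *\<^sub>R e" f] by simp
  show ?thesis using s1 s2 s3 s4 by (simp add: e_def)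
qed

lemma integral_cube_shift_axis:
  fixes f :: "real^'n \<Rightarrow> real"
  assumes f: "continuous_on UNIV f" "periodic f"
  shows "integral (cbox 0 1) (\<lambda>x. f (x + t *\<^sub>R axis i 1)) = integral (cbox 0 1) f"
proof (cases "t \<ge> 0")
  case False
  have "continuous_on UNIV (\<lambda>x. f (x + t *\<^sub>R axis i 1))"
    by (rule continuous_on_compose2[OF f(1)]) (auto intro!: continuous_intros)
  from integral_cube_shift_axis_nonneg[OF this periodic_translate[OF f(2)], of "-t" i] False
  show ?thesis by simp
qed (rule integral_cube_shift_axis_nonneg[OF f])

lemma integral_torus_translate:
  fixes f :: "real^'n \<Rightarrow> real"
  assumes f: "continuous_on UNIV f" "periodic f"
  shows "(\<integral>x. f (x + h) \<partial>torus) = (\<integral>x. f x \<partial>torus)"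
proof -
  have c: "continuous_on UNIV (\<lambda>x. f (x + k))" for k
    by (rule continuous_on_compose2[OF f(1)]) (auto intro!: continuous_intros)
  have ind: "finite J \<Longrightarrow> integral (cbox 0 1) (\<lambda>x. f (x + (\<Sum>i\<in>J. (h$i) *\<^sub>R axis i 1))) = integral (cbox 0 1) f" for J
  proof (induction J rule: finite_induct)
    case (insert j J)
    let ?f = "\<lambda>x. f (x + (\<Sum>i\<in>J. (h$i) *\<^sub>R axis i 1))"
    have "integral (cbox 0 1) (\<lambda>x. ?f (x + (h$j) *\<^sub>R axis j 1)) = integral (cbox 0 1) ?f"
      by (rule integral_cube_shift_axis[OF c periodic_translate[OF f(2)]])
    thus ?case using insert by (simp add: add.assoc)
  qed simp
  have hh: "(\<Sum>i\<in>UNIV. (h$i) *\<^sub>R axis i 1) = h"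
    using basis_expansion[of h] by (simp add: scalar_mult_eq_scaleR)
  have "integrable torus f" "integrable torus (\<lambda>x. f (x + h))"
    using f(1) c[of h] by (auto intro!: integrable_torus_continuous intro: continuous_on_subset)
  thus ?thesis using ind[of UNIV] unfolding hh by (simp add: integral_torus_eq)
qed

section \<open>Periodic functions of class \<open>C\<^sup>1\<close>\<close>

definition C1_torus :: "(real^'n \<Rightarrow> real) \<Rightarrow> (real^'n \<Rightarrow> real^'n) \<Rightarrow> bool" where
  "C1_torus f D \<longleftrightarrow> periodic f \<and> (\<forall>x. (f has_derivative (\<lambda>h. D x \<bullet> h)) (at x)) \<and> continuous_on UNIV D"

lemma C1_torusD:
  assumes "C1_torus f D"
  shows "periodic f" "(f has_derivative (\<lambda>h. D x \<bullet> h)) (at x within S)" "continuous_on S D"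
    "continuous_on S f"
  using assms continuous_on_subset has_derivative_at_withinI has_derivative_continuous
  unfolding C1_torus_def
  by (blast, blast, blast) (meson assms C1_torus_def continuous_at_imp_continuous_on has_derivative_continuous)

lemma C1_torus_gradient_periodic:
  assumes "C1_torus f D"
  shows "D (x + axis i 1) = D x"
proof -
  have "((\<lambda>y. f (y + axis i 1)) has_derivative (\<lambda>h. D (x + axis i 1) \<bullet> h)) (at x)"
    by (rule has_derivative_compose[of "\<lambda>y. y + axis i 1" "\<lambda>h. h", where g = f])
      (auto intro!: derivative_eq_intros C1_torusD[OF assms])
  hence "(f has_derivative (\<lambda>h. D (x + axis i 1) \<bullet> h)) (at x)"
    using C1_torusD(1)[OF assms] by (simp add: periodic_def)
  hence "(\<lambda>h. D (x + axis i 1) \<bullet> h) = (\<lambda>h. D x \<bullet> h)"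
    by (rule has_derivative_unique) (rule C1_torusD[OF assms])
  thus ?thesis by (metis vector_eq_rdot inner_commute)
qed

lemma C1_torus_gradient_component_periodic:
  "C1_torus f D \<Longrightarrow> periodic (\<lambda>x. D x $ j)"
  using C1_torus_gradient_periodic unfolding periodic_def by metis

lemma C1_torus_const [intro]: "C1_torus (\<lambda>x. c) (\<lambda>x. 0)"
  by (auto simp: C1_torus_def periodic_def)

lemma C1_torus_add [intro]:
  assumes "C1_torus f D" "C1_torus f' D'"
  shows "C1_torus (\<lambda>x. f x + f' x) (\<lambda>x. D x + D' x)"
  using assms unfolding C1_torus_def periodic_def
  by (auto intro!: continuous_intros derivative_eq_intros simp: inner_add_left)

lemma C1_torus_scale [intro]:
  assumes "C1_torus f D"
  shows "C1_torus (\<lambda>x. c * f x) (\<lambda>x. c *\<^sub>R D x)"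
  using assms unfolding C1_torus_def periodic_def
  by (auto intro!: continuous_intros derivative_eq_intros)

lemma C1_torus_mult:
  assumes "C1_torus f D" "C1_torus f' D'"
  shows "C1_torus (\<lambda>x. f x * f' x) (\<lambda>x. f x *\<^sub>R D' x + f' x *\<^sub>R D x)"
  using assms C1_torusD(4)[of f D UNIV] C1_torusD(4)[of f' D' UNIV] unfolding C1_torus_def periodic_def
  by (auto intro!: continuous_intros derivative_eq_intros simp: inner_add_left algebra_simps)

lemma C1_torus_sum:
  assumes "finite I" "\<And>i. i \<in> I \<Longrightarrow> C1_torus (f i) (D i)"
  shows "C1_torus (\<lambda>x. \<Sum>i\<in>I. f i x) (\<lambda>x. \<Sum>i\<in>I. D i x)"
  using assms by (induction I rule: finite_induct) auto

text \<open>The increment of \<open>f\<close> over one period vanishes. Written as an integral of the derivative along the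
  period and integrated over the torus, it is a mean of integrals of translates of the derivative,
  which all agree.\<close>

lemma integral_torus_partial_eq_0:
  fixes f :: "real^'n \<Rightarrow> real"
  assumes f: "C1_torus f D"
  shows "(\<integral>x. D x $ i \<partial>torus) = 0"
proof -
  define e :: "real^'n" where "e = axis i 1"
  define q where "q = (\<lambda>x. D x \<bullet> e)"
  have qc: "continuous_on UNIV q" unfolding q_def by (intro continuous_intros C1_torusD[OF f])
  have qp: "periodic q" unfolding periodic_def q_def using C1_torus_gradient_periodic[OF f] by simp
  have qt: "(\<integral>x. q (x + t *\<^sub>R e) \<partial>torus) = (\<integral>x. q x \<partial>torus)" for t
    by (rule integral_torus_translate[OF qc qp])
  have qi: "integrable torus (\<lambda>x. q (x + t *\<^sub>R e))" for t
    by (intro integrable_torus_continuous continuous_on_compose2[OF qc] continuous_intros) auto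
  have ftc: "integral (cbox 0 1) (\<lambda>t. q (x + t *\<^sub>R e)) = f (x + e) - f x" for x
  proof -
    have "((\<lambda>t. q (x + t *\<^sub>R e)) has_integral (f (x + 1 *\<^sub>R e) - f (x + 0 *\<^sub>R e))) {0..1}"
    proof (rule fundamental_theorem_of_calculus)
      fix t :: real
      have "((\<lambda>t. f (x + t *\<^sub>R e)) has_derivative (\<lambda>h. D (x + t *\<^sub>R e) \<bullet> (h *\<^sub>R e))) (at t within {0..1})"
        by (rule has_derivative_compose[where g = f]) (auto intro!: derivative_eq_intros C1_torusD[OF f])
      thus "((\<lambda>t. f (x + t *\<^sub>R e)) has_vector_derivative q (x + t *\<^sub>R e)) (at t within {0..1})"
        by (simp add: has_vector_derivative_def q_def mult.commute)
    qed simp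
    thus ?thesis by (simp add: integral_unique)
  qed
  have "0 = integral (cbox 0 1) (\<lambda>x. f (x + e) - f x)"
    using C1_torusD(1)[OF f] by (simp add: periodic_def e_def)
  also have "\<dots> = integral (cbox 0 1) (\<lambda>x. integral (cbox 0 1) (\<lambda>t. q (x + t *\<^sub>R e)))"
    using ftc by simp
  also have "\<dots> = integral (cbox 0 1) (\<lambda>t. integral (cbox 0 1) (\<lambda>x. q (x + t *\<^sub>R e)))"
    by (rule integral_swap_continuous)
      (auto simp: case_prod_unfold intro!: continuous_on_compose2[OF qc] continuous_intros)
  also have "\<dots> = integral (cbox 0 (1::real)) (\<lambda>t. \<integral>x. q x \<partial>torus)"
    using qt integral_torus_eq[OF qi] by simp
  also have "\<dots> = (\<integral>x. q x \<partial>torus)" by simp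
  finally show ?thesis by (simp add: q_def e_def inner_axis)
qed

lemma integration_by_parts_torus:
  fixes f \<psi> :: "real^'n \<Rightarrow> real"
  assumes f: "C1_torus f D" and \<psi>: "C1_torus \<psi> E"
  shows "(\<integral>x. f x * E x $ i \<partial>torus) = - (\<integral>x. D x $ i * \<psi> x \<partial>torus)"
proof -
  have "(\<integral>x. (f x *\<^sub>R E x + \<psi> x *\<^sub>R D x) $ i \<partial>torus) = 0"
    by (rule integral_torus_partial_eq_0[OF C1_torus_mult[OF f \<psi>]])
  moreover have "integrable torus (\<lambda>x. f x * E x $ i)" "integrable torus (\<lambda>x. D x $ i * \<psi> x)"
    by (intro integrable_torus_continuous continuous_intros C1_torusD[OF f] C1_torusD[OF \<psi>])+
  ultimately show ?thesis by (simp add: mult.commute)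
qed

section \<open>The Poincare inequality\<close>

lemma powr_ge_tangent:
  fixes s t \<alpha> :: real
  assumes "\<alpha> > 1" "s \<ge> 0" "t \<ge> 0"
  shows "t powr \<alpha> + \<alpha> * t powr (\<alpha> - 1) * (s - t) \<le> s powr \<alpha>"
proof -
  define q where "q = \<alpha> / (\<alpha> - 1)"
  have q: "q > 1" "1 / \<alpha> + 1 / q = 1" "\<alpha> / q = \<alpha> - 1" using assms by (auto simp: q_def field_simps)
  have "s * t powr (\<alpha> - 1) \<le> s powr \<alpha> / \<alpha> + (t powr (\<alpha> - 1)) powr q / q"
    by (rule Youngs_inequality) (use assms q in auto)
  also have "(t powr (\<alpha> - 1)) powr q = t powr \<alpha>"
    using assms by (simp add: powr_powr q_def)
  finally have "\<alpha> * (s * t powr (\<alpha> - 1)) \<le> \<alpha> * (s powr \<alpha> / \<alpha> + t powr \<alpha> / q)"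
    using assms by (intro mult_left_mono) auto
  also have "\<dots> = s powr \<alpha> + (\<alpha> / q) * t powr \<alpha>" using assms by (simp add: distrib_left)
  also have "\<dots> = s powr \<alpha> + (\<alpha> - 1) * t powr \<alpha>" by (simp add: q(3))
  finally have *: "\<alpha> * (s * t powr (\<alpha> - 1)) \<le> s powr \<alpha> + (\<alpha> - 1) * t powr \<alpha>" .
  have "t powr (\<alpha> - 1) * t = t powr \<alpha>"
  proof (cases "t = 0")
    case False
    thus ?thesis using assms powr_add[of t "\<alpha> - 1" 1] by simp
  qed simp
  hence "\<alpha> * t powr (\<alpha> - 1) * t = \<alpha> * t powr \<alpha>" by (simp add: mult.assoc)
  thus ?thesis using * assms(1) by (simp add: algebra_simps)
qed

lemma powr_sum_convex:
  fixes s \<mu> :: "'i \<Rightarrow> real"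
  assumes \<alpha>: "\<alpha> > 1" and I: "\<And>i. i \<in> I \<Longrightarrow> \<mu> i \<ge> 0" "(\<Sum>i\<in>I. \<mu> i) = 1" "\<And>i. i \<in> I \<Longrightarrow> s i \<ge> 0"
  shows "(\<Sum>i\<in>I. \<mu> i * s i) powr \<alpha> \<le> (\<Sum>i\<in>I. \<mu> i * s i powr \<alpha>)"
proof -
  define t where "t = (\<Sum>i\<in>I. \<mu> i * s i)"
  have t: "t \<ge> 0" unfolding t_def by (intro sum_nonneg mult_nonneg_nonneg I)
  have "(\<Sum>i\<in>I. \<mu> i * (t powr \<alpha> + \<alpha> * t powr (\<alpha> - 1) * (s i - t))) \<le> (\<Sum>i\<in>I. \<mu> i * s i powr \<alpha>)"
    by (intro sum_mono mult_left_mono powr_ge_tangent \<alpha> t I)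
  also have "(\<Sum>i\<in>I. \<mu> i * (t powr \<alpha> + \<alpha> * t powr (\<alpha> - 1) * (s i - t))) = t powr \<alpha>"
  proof -
    have "(\<Sum>i\<in>I. \<mu> i * (A + B * (s i - c))) = (\<Sum>i\<in>I. \<mu> i) * A + B * ((\<Sum>i\<in>I. \<mu> i * s i) - (\<Sum>i\<in>I. \<mu> i) * c)"
      for A B c
      by (simp add: algebra_simps sum.distrib sum_subtractf sum_distrib_left sum_distrib_right)
    from this[of "t powr \<alpha>" "\<alpha> * t powr (\<alpha> - 1)" t] show ?thesis
      using I(2) by (simp add: t_def)
  qed
  finally show ?thesis using I by (simp add: t_def)
qed

lemma continuous_on_powr_abs [continuous_intros]:
  fixes f :: "'a::topological_space \<Rightarrow> real"
  assumes "continuous_on S f" "\<alpha> > 1"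
  shows "continuous_on S (\<lambda>x. \<bar>f x\<bar> powr \<alpha>)"
  by (intro continuous_on_powr' continuous_intros assms) (use assms in auto)

text \<open>The tangent to the power function at the mean of the modulus, integrated over a box of unit volume.\<close>

lemma powr_abs_integral_le:
  fixes f :: "'a::euclidean_space \<Rightarrow> real"
  assumes f: "continuous_on (cbox a b) f" and \<alpha>: "\<alpha> > 1" and vol: "measure lborel (cbox a b) = 1"
  shows "\<bar>integral (cbox a b) f\<bar> powr \<alpha> \<le> integral (cbox a b) (\<lambda>x. \<bar>f x\<bar> powr \<alpha>)"
proof -
  define t where "t = integral (cbox a b) (\<lambda>x. \<bar>f x\<bar>)"
  have ia: "(\<lambda>x. \<bar>f x\<bar>) integrable_on cbox a b" by (intro integrable_continuous continuous_intros f)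
  have ip: "(\<lambda>x. \<bar>f x\<bar> powr \<alpha>) integrable_on cbox a b"
    by (intro integrable_continuous continuous_intros f \<alpha>)
  have t: "t \<ge> 0" unfolding t_def by (rule integral_nonneg[OF ia]) auto
  have "\<bar>integral (cbox a b) f\<bar> \<le> t"
    using integral_norm_bound_integral[OF integrable_continuous[OF f] ia] by (simp add: t_def)
  hence "\<bar>integral (cbox a b) f\<bar> powr \<alpha> \<le> t powr \<alpha>" using \<alpha> by (intro powr_mono2) auto
  also have "t powr \<alpha> = integral (cbox a b) (\<lambda>x. t powr \<alpha> + \<alpha> * t powr (\<alpha> - 1) * (\<bar>f x\<bar> - t))"
  proof -
    have c: "((\<lambda>x. k) has_integral k) (cbox a b)" for k :: real
      using has_integral_const[of k a b] vol by simp
    have "((\<lambda>x. t powr \<alpha> + \<alpha> * t powr (\<alpha> - 1) * (\<bar>f x\<bar> - t)) has_integral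
       (t powr \<alpha> + \<alpha> * t powr (\<alpha> - 1) * (t - t))) (cbox a b)"
      by (intro has_integral_add has_integral_mult_right has_integral_diff c)
        (use ia in \<open>simp add: t_def has_integral_integral\<close>)
    thus ?thesis by (simp add: integral_unique)
  qed
  also have "\<dots> \<le> integral (cbox a b) (\<lambda>x. \<bar>f x\<bar> powr \<alpha>)"
    by (intro integral_le ip integrable_continuous continuous_intros f powr_ge_tangent \<alpha> t) auto
  finally show ?thesis .
qed

text \<open>Along a segment, Jensen's inequality bounds the increment by the mean of the directional
  derivative, and averaging over the base point removes the dependence on the position.\<close>

lemma integral_increment_le:
  fixes u :: "real^'n \<Rightarrow> real"
  assumes u: "C1_torus u D" and \<alpha>: "\<alpha> > 1"
  shows "integral (cbox 0 1) (\<lambda>x. \<bar>u (x + h) - u x\<bar> powr \<alpha>)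
    \<le> norm h powr \<alpha> * integral (cbox 0 1) (\<lambda>x. norm (D x) powr \<alpha>)"
proof -
  define q where "q = (\<lambda>x. \<bar>D x \<bullet> h\<bar> powr \<alpha>)"
  have qc: "continuous_on UNIV q" unfolding q_def by (intro continuous_intros C1_torusD[OF u] \<alpha>)
  have qp: "periodic q" unfolding periodic_def q_def using C1_torus_gradient_periodic[OF u] by simp
  have uc: "continuous_on UNIV u" by (rule C1_torusD[OF u])
  have qi: "integrable torus (\<lambda>x. q (x + t *\<^sub>R h))" for t
    by (intro integrable_torus_continuous continuous_on_compose2[OF qc] continuous_intros) auto
  have ptw: "\<bar>u (x + h) - u x\<bar> powr \<alpha> \<le> integral (cbox 0 1) (\<lambda>t. q (x + t *\<^sub>R h))" for x
  proof -
    have "((\<lambda>t. D (x + t *\<^sub>R h) \<bullet> h) has_integral (u (x + 1 *\<^sub>R h) - u (x + 0 *\<^sub>R h))) {0..1}"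
    proof (rule fundamental_theorem_of_calculus)
      fix t :: real
      have "((\<lambda>t. u (x + t *\<^sub>R h)) has_derivative (\<lambda>k. D (x + t *\<^sub>R h) \<bullet> (k *\<^sub>R h))) (at t within {0..1})"
        by (rule has_derivative_compose[where g = u]) (auto intro!: derivative_eq_intros C1_torusD[OF u])
      thus "((\<lambda>t. u (x + t *\<^sub>R h)) has_vector_derivative D (x + t *\<^sub>R h) \<bullet> h) (at t within {0..1})"
        by (simp add: has_vector_derivative_def mult.commute)
    qed simp
    hence "u (x + h) - u x = integral (cbox 0 1) (\<lambda>t. D (x + t *\<^sub>R h) \<bullet> h)"
      by (simp add: integral_unique)
    thus ?thesis unfolding q_def
      by (simp only:) (rule powr_abs_integral_le, auto intro!: continuous_intros \<alpha>
        continuous_on_compose2[OF C1_torusD(3)[OF u, of UNIV]])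
  qed
  have cont2: "continuous_on (cbox (0, 0) (1, 1)) (\<lambda>(x, t). q (x + t *\<^sub>R h))"
    by (auto simp: case_prod_unfold intro!: continuous_on_compose2[OF qc] continuous_intros)
  have "integral (cbox 0 1) (\<lambda>x. \<bar>u (x + h) - u x\<bar> powr \<alpha>)
      \<le> integral (cbox 0 1) (\<lambda>x. integral (cbox 0 1) (\<lambda>t. q (x + t *\<^sub>R h)))"
  proof (rule integral_le)
    show "(\<lambda>x. \<bar>u (x + h) - u x\<bar> powr \<alpha>) integrable_on cbox 0 1"
      by (auto intro!: integrable_continuous continuous_intros \<alpha> continuous_on_compose2[OF uc])
    show "(\<lambda>x. integral (cbox 0 1) (\<lambda>t. q (x + t *\<^sub>R h))) integrable_on cbox 0 1"
      using integral_integrable_2dim[OF cont2] by simp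
  qed (rule ptw)
  also have "\<dots> = integral (cbox 0 1) (\<lambda>t. integral (cbox 0 1) (\<lambda>x. q (x + t *\<^sub>R h)))"
    by (rule integral_swap_continuous[OF cont2])
  also have "\<dots> = integral (cbox 0 (1::real)) (\<lambda>t. integral (cbox 0 1) q)"
    using integral_torus_translate[OF qc qp] integral_torus_eq[OF qi]
      integral_torus_eq[of q] qi[of 0] by simp
  also have "\<dots> = integral (cbox 0 1) q" by simp
  also have "\<dots> \<le> integral (cbox 0 1) (\<lambda>x. norm h powr \<alpha> * norm (D x) powr \<alpha>)"
  proof (rule integral_le)
    show "q integrable_on cbox 0 1" using qc by (auto intro!: integrable_continuous intro: continuous_on_subset)
    have "continuous_on (cbox 0 1) (\<lambda>x. \<bar>norm (D x)\<bar> powr \<alpha>)"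
      by (intro continuous_intros C1_torusD[OF u] \<alpha>)
    thus "(\<lambda>x. norm h powr \<alpha> * norm (D x) powr \<alpha>) integrable_on cbox 0 1"
      by (auto intro!: integrable_continuous continuous_intros)
    show "q x \<le> norm h powr \<alpha> * norm (D x) powr \<alpha>" for x
      using Cauchy_Schwarz_ineq2[of "D x" h] \<alpha>
      by (auto simp: q_def powr_mult[symmetric] mult.commute intro!: powr_mono2)
  qed
  finally show ?thesis by simp
qed

lemma norm_unit_cube_le:
  assumes "x \<in> cbox 0 (1::real^'n)"
  shows "norm x \<le> real CARD('n)"
proof -
  have "norm x \<le> (\<Sum>i\<in>UNIV. \<bar>x $ i\<bar>)" by (rule norm_le_l1_cart)
  also have "\<dots> \<le> (\<Sum>i\<in>(UNIV::'n set). 1)"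
    using assms by (intro sum_mono) (auto simp: mem_box_cart)
  finally show ?thesis by simp
qed

text \<open>The mean of \<open>u\<close> is also its mean over translates, so Jensen's inequality reduces the deviation
  from the mean to increments.\<close>

lemma poincare_torus:
  fixes u :: "real^'n \<Rightarrow> real"
  assumes u: "C1_torus u D" and \<alpha>: "\<alpha> > 1"
  shows "(\<integral>x. \<bar>u x - (\<integral>y. u y \<partial>torus)\<bar> powr \<alpha> \<partial>torus)
    \<le> real CARD('n) powr \<alpha> * (\<integral>x. norm (D x) powr \<alpha> \<partial>torus)"
proof -
  have uc: "continuous_on UNIV u" by (rule C1_torusD[OF u])
  have uc': "continuous_on (cbox 0 1) u" using uc continuous_on_subset by blast
  define a where "a = (\<integral>y. u y \<partial>torus)"
  define G where "G = integral (cbox 0 1) (\<lambda>x. norm (D x) powr \<alpha>)"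
  have cN: "continuous_on (cbox 0 1) (\<lambda>x. norm (D x) powr \<alpha>)"
    using continuous_on_powr_abs[of "cbox 0 1" "\<lambda>x. norm (D x)" \<alpha>] C1_torusD(3)[OF u] \<alpha>
    by (auto intro: continuous_intros)
  have G0: "G \<ge> 0" unfolding G_def by (rule integral_nonneg[OF integrable_continuous[OF cN]]) auto
  have cT: "continuous_on UNIV (\<lambda>h. u (x + h))" for x
    by (rule continuous_on_compose2[OF uc]) (auto intro!: continuous_intros)
  have a: "a = integral (cbox 0 1) (\<lambda>h. u (x + h))" for x
  proof -
    have "integral (cbox 0 1) (\<lambda>h. u (x + h)) = (\<integral>h. u (h + x) \<partial>torus)"
      using integral_torus_eq[OF integrable_torus_continuous[OF continuous_on_subset[OF cT[of x] subset_UNIV]]]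
      by (simp add: add.commute)
    thus ?thesis using integral_torus_translate[OF uc C1_torusD(1)[OF u]] by (simp add: a_def)
  qed
  have ptw: "\<bar>u x - a\<bar> powr \<alpha> \<le> integral (cbox 0 1) (\<lambda>h. \<bar>u (x + h) - u x\<bar> powr \<alpha>)" for x
  proof -
    have i: "(\<lambda>h. u (x + h)) integrable_on cbox 0 1"
      by (intro integrable_continuous continuous_on_subset[OF cT]) auto
    have "integral (cbox 0 1) (\<lambda>h. u (x + h) - u x) = a - u x"
      using integral_diff[OF i integrable_const] a[of x] by (simp add: content_unit_cube)
    hence "\<bar>u x - a\<bar> = \<bar>integral (cbox 0 1) (\<lambda>h. u (x + h) - u x)\<bar>" by simp
    thus ?thesis
      by (simp only:) (rule powr_abs_integral_le, auto intro!: continuous_intros \<alpha>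
         content_unit_cube continuous_on_subset[OF cT])
  qed
  have cont2: "continuous_on (cbox (0, 0) (1, 1)) (\<lambda>(x, h). \<bar>u (x + h) - u x\<bar> powr \<alpha>)"
    by (auto simp: case_prod_unfold intro!: continuous_on_compose2[OF uc] continuous_intros \<alpha>)
  have cont3: "continuous_on (cbox (0, 0) (1, 1)) (\<lambda>(h, x). \<bar>u (x + h) - u x\<bar> powr \<alpha>)"
    by (auto simp: case_prod_unfold intro!: continuous_on_compose2[OF uc] continuous_intros \<alpha>)
  have c1: "continuous_on (cbox 0 1) (\<lambda>x. \<bar>u x - a\<bar> powr \<alpha>)"
    by (intro continuous_intros uc' \<alpha>)
  have "integral (cbox 0 1) (\<lambda>x. \<bar>u x - a\<bar> powr \<alpha>)
      \<le> integral (cbox 0 1) (\<lambda>x. integral (cbox 0 1) (\<lambda>h. \<bar>u (x + h) - u x\<bar> powr \<alpha>))"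
    using integral_integrable_2dim[OF cont2] by (intro integral_le integrable_continuous[OF c1] ptw) simp
  also have "\<dots> = integral (cbox 0 1) (\<lambda>h. integral (cbox 0 1) (\<lambda>x. \<bar>u (x + h) - u x\<bar> powr \<alpha>))"
    by (rule integral_swap_continuous[OF cont2])
  also have "\<dots> \<le> integral (cbox 0 1) (\<lambda>h::real^'n. real CARD('n) powr \<alpha> * G)"
  proof (rule integral_le)
    show "(\<lambda>h. integral (cbox 0 1) (\<lambda>x. \<bar>u (x + h) - u x\<bar> powr \<alpha>)) integrable_on cbox 0 1"
      using integral_integrable_2dim[OF cont3] by simp
    fix h :: "real^'n" assume h: "h \<in> cbox 0 1"
    have "integral (cbox 0 1) (\<lambda>x. \<bar>u (x + h) - u x\<bar> powr \<alpha>) \<le> norm h powr \<alpha> * G"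
      unfolding G_def by (rule integral_increment_le[OF u \<alpha>])
    also have "\<dots> \<le> real CARD('n) powr \<alpha> * G"
      using norm_unit_cube_le[OF h] \<alpha> G0 by (intro mult_right_mono powr_mono2) auto
    finally show "integral (cbox 0 1) (\<lambda>x. \<bar>u (x + h) - u x\<bar> powr \<alpha>) \<le> real CARD('n) powr \<alpha> * G" .
  qed auto
  finally show ?thesis
    by (simp add: a_def[symmetric] G_def[symmetric] content_unit_cube integral_torus_eq
        integrable_torus_continuous c1 cN)
qed

section \<open>Strong limits in nested convex families of integrable functions\<close>

text \<open>The limit is given by a pointwise formula for every argument, so that it inherits symmetries
  such as periodicity from the sequence without any choice of a representative.\<close>

lemma L1_fast_Cauchy_limit:
  fixes Q :: "nat \<Rightarrow> 'a \<Rightarrow> 'b::euclidean_space"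
  assumes int: "\<And>n. integrable M (Q n)"
    and fast: "\<And>n. (\<integral>x. norm (Q (Suc n) x - Q n x) \<partial>M) \<le> (1/2)^n"
  defines "P \<equiv> \<lambda>x. lim (\<lambda>n. Q n x)"
  shows "AE x in M. (\<lambda>n. Q n x) \<longlonglongrightarrow> P x" "integrable M P"
    "(\<lambda>n. \<integral>x. norm (Q n x - P x) \<partial>M) \<longlonglongrightarrow> 0"
proof -
  define w where "w = (\<lambda>n x. norm (Q (Suc n) x - Q n x))"
  have wi: "integrable M (w n)" for n using int by (auto simp: w_def)
  have w0: "w n x \<ge> 0" for n x by (simp add: w_def)
  have meas [measurable]: "Q n \<in> borel_measurable M" for n using int by auto
  have wm [measurable]: "w n \<in> borel_measurable M" for n using wi by auto
  have geo: "summable (\<lambda>n. (1/2::real)^n)" by (rule summable_geometric) simp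
  have sumint: "summable (\<lambda>n. \<integral>x. norm (w n x) \<partial>M)"
    by (rule summable_comparison_test'[OF geo]) (use fast in \<open>auto simp: w_def\<close>)
  have "(\<integral>\<^sup>+x. (\<Sum>n. ennreal (w n x)) \<partial>M) = (\<Sum>n. ennreal (\<integral>x. w n x \<partial>M))"
    by (subst nn_integral_suminf) (auto simp: nn_integral_eq_integral[OF wi] w0)
  also have "\<dots> = ennreal (\<Sum>n. \<integral>x. w n x \<partial>M)"
    using sumint w0 by (intro suminf_ennreal2) auto
  finally have "(\<integral>\<^sup>+x. (\<Sum>n. ennreal (w n x)) \<partial>M) \<noteq> \<infinity>" by simp
  hence "AE x in M. (\<Sum>n. ennreal (w n x)) \<noteq> \<infinity>"
    by (intro nn_integral_PInf_AE) auto
  hence sm: "AE x in M. summable (\<lambda>n. w n x)"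
    by eventually_elim (rule summable_suminf_not_top, use w0 in auto)
  have smn: "AE x in M. summable (\<lambda>n. norm (w n x))" using sm w0 by simp
  define W where "W = (\<lambda>x. \<Sum>n. w n x)"
  have Wi: "integrable M W" unfolding W_def by (rule integrable_suminf[OF wi smn sumint])
  have tele: "Q n x - Q m x = (\<Sum>k\<in>{m..<n}. Q (Suc k) x - Q k x)" if "m \<le> n" for m n x
    using sum_Suc_diff'[OF that, of "\<lambda>k. Q k x"] by simp
  have conv: "AE x in M. (\<lambda>n. Q n x) \<longlonglongrightarrow> P x" 
    using sm
  proof eventually_elim
    case (elim x)
    have "summable (\<lambda>k. Q (Suc k) x - Q k x)"
      by (rule summable_norm_cancel) (use elim in \<open>simp add: w_def\<close>)
    hence "convergent (\<lambda>n. \<Sum>k<n. Q (Suc k) x - Q k x)" by (simp add: summable_iff_convergent)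
    hence "convergent (\<lambda>n. Q 0 x + (\<Sum>k<n. Q (Suc k) x - Q k x))"
      by (intro convergent_add) (auto simp: convergent_const)
    moreover have "Q 0 x + (\<Sum>k<n. Q (Suc k) x - Q k x) = Q n x" for n
      using tele[of 0 n x] by (simp add: atLeast0LessThan algebra_simps)
    ultimately have "convergent (\<lambda>n. Q n x)" by simp
    thus ?case unfolding P_def by (simp add: convergent_LIMSEQ_iff)
  qed
  have bound: "AE x in M. norm (Q n x - Q m x) \<le> W x" if "m \<le> n" for m n
    using sm
  proof eventually_elim
    case (elim x)
    have "norm (Q n x - Q m x) \<le> (\<Sum>k\<in>{m..<n}. w k x)"
      unfolding tele[OF that] w_def by (rule norm_sum)
    also have "\<dots> \<le> W x" unfolding W_def by (rule sum_le_suminf[OF elim]) (auto simp: w0)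
    finally show ?case .
  qed
  have boundP: "AE x in M. norm (Q n x - P x) \<le> W x" for n
  proof -
    have "AE x in M. \<forall>m. n \<le> m \<longrightarrow> norm (Q m x - Q n x) \<le> W x"
      using bound[of n] by (subst AE_all_countable) auto
    thus ?thesis using conv
    proof eventually_elim
      case (elim x)
      have "(\<lambda>m. norm (Q m x - Q n x)) \<longlonglongrightarrow> norm (P x - Q n x)"
        by (intro tendsto_intros elim)
      hence "norm (P x - Q n x) \<le> W x"
        by (rule tendsto_upperbound) (use elim in \<open>auto simp: eventually_at_top_linorder\<close>)
      thus ?case by (simp add: norm_minus_commute)
    qed
  qed
  have Pm [measurable]: "P \<in> borel_measurable M" unfolding P_def by measurable
  have d: "integrable M (\<lambda>x. Q 0 x - P x)"
    by (rule Bochner_Integration.integrable_bound[OF Wi]) (use boundP[of 0] in \<open>auto elim!: eventually_mono\<close>)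
  have "integrable M (\<lambda>x. Q 0 x - (Q 0 x - P x))" by (intro Bochner_Integration.integrable_diff int d)
  thus Pi: "integrable M P" by simp
  have "(\<lambda>n. \<integral>x. norm (Q n x - P x) \<partial>M) \<longlonglongrightarrow> (\<integral>x. 0 \<partial>M)"
  proof (rule integral_dominated_convergence[where w = W])
    show "AE x in M. (\<lambda>n. norm (Q n x - P x)) \<longlonglongrightarrow> 0"
      using conv by eventually_elim (simp add: tendsto_norm_zero_iff LIM_zero_iff)
    show "\<And>n. AE x in M. norm (norm (Q n x - P x)) \<le> W x" using boundP by simp
  qed (use Wi in auto)
  thus "(\<lambda>n. \<integral>x. norm (Q n x - P x) \<partial>M) \<longlonglongrightarrow> 0" by simp
  show "AE x in M. (\<lambda>n. Q n x) \<longlonglongrightarrow> P x" by (rule conv)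
qed

text \<open>The Japanese bracket: strictly convex, and of linear growth.\<close>

definition japanese :: "'b::real_inner \<Rightarrow> real" where
  "japanese p = sqrt (1 + (norm p)\<^sup>2)"

lemma japanese_bounds: "1 \<le> japanese p" "norm p \<le> japanese p" "japanese p \<le> 1 + norm p"
  unfolding japanese_def by (auto intro!: real_le_rsqrt real_le_lsqrt simp: power2_eq_square algebra_simps)

text \<open>Strict convexity in quantitative form. The difference to the tangent at \<open>c\<close> is
  \<open>(\<langle>a\<rangle>\<langle>c\<rangle> - 1 - a \<bullet> c) / \<langle>c\<rangle>\<close>, and its numerator is a difference of squares divided by a sum.\<close>

lemma japanese_tangent:
  fixes a c :: "'b::real_inner"
  shows "(norm (a - c))\<^sup>2 / (2 * japanese a * (japanese c)\<^sup>2)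
    \<le> japanese a - japanese c - (c \<bullet> (a - c)) / japanese c"
proof -
  define A C where "A = japanese a" and "C = japanese c"
  have A: "A \<ge> 1" "A\<^sup>2 = 1 + a \<bullet> a" and C: "C \<ge> 1" "C\<^sup>2 = 1 + c \<bullet> c"
    using japanese_bounds(1)[of a] japanese_bounds(1)[of c]
    by (auto simp: A_def C_def japanese_def power2_norm_eq_inner add_nonneg_nonneg)
  define s where "s = a \<bullet> c"
  have cs: "s\<^sup>2 \<le> (a \<bullet> a) * (c \<bullet> c)" unfolding s_def by (rule Cauchy_Schwarz_ineq)
  have n2: "(norm (a - c))\<^sup>2 = a \<bullet> a + c \<bullet> c - 2 * s"
    by (simp add: power2_norm_eq_inner inner_diff_left inner_diff_right inner_commute s_def)
  have "(norm (a - c))\<^sup>2 \<le> (A * C)\<^sup>2 - (1 + s)\<^sup>2"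
    using cs unfolding power_mult_distrib A C n2 by (simp add: power2_eq_square algebra_simps)
  also have "\<dots> = (A * C - (1 + s)) * (A * C + (1 + s))" by (simp add: power2_eq_square algebra_simps)
  finally have 1: "(norm (a - c))\<^sup>2 \<le> (A * C - (1 + s)) * (A * C + (1 + s))" .
  have sAC: "\<bar>1 + s\<bar> \<le> A * C"
  proof (rule power2_le_imp_le)
    have "(1 + s)\<^sup>2 \<le> (A * C)\<^sup>2"
      using \<open>(norm (a - c))\<^sup>2 \<le> (A * C)\<^sup>2 - (1 + s)\<^sup>2\<close> zero_le_power2[of "norm (a - c)"] by linarith
    thus "\<bar>1 + s\<bar>\<^sup>2 \<le> (A * C)\<^sup>2" by simp
  qed (use A C in auto)
  have "(A * C - (1 + s)) * (A * C + (1 + s)) \<le> (A * C - (1 + s)) * (2 * (A * C))"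
    using sAC by (intro mult_left_mono) auto
  with 1 have 2: "(norm (a - c))\<^sup>2 \<le> (A * C - (1 + s)) * (2 * (A * C))" by linarith
  have "A - C - (c \<bullet> (a - c)) / C = (A * C - (1 + s)) / C"
  proof -
    have "c \<bullet> (a - c) = s - (C\<^sup>2 - 1)" using C by (simp add: inner_diff_right s_def inner_commute)
    thus ?thesis using C(1) by (simp add: field_simps power2_eq_square)
  qed
  moreover have "(norm (a - c))\<^sup>2 / (2 * A * C\<^sup>2) \<le> (A * C - (1 + s)) / C"
  proof -
    have "(norm (a - c))\<^sup>2 / (2 * A * C\<^sup>2) \<le> (A * C - (1 + s)) * (2 * (A * C)) / (2 * A * C\<^sup>2)"
      using 2 A C by (intro divide_right_mono) auto
    also have "\<dots> = (A * C - (1 + s)) / C" using A(1) C(1) by (simp add: power2_eq_square)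
    finally show ?thesis .
  qed
  ultimately show ?thesis by (simp add: A_def C_def)
qed

definition japanese_gap :: "'b::real_inner \<Rightarrow> 'b \<Rightarrow> real" where
  "japanese_gap a b = japanese a / 2 + japanese b / 2 - japanese ((1/2) *\<^sub>R (a + b))"

lemma japanese_gap_ge:
  fixes a b :: "'b::real_inner"
  defines "c \<equiv> (1/2) *\<^sub>R (a + b)"
  shows "(norm (a - b))\<^sup>2 / 16 * (1 / (japanese a * (japanese c)\<^sup>2) + 1 / (japanese b * (japanese c)\<^sup>2))
    \<le> japanese_gap a b"
proof -
  have e: "a - c = (1/2) *\<^sub>R (a - b)" "b - c = - ((1/2) *\<^sub>R (a - b))"
    unfolding c_def by (simp_all add: scaleR_left_diff_distrib algebra_simps)
      (metis add.commute add_diff_cancel_left' diff_add_cancel scaleR_half_double scaleR_add_right)+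
  have n: "(norm (a - c))\<^sup>2 = (norm (a - b))\<^sup>2 / 4" "(norm (b - c))\<^sup>2 = (norm (a - b))\<^sup>2 / 4"
    unfolding e by (simp_all add: power2_eq_square)
  have i: "c \<bullet> (b - c) = - (c \<bullet> (a - c))" unfolding e by simp
  from japanese_tangent[of a c] japanese_tangent[of b c]
  have "(norm (a - b))\<^sup>2 / 4 / (2 * japanese a * (japanese c)\<^sup>2) + (norm (a - b))\<^sup>2 / 4 / (2 * japanese b * (japanese c)\<^sup>2)
     \<le> japanese a + japanese b - 2 * japanese c"
    unfolding n i by simp
  moreover have "X / 16 * (1 / (A * C) + 1 / (B * C)) = (X / 4 / (2 * A * C) + X / 4 / (2 * B * C)) / 2" for X A B C :: real
    by (simp add: add_divide_distrib distrib_left)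
  ultimately show ?thesis by (simp only: japanese_gap_def c_def[symmetric]) simp
qed

lemma japanese_gap_nonneg: "0 \<le> japanese_gap a b"
proof (rule order_trans[OF _ japanese_gap_ge])
  have "japanese x > 0" for x :: 'a using japanese_bounds(1)[of x] by linarith
  thus "0 \<le> (norm (a - b))\<^sup>2 / 16 * (1 / (japanese a * (japanese ((1/2) *\<^sub>R (a + b)))\<^sup>2) + 1 / (japanese b * (japanese ((1/2) *\<^sub>R (a + b)))\<^sup>2))"
    by (intro mult_nonneg_nonneg add_nonneg_nonneg divide_nonneg_nonneg zero_le_power2) (auto simp: less_imp_le)
qed

text \<open>Two points of moderate norm are controlled by the convexity gap; large points are controlled
  by their excess over \<open>S\<close>.\<close>

lemma norm_diff_le_japanese_gap:
  fixes a b :: "'b::real_inner"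
  assumes \<tau>: "\<tau> > 0" and S: "S \<ge> 0"
  shows "norm (a - b) \<le> \<tau> + 8 * (1 + 2 * S)^3 / \<tau> * japanese_gap a b
    + 4 * max 0 (norm a - S) + 4 * max 0 (norm b - S)"
proof (cases "norm a \<le> 2 * S \<and> norm b \<le> 2 * S")
  case True
  define c where "c = (1/2) *\<^sub>R (a + b)"
  define T where "T = 1 + 2 * S"
  have T: "T > 0" using S by (simp add: T_def)
  have "norm c \<le> 2 * S" using True norm_triangle_ineq[of a b] by (simp add: c_def)
  hence j: "japanese a \<le> T" "japanese b \<le> T" "japanese c \<le> T"
    using True japanese_bounds(3)[of a] japanese_bounds(3)[of b] japanese_bounds(3)[of c]
    unfolding T_def by linarith+
  have p: "japanese x > 0" for x :: 'b using japanese_bounds(1)[of x] by linarith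
  have k: "1 / T^3 \<le> 1 / (japanese x * (japanese c)\<^sup>2)" if "japanese x \<le> T" for x :: 'b
  proof -
    have "japanese x * (japanese c)\<^sup>2 \<le> T * T\<^sup>2"
      using j that p T by (intro mult_mono power_mono) (auto simp: less_imp_le)
    also have "\<dots> = T^3" by (simp add: power2_eq_square power3_eq_cube)
    finally show ?thesis using T by (intro divide_left_mono mult_pos_pos zero_less_power p) simp_all
  qed
  have "(norm (a - b))\<^sup>2 / 16 * (1 / T^3 + 1 / T^3) \<le> japanese_gap a b"
    by (rule order_trans[OF mult_left_mono japanese_gap_ge[of a b, folded c_def]])
      (use k[OF j(1)] k[OF j(2)] in \<open>intro add_mono, auto\<close>)
  hence "(norm (a - b))\<^sup>2 \<le> 8 * T^3 * japanese_gap a b" using T by (simp add: field_simps)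
  hence "(norm (a - b))\<^sup>2 / \<tau> \<le> 8 * T^3 / \<tau> * japanese_gap a b" using \<tau> by (simp add: field_simps)
  moreover have "norm (a - b) \<le> \<tau> + (norm (a - b))\<^sup>2 / \<tau>"
  proof (cases "norm (a - b) \<le> \<tau>")
    case True
    thus ?thesis using \<tau> by (simp add: add_increasing2)
  next
    case False
    hence "norm (a - b) * \<tau> \<le> norm (a - b) * norm (a - b)" by (intro mult_left_mono) auto
    hence "norm (a - b) \<le> (norm (a - b))\<^sup>2 / \<tau>" using \<tau> by (simp add: field_simps power2_eq_square)
    thus ?thesis using \<tau> by linarith
  qed
  ultimately show ?thesis unfolding T_def by (smt (verit) max.cobounded1)
next
  case False
  have "0 \<le> 8 * (1 + 2 * S)^3 / \<tau> * japanese_gap a b"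
    using \<tau> S by (intro mult_nonneg_nonneg divide_nonneg_nonneg japanese_gap_nonneg) auto
  moreover have "norm (a - b) \<le> norm a + norm b" by (rule norm_triangle_ineq4)
  moreover have "norm a + norm b \<le> 4 * max 0 (norm a - S) + 4 * max 0 (norm b - S)"
    using False S unfolding max_def by (auto split: if_splits)
  ultimately show ?thesis using \<tau> by linarith
qed

lemma continuous_on_japanese: "continuous_on UNIV (japanese :: 'b::real_inner \<Rightarrow> real)"
  unfolding japanese_def by (intro continuous_intros)

lemma borel_measurable_japanese [measurable]:
  "(japanese :: 'b::euclidean_space \<Rightarrow> real) \<in> borel_measurable borel"
  by (rule borel_measurable_continuous_onI[OF continuous_on_japanese])

text \<open>A uniformly integrable convex family need not be compact in \<open>L\<^sup>1\<close>. However, minimising a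
  strictly convex functional of linear growth over smaller and smaller convex subfamilies produces a
  Cauchy sequence: the increasing minimal values converge, so midpoints of near-minimisers gain
  little, and a small convexity gap forces the minimisers together. The limit is approximated from
  within every single constraint set, because adding one more constraint to a late stage does not
  change the minimal value much.\<close>

theorem nested_convex_L1_limit:
  fixes X :: "('a \<Rightarrow> 'b::euclidean_space) set" and K :: "'i \<Rightarrow> ('a \<Rightarrow> 'b) set"
  assumes "finite_measure M"
    and int: "\<And>P. P \<in> X \<Longrightarrow> integrable M P"
    and ui: "\<And>\<epsilon>. \<epsilon> > 0 \<Longrightarrow> \<exists>S\<ge>0. \<forall>P\<in>X. (\<integral>x. max 0 (norm (P x) - S) \<partial>M) \<le> \<epsilon>"
    and midX: "\<And>P Q. P \<in> X \<Longrightarrow> Q \<in> X \<Longrightarrow> (\<lambda>x. (1/2) *\<^sub>R (P x + Q x)) \<in> X"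
    and midK: "\<And>i P Q. i \<in> I \<Longrightarrow> P \<in> X \<inter> K i \<Longrightarrow> Q \<in> X \<inter> K i \<Longrightarrow> (\<lambda>x. (1/2) *\<^sub>R (P x + Q x)) \<in> K i"
    and fip: "\<And>F. finite F \<Longrightarrow> F \<subseteq> I \<Longrightarrow> \<exists>P\<in>X. \<forall>i\<in>F. P \<in> K i"
  obtains Q P where "\<And>n. Q n \<in> X" "P = (\<lambda>x. lim (\<lambda>n. Q n x))" "integrable M P"
    "AE x in M. (\<lambda>n. Q n x) \<longlonglongrightarrow> P x" "(\<lambda>n. \<integral>x. norm (Q n x - P x) \<partial>M) \<longlonglongrightarrow> 0"
    "\<And>i. i \<in> I \<Longrightarrow> \<exists>R. (\<forall>n. R n \<in> X \<inter> K i) \<and> (\<lambda>n. \<integral>x. norm (R n x - P x) \<partial>M) \<longlonglongrightarrow> 0"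
proof -
  interpret finite_measure M by fact
  define \<Theta> where "\<Theta> = (\<lambda>P::'a \<Rightarrow> 'b. \<integral>x. japanese (P x) \<partial>M)"
  define XF where "XF = (\<lambda>F. {P \<in> X. \<forall>i\<in>F. P \<in> K i})"
  have intT: "integrable M (\<lambda>x. japanese (P x))" if "P \<in> X" for P
  proof (rule Bochner_Integration.integrable_bound)
    show "integrable M (\<lambda>x. 1 + norm (P x))" using int[OF that] by auto
    have [measurable]: "P \<in> borel_measurable M" using int[OF that] by auto
    show "(\<lambda>x. japanese (P x)) \<in> borel_measurable M" by measurable
    have "norm (japanese p) \<le> norm (1 + norm p)" for p :: 'b
      using japanese_bounds(1)[of p] japanese_bounds(3)[of p] by simp
    thus "AE x in M. norm (japanese (P x)) \<le> norm (1 + norm (P x))" by simp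
  qed
  have intm: "integrable M (\<lambda>x. max 0 (norm (P x) - S))" if "P \<in> X" for P S
    using int[OF that] by (intro integrable_max Bochner_Integration.integrable_diff integrable_norm) auto
  have \<Theta>0: "0 \<le> \<Theta> P" for P
    unfolding \<Theta>_def by (intro integral_nonneg_AE AE_I2) (smt (verit) japanese_bounds(1))
  obtain B where B: "\<And>P. P \<in> X \<Longrightarrow> \<Theta> P \<le> B"
  proof -
    obtain S where S: "\<And>P. P \<in> X \<Longrightarrow> (\<integral>x. max 0 (norm (P x) - S) \<partial>M) \<le> 1" using ui[of 1] by auto
    have "\<Theta> P \<le> measure M (space M) * (1 + S) + 1" if P: "P \<in> X" for P
    proof -
      have "\<Theta> P \<le> (\<integral>x. (1 + S) + max 0 (norm (P x) - S) \<partial>M)"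
        unfolding \<Theta>_def
      proof (rule integral_mono[OF intT[OF P]])
        show "integrable M (\<lambda>x. (1 + S) + max 0 (norm (P x) - S))" using intm[OF P] by auto
        show "japanese (P x) \<le> (1 + S) + max 0 (norm (P x) - S)" for x
          using japanese_bounds(3)[of "P x"] by linarith
      qed
      also have "\<dots> = measure M (space M) * (1 + S) + (\<integral>x. max 0 (norm (P x) - S) \<partial>M)"
        using intm[OF P] by simp
      finally show ?thesis using S[OF P] by linarith
    qed
    thus ?thesis using that by blast
  qed
  define d where "d = (\<lambda>F. Inf (\<Theta> ` XF F))"
  have XFne: "XF F \<noteq> {}" if "finite F" "F \<subseteq> I" for F using fip[OF that] by (auto simp: XF_def)
  have bdd: "bdd_below (\<Theta> ` XF F)" for F using \<Theta>0 by (intro bdd_belowI[of _ 0]) auto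
  have dle: "d F \<le> \<Theta> P" if "P \<in> XF F" for F P
    unfolding d_def using that bdd by (intro cInf_lower) auto
  have dB: "d F \<le> B" if F: "finite F" "F \<subseteq> I" for F
  proof -
    obtain P where "P \<in> XF F" using XFne[OF F] by auto
    thus ?thesis using dle[of P F] B[of P] by (auto simp: XF_def)
  qed
  define \<F> where "\<F> = {F. finite F \<and> F \<subseteq> I}"
  define s where "s = Sup (d ` \<F>)"
  have \<F>ne: "\<F> \<noteq> {}" by (auto simp: \<F>_def)
  have dbdd: "bdd_above (d ` \<F>)" using dB by (intro bdd_aboveI[of _ B]) (auto simp: \<F>_def)
  have ds: "d F \<le> s" if "F \<in> \<F>" for F unfolding s_def using that dbdd by (intro cSup_upper) auto
  define \<delta> where "\<delta> = (\<lambda>n::nat. 1 / real (Suc n))"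
  have \<delta>: "\<delta> n > 0" "m \<le> n \<Longrightarrow> \<delta> n \<le> \<delta> m" for n m by (auto simp: \<delta>_def field_simps)
  have "\<forall>n. \<exists>F\<in>\<F>. s - \<delta> n < d F"
  proof
    fix n
    have "s - \<delta> n < Sup (d ` \<F>)" using \<delta>(1)[of n] by (simp add: s_def)
    thus "\<exists>F\<in>\<F>. s - \<delta> n < d F" using less_cSup_iff[of "d ` \<F>"] \<F>ne dbdd by auto
  qed
  then obtain Fs where Fs: "\<And>n. Fs n \<in> \<F>" "\<And>n. s - \<delta> n < d (Fs n)" by metis
  define G where "G = (\<lambda>n. \<Union>k\<le>n. Fs k)"
  have G: "G n \<in> \<F>" "m \<le> n \<Longrightarrow> Fs m \<subseteq> G n" for m n using Fs(1) by (auto simp: G_def \<F>_def)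
  have near: "\<exists>P. P \<in> XF F \<and> \<Theta> P < s + \<delta> n" if "F \<in> \<F>" for F n
  proof -
    have "Inf (\<Theta> ` XF F) < s + \<delta> n" using ds[OF that] \<delta>(1)[of n] by (simp add: d_def)
    thus ?thesis using cInf_less_iff[of "\<Theta> ` XF F"] bdd XFne that by (auto simp: \<F>_def)
  qed
  \<comment> \<open>Near-minimisers of the same late stage are close: the midpoint is at least \<open>s - \<delta> n\<close>, which
    bounds the integrated convexity gap.\<close>
  have close: "\<exists>N. \<forall>n P Q. n \<ge> N \<longrightarrow> P \<in> XF (Fs n) \<longrightarrow> Q \<in> XF (Fs n) \<longrightarrow> \<Theta> P < s + \<delta> n \<longrightarrow> \<Theta> Q < s + \<delta> n
      \<longrightarrow> (\<integral>x. norm (P x - Q x) \<partial>M) < \<epsilon>" if \<epsilon>: "\<epsilon> > 0" for \<epsilon>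
  proof -
    define m where "m = measure M (space M)"
    define \<tau> where "\<tau> = \<epsilon> / (4 * (m + 1))"
    have m: "m \<ge> 0" by (simp add: m_def)
    have \<tau>: "\<tau> > 0" "m * \<tau> \<le> \<epsilon> / 4"
      using \<epsilon> m by (auto simp: \<tau>_def field_simps)
    obtain S where S: "S \<ge> 0" "\<And>P. P \<in> X \<Longrightarrow> (\<integral>x. max 0 (norm (P x) - S) \<partial>M) \<le> \<epsilon> / 32"
      using ui[of "\<epsilon> / 32"] \<epsilon> by auto
    define L where "L = 8 * (1 + 2 * S)^3 / \<tau>"
    have L: "L > 0" using S \<tau> by (auto simp: L_def)
    obtain N where N: "\<delta> N < \<epsilon> / (8 * L)" using reals_Archimedean[of "\<epsilon> / (8 * L)"] \<epsilon> L
      by (auto simp: \<delta>_def inverse_eq_divide)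
    show ?thesis
    proof (intro exI[of _ N] allI impI)
      fix n P Q assume n: "n \<ge> N" and P: "P \<in> XF (Fs n)" and Q: "Q \<in> XF (Fs n)"
        and lt: "\<Theta> P < s + \<delta> n" "\<Theta> Q < s + \<delta> n"
      define R where "R = (\<lambda>x. (1/2) *\<^sub>R (P x + Q x))"
      have PX: "P \<in> X" "Q \<in> X" using P Q by (auto simp: XF_def)
      have R: "R \<in> XF (Fs n)" using P Q midX[of P Q] midK[of _ P Q] Fs(1)[of n]
        by (auto simp: XF_def R_def \<F>_def)
      have RX: "R \<in> X" using R by (auto simp: XF_def)
      have "s - \<delta> n < \<Theta> R" using dle[OF R] Fs(2)[of n] by linarith
      moreover have gi: "integrable M (\<lambda>x. japanese_gap (P x) (Q x))"
        unfolding japanese_gap_def R_def[symmetric]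
        using intT[OF PX(1)] intT[OF PX(2)] intT[OF RX] by (auto simp: R_def)
      moreover have "(\<integral>x. japanese_gap (P x) (Q x) \<partial>M) = \<Theta> P / 2 + \<Theta> Q / 2 - \<Theta> R"
        unfolding japanese_gap_def \<Theta>_def
        using intT[OF PX(1)] intT[OF PX(2)] intT[OF RX] by (simp add: R_def)
      ultimately have g: "(\<integral>x. japanese_gap (P x) (Q x) \<partial>M) \<le> 2 * \<delta> n" using lt by linarith
      have "(\<integral>x. norm (P x - Q x) \<partial>M) \<le> (\<integral>x. \<tau> + L * japanese_gap (P x) (Q x)
           + 4 * max 0 (norm (P x) - S) + 4 * max 0 (norm (Q x) - S) \<partial>M)"
      proof (rule integral_mono)
        show "integrable M (\<lambda>x. norm (P x - Q x))" using int PX by auto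
        show "integrable M (\<lambda>x. \<tau> + L * japanese_gap (P x) (Q x)
           + 4 * max 0 (norm (P x) - S) + 4 * max 0 (norm (Q x) - S))"
          using gi intm PX by auto
        show "norm (P x - Q x) \<le> \<tau> + L * japanese_gap (P x) (Q x)
           + 4 * max 0 (norm (P x) - S) + 4 * max 0 (norm (Q x) - S)" for x
          unfolding L_def by (rule norm_diff_le_japanese_gap[OF \<tau>(1) S(1)])
      qed
      also have "\<dots> = m * \<tau> + L * (\<integral>x. japanese_gap (P x) (Q x) \<partial>M)
         + 4 * (\<integral>x. max 0 (norm (P x) - S) \<partial>M) + 4 * (\<integral>x. max 0 (norm (Q x) - S) \<partial>M)"
        using gi intm[OF PX(1)] intm[OF PX(2)] by (simp add: m_def)
      also have "\<dots> \<le> \<epsilon> / 4 + L * (2 * \<delta> N) + 4 * (\<epsilon> / 32) + 4 * (\<epsilon> / 32)"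
        using \<tau>(2) S(2)[OF PX(1)] S(2)[OF PX(2)] g \<delta>(2)[OF n] L
        by (intro add_mono mult_left_mono) auto
      also have "L * (2 * \<delta> N) < \<epsilon> / 4" using N L by (simp add: field_simps)
      finally show "(\<integral>x. norm (P x - Q x) \<partial>M) < \<epsilon>" using \<epsilon> by simp
    qed
  qed
  have "\<forall>n. \<exists>P. P \<in> XF (G n) \<and> \<Theta> P < s + \<delta> n" using near G by blast
  then obtain Q0 where Q0: "\<And>n. Q0 n \<in> XF (G n)" "\<And>n. \<Theta> (Q0 n) < s + \<delta> n" by metis
  have cau: "\<exists>N. \<forall>n\<ge>N. \<forall>m\<ge>n. (\<integral>x. norm (Q0 m x - Q0 n x) \<partial>M) < \<epsilon>" if \<epsilon>: "\<epsilon> > 0" for \<epsilon>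
  proof -
    obtain N where N: "\<And>n P Q. n \<ge> N \<Longrightarrow> P \<in> XF (Fs n) \<Longrightarrow> Q \<in> XF (Fs n) \<Longrightarrow> \<Theta> P < s + \<delta> n
      \<Longrightarrow> \<Theta> Q < s + \<delta> n \<Longrightarrow> (\<integral>x. norm (P x - Q x) \<partial>M) < \<epsilon>" using close[OF \<epsilon>] by blast
    have "(\<integral>x. norm (Q0 m x - Q0 n x) \<partial>M) < \<epsilon>" if "n \<ge> N" "m \<ge> n" for m n
    proof (rule N[OF that(1)])
      show "Q0 m \<in> XF (Fs n)" "Q0 n \<in> XF (Fs n)"
        using Q0(1)[of m] Q0(1)[of n] G(2)[of n n] G(2)[OF that(2)] by (auto simp: XF_def)
      show "\<Theta> (Q0 m) < s + \<delta> n" using Q0(2)[of m] \<delta>(2)[OF that(2)] by linarith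
    qed (rule Q0)
    thus ?thesis by blast
  qed
  have "\<forall>k. \<exists>N. \<forall>n\<ge>N. \<forall>m\<ge>n. (\<integral>x. norm (Q0 m x - Q0 n x) \<partial>M) < (1/2)^k" using cau by simp
  then obtain Nk where Nk: "\<And>k n m. n \<ge> Nk k \<Longrightarrow> m \<ge> n \<Longrightarrow> (\<integral>x. norm (Q0 m x - Q0 n x) \<partial>M) < (1/2)^k" by metis
  \<comment> \<open>A subsequence with summable increments; the sum makes it monotone and beyond every \<open>Nk k\<close>.\<close>
  define r where "r = (\<lambda>k. k + (\<Sum>j\<le>k. Nk j))"
  have r: "r k \<ge> Nk k" "r (Suc k) \<ge> r k" "r k \<ge> k" for k
  proof -
    have "Nk k \<le> (\<Sum>j\<le>k. Nk j)" by (intro member_le_sum) auto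
    thus "r k \<ge> Nk k" by (simp add: r_def)
  qed (auto simp: r_def)
  define Q where "Q = (\<lambda>k. Q0 (r k))"
  define P where "P = (\<lambda>x. lim (\<lambda>n. Q n x))"
  have QX: "Q n \<in> X" for n using Q0(1)[of "r n"] by (auto simp: Q_def XF_def)
  have fast: "(\<integral>x. norm (Q (Suc n) x - Q n x) \<partial>M) \<le> (1/2)^n" for n
    using Nk[OF r(1) r(2), of n] by (simp add: Q_def less_imp_le)
  have lim: "AE x in M. (\<lambda>n. Q n x) \<longlonglongrightarrow> P x" "integrable M P"
    "(\<lambda>n. \<integral>x. norm (Q n x - P x) \<partial>M) \<longlonglongrightarrow> 0"
    unfolding P_def by (rule L1_fast_Cauchy_limit[OF int[OF QX] fast])+
  have cons: "\<exists>R. (\<forall>n. R n \<in> X \<inter> K i) \<and> (\<lambda>n. \<integral>x. norm (R n x - P x) \<partial>M) \<longlonglongrightarrow> 0" if i: "i \<in> I" for i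
  proof -
    have "\<forall>n. \<exists>P. P \<in> XF (insert i (G n)) \<and> \<Theta> P < s + \<delta> n"
      using near G(1) i by (auto simp: \<F>_def)
    then obtain R0 where R0: "\<And>n. R0 n \<in> XF (insert i (G n))" "\<And>n. \<Theta> (R0 n) < s + \<delta> n" by metis
    have R0X: "R0 n \<in> X" "R0 n \<in> K i" for n using R0(1)[of n] by (auto simp: XF_def)
    have near0: "(\<lambda>n. \<integral>x. norm (R0 n x - Q0 n x) \<partial>M) \<longlonglongrightarrow> 0"
    proof (rule LIMSEQ_I)
      fix \<epsilon> :: real assume \<epsilon>: "\<epsilon> > 0"
      obtain N where N: "\<And>n P Q. n \<ge> N \<Longrightarrow> P \<in> XF (Fs n) \<Longrightarrow> Q \<in> XF (Fs n) \<Longrightarrow> \<Theta> P < s + \<delta> n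
        \<Longrightarrow> \<Theta> Q < s + \<delta> n \<Longrightarrow> (\<integral>x. norm (P x - Q x) \<partial>M) < \<epsilon>" using close[OF \<epsilon>] by blast
      have "(\<integral>x. norm (R0 n x - Q0 n x) \<partial>M) < \<epsilon>" if "n \<ge> N" for n
      proof (rule N[OF that])
        show "R0 n \<in> XF (Fs n)" "Q0 n \<in> XF (Fs n)"
          using Q0(1)[of n] R0(1)[of n] G(2)[of n n] by (auto simp: XF_def)
      qed (rule R0 Q0)+
      thus "\<exists>N. \<forall>n\<ge>N. norm ((\<integral>x. norm (R0 n x - Q0 n x) \<partial>M) - 0) < \<epsilon>" by auto
    qed
    have sub: "(\<lambda>n. \<integral>x. norm (R0 (r n) x - Q n x) \<partial>M) \<longlonglongrightarrow> 0"
      unfolding Q_def using filterlim_compose[OF near0 filterlim_at_top_mono[OF filterlim_ident, of r]] r(3)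
      by (simp add: eventually_sequentially)
    have "(\<lambda>n. \<integral>x. norm (R0 (r n) x - P x) \<partial>M) \<longlonglongrightarrow> 0"
    proof (rule tendsto_sandwich[OF _ _ tendsto_const])
      show "(\<lambda>n. (\<integral>x. norm (R0 (r n) x - Q n x) \<partial>M) + (\<integral>x. norm (Q n x - P x) \<partial>M)) \<longlonglongrightarrow> 0"
        using tendsto_add[OF sub lim(3)] by simp
      have "(\<integral>x. norm (R0 (r n) x - P x) \<partial>M) \<le> (\<integral>x. norm (R0 (r n) x - Q n x) + norm (Q n x - P x) \<partial>M)" for n
        using int[OF R0X(1)] int[OF QX] lim(2) norm_triangle_ineq[of "R0 (r n) x - Q n x" "Q n x - P x" for x]
        by (intro integral_mono) auto
      thus "\<forall>\<^sub>F n in sequentially. (\<integral>x. norm (R0 (r n) x - P x) \<partial>M)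
          \<le> (\<integral>x. norm (R0 (r n) x - Q n x) \<partial>M) + (\<integral>x. norm (Q n x - P x) \<partial>M)"
        using int[OF R0X(1)] int[OF QX] lim(2) by simp
    qed auto
    thus ?thesis using R0X by (intro exI[of _ "\<lambda>n. R0 (r n)"]) auto
  qed
  show ?thesis
    by (rule that[OF QX P_def lim(2,1,3) cons])
qed

section \<open>Finite systems of convex inequalities\<close>

text \<open>This is a finite minimax theorem without compactness, hence with an error \<open>\<epsilon>\<close>. Choose \<open>y\<close>
  such that the squared length of its positive part is nearly minimal. With this positive part as
  weights there is a \<open>z\<close> with non-positive weighted sum, and moving from \<open>y\<close> towards \<open>z\<close> would lower the
  squared length substantially unless it is almost zero.\<close>

lemma finite_convex_system:
  fixes Y :: "('i \<Rightarrow> real) set"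
  assumes I: "finite I"
    and conv: "\<And>y z t. y \<in> Y \<Longrightarrow> z \<in> Y \<Longrightarrow> 0 \<le> t \<Longrightarrow> t \<le> 1 \<Longrightarrow> (\<lambda>i. (1 - t) * y i + t * z i) \<in> Y"
    and bound: "\<And>y i. y \<in> Y \<Longrightarrow> i \<in> I \<Longrightarrow> \<bar>y i\<bar> \<le> C"
    and ne: "Y \<noteq> {}"
    and weighted: "\<And>\<mu>. (\<And>i. i \<in> I \<Longrightarrow> 0 \<le> \<mu> i) \<Longrightarrow> (\<Sum>i\<in>I. \<mu> i) = 1 \<Longrightarrow> \<exists>z\<in>Y. (\<Sum>i\<in>I. \<mu> i * z i) \<le> 0"
    and \<epsilon>: "\<epsilon> > 0"
  shows "\<exists>y\<in>Y. \<forall>i\<in>I. y i \<le> \<epsilon>"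
proof -
  define p where "p = (\<lambda>(y::'i \<Rightarrow> real) i. max 0 (y i))"
  define Q where "Q = (\<lambda>y. \<Sum>i\<in>I. (p y i)\<^sup>2)"
  have Q0: "Q y \<ge> 0" for y unfolding Q_def by (intro sum_nonneg) auto
  define d where "d = Inf (Q ` Y)"
  have bdd: "bdd_below (Q ` Y)" using Q0 by (intro bdd_belowI[of _ 0]) auto
  have dle: "d \<le> Q y" if "y \<in> Y" for y unfolding d_def using that bdd by (intro cInf_lower) auto
  have d0: "d \<ge> 0" unfolding d_def using ne Q0 by (intro cInf_greatest) auto
  define B where "B = (\<Sum>i\<in>I. (2 * C)\<^sup>2) + 1"
  have B: "B > 0" unfolding B_def by (intro add_nonneg_pos sum_nonneg) auto
  \<comment> \<open>The positive part of a sum is at most the modulus of the positive part plus the increment, so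
    the squared length behaves like a quadratic function along the segment towards \<open>z\<close>.\<close>
  have step: "\<exists>z\<in>Y. Q z \<le> (1 - 2 * t) * Q y + t\<^sup>2 * B" if y: "y \<in> Y" and t: "0 \<le> t" "t \<le> 1" for y t
  proof (cases "Q y = 0")
    case True
    thus ?thesis using y B t by (intro bexI[of _ y]) auto
  next
    case False
    define S where "S = (\<Sum>i\<in>I. p y i)"
    have p0: "p y i \<ge> 0" for i by (simp add: p_def)
    have "S \<noteq> 0"
    proof
      assume "S = 0"
      hence "\<forall>i\<in>I. p y i = 0" using sum_nonneg_eq_0_iff[OF I, of "p y"] p0 by (simp add: S_def)
      hence "Q y = 0" unfolding Q_def by simp
      thus False using False by simp
    qed
    moreover have "S \<ge> 0" unfolding S_def by (intro sum_nonneg p0)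
    ultimately have S: "S > 0" by simp
    have "\<exists>z\<in>Y. (\<Sum>i\<in>I. p y i / S * z i) \<le> 0"
      by (rule weighted) (use S p0 in \<open>auto simp: S_def simp flip: sum_divide_distrib\<close>)
    then obtain z where z: "z \<in> Y" "(\<Sum>i\<in>I. p y i / S * z i) \<le> 0" by blast
    have "(\<Sum>i\<in>I. p y i / S * z i) = (\<Sum>i\<in>I. p y i * z i) / S" by (simp add: sum_divide_distrib)
    hence pz: "(\<Sum>i\<in>I. p y i * z i) \<le> 0" using z(2) S by (simp add: divide_le_0_iff)
    define x where "x = (\<lambda>i. (1 - t) * y i + t * z i)"
    have "Q x \<le> (\<Sum>i\<in>I. (p y i)\<^sup>2 - 2 * t * (p y i)\<^sup>2 + 2 * t * (p y i * z i) + t\<^sup>2 * (2 * C)\<^sup>2)"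
      unfolding Q_def
    proof (rule sum_mono)
      fix i assume i: "i \<in> I"
      have "p x i \<le> \<bar>p y i + t * (z i - y i)\<bar>" by (auto simp: p_def x_def algebra_simps)
      hence "(p x i)\<^sup>2 \<le> (p y i + t * (z i - y i))\<^sup>2"
        using abs_le_square_iff[of "p x i" "p y i + t * (z i - y i)"] by (simp add: p_def)
      also have "\<dots> = (p y i)\<^sup>2 + 2 * t * (p y i * z i) - 2 * t * (p y i * y i) + t\<^sup>2 * (z i - y i)\<^sup>2"
        by (simp add: power2_eq_square algebra_simps)
      also have "p y i * y i = (p y i)\<^sup>2" by (auto simp: p_def max_def power2_eq_square)
      also have "(z i - y i)\<^sup>2 \<le> (2 * C)\<^sup>2"
        using bound[OF y i] bound[OF z(1) i] by (intro abs_le_square_iff[THEN iffD1]) auto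
      finally show "(p x i)\<^sup>2 \<le> (p y i)\<^sup>2 - 2 * t * (p y i)\<^sup>2 + 2 * t * (p y i * z i) + t\<^sup>2 * (2 * C)\<^sup>2"
        using t by (simp add: mult_left_mono)
    qed
    also have "\<dots> = Q y - 2 * t * Q y + 2 * t * (\<Sum>i\<in>I. p y i * z i) + t\<^sup>2 * (B - 1)"
      by (simp add: sum.distrib sum_subtractf sum_distrib_left Q_def B_def)
    also have "\<dots> \<le> (1 - 2 * t) * Q y + t\<^sup>2 * B"
    proof -
      have "2 * t * (\<Sum>i\<in>I. p y i * z i) \<le> 0" using pz t by (intro mult_nonneg_nonpos) auto
      moreover have "(1 - 2 * t) * Q y = Q y - 2 * t * Q y" "t\<^sup>2 * (B - 1) = t\<^sup>2 * B - t\<^sup>2"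
        by (simp_all add: algebra_simps)
      ultimately show ?thesis using zero_le_power2[of t] by linarith
    qed
    finally show ?thesis using conv[OF y z(1) t] by (auto simp: x_def)
  qed
  have small: "d \<le> t * B" if t: "0 < t" "t \<le> 1/2" for t
  proof -
    have "d < d + t\<^sup>2 * B" using t B by simp
    then obtain y where y: "y \<in> Y" "Q y < d + t\<^sup>2 * B"
      using cInf_less_iff[of "Q ` Y" "d + t\<^sup>2 * B"] ne bdd by (auto simp: d_def)
    obtain z where z: "z \<in> Y" "Q z \<le> (1 - 2 * t) * Q y + t\<^sup>2 * B" using step[OF y(1), of t] t by auto
    have "d \<le> (1 - 2 * t) * Q y + t\<^sup>2 * B" using z dle[OF z(1)] by linarith
    also have "\<dots> \<le> (1 - 2 * t) * (d + t\<^sup>2 * B) + t\<^sup>2 * B" using y t by (intro add_mono mult_left_mono) auto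
    also have "\<dots> \<le> (1 - 2 * t) * d + t\<^sup>2 * B + t\<^sup>2 * B"
    proof -
      have "(1 - 2 * t) * (t\<^sup>2 * B) \<le> 1 * (t\<^sup>2 * B)" using t B by (intro mult_right_mono) auto
      thus ?thesis by (simp add: distrib_left mult.commute)
    qed
    finally have "d \<le> (1 - 2 * t) * d + 2 * (t\<^sup>2 * B)" by linarith
    moreover have "(1 - 2 * t) * d = d - 2 * (t * d)" by (simp add: left_diff_distrib)
    moreover have "t\<^sup>2 * B = t * (t * B)" by (simp add: power2_eq_square)
    ultimately have "t * d \<le> t * (t * B)" by linarith
    thus ?thesis using t by (metis mult_le_cancel_left_pos)
  qed
  have "d < \<epsilon>\<^sup>2"
  proof -
    define t where "t = min (1/2) (\<epsilon>\<^sup>2 / (2 * B))"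
    have t: "0 < t" "t \<le> 1/2" using \<epsilon> B by (auto simp: t_def)
    have "t * B \<le> \<epsilon>\<^sup>2 / (2 * B) * B" using B by (intro mult_right_mono) (auto simp: t_def)
    also have "\<dots> < \<epsilon>\<^sup>2" using \<epsilon> B by simp
    finally show ?thesis using small[OF t] by linarith
  qed
  then obtain y where y: "y \<in> Y" "Q y < \<epsilon>\<^sup>2"
    using cInf_less_iff[of "Q ` Y" "\<epsilon>\<^sup>2"] ne bdd by (auto simp: d_def)
  have "y i \<le> \<epsilon>" if i: "i \<in> I" for i
  proof -
    have "(p y i)\<^sup>2 \<le> Q y" unfolding Q_def by (rule member_le_sum[OF i _ I]) auto
    hence "(p y i)\<^sup>2 \<le> \<epsilon>\<^sup>2" using y by simp
    hence "p y i \<le> \<epsilon>" by (rule power2_le_imp_le) (use \<epsilon> in simp)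
    thus ?thesis by (simp add: p_def)
  qed
  thus ?thesis using y(1) by blast
qed

section \<open>Gradients\<close>

lemma has_derivative_gradient:
  fixes f :: "real^'n \<Rightarrow> real"
  assumes "f differentiable (at x)"
  shows "(f has_derivative (\<lambda>h. gradient f x \<bullet> h)) (at x)"
proof -
  define f' where "f' = frechet_derivative f (at x)"
  have f': "(f has_derivative f') (at x)"
    using assms frechet_derivative_works unfolding f'_def by blast
  have lin: "linear f'" using f' by (rule has_derivative_linear)
  have "f' h = gradient f x \<bullet> h" for h
  proof -
    have "f' h = f' (\<Sum>i\<in>UNIV. (h$i) *\<^sub>R axis i 1)"
      using basis_expansion[of h] by (simp add: scalar_mult_eq_scaleR)
    also have "\<dots> = (\<Sum>i\<in>UNIV. h$i * f' (axis i 1))"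
      by (simp add: linear_sum[OF lin] linear_cmul[OF lin])
    finally show ?thesis
      by (simp add: gradient_def partial_deriv_def f'_def inner_vec_def mult.commute)
  qed
  thus ?thesis using f' by (metis (no_types, lifting) ext)
qed

lemma has_derivative_imp_partial_deriv:
  fixes f :: "real^'n \<Rightarrow> real"
  assumes "(f has_derivative (\<lambda>h. D \<bullet> h)) (at x)"
  shows "partial_deriv i f x = D $ i"
  unfolding partial_deriv_def frechet_derivative_at[OF assms, symmetric] by (simp add: inner_axis)

lemma convex_above_gradient:
  fixes f :: "real^'n \<Rightarrow> real"
  assumes conv: "convex_on UNIV f" and D: "(f has_derivative (\<lambda>h. D \<bullet> h)) (at p)"
  shows "f p + D \<bullet> (q - p) \<le> f q"
proof -
  define \<psi> where "\<psi> = (\<lambda>t::real. f (p + t *\<^sub>R (q - p)))"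
  have "((\<lambda>t. p + t *\<^sub>R (q - p)) has_derivative (\<lambda>t. t *\<^sub>R (q - p))) (at 0)"
    by (auto intro!: derivative_eq_intros)
  hence "(\<psi> has_derivative (\<lambda>t. D \<bullet> (t *\<^sub>R (q - p)))) (at 0)"
    unfolding \<psi>_def by (rule has_derivative_compose[where g = f]) (simp add: D)
  moreover have "(\<lambda>t. D \<bullet> (t *\<^sub>R (q - p))) = (*) (D \<bullet> (q - p))" by (simp add: fun_eq_iff)
  ultimately have "(\<psi> has_field_derivative D \<bullet> (q - p)) (at 0)"
    by (simp only: has_field_derivative_def)
  hence "((\<lambda>t. (\<psi> t - \<psi> 0) / t) \<longlongrightarrow> D \<bullet> (q - p)) (at 0)"
    by (simp add: DERIV_def)
  hence "((\<lambda>t. (\<psi> t - \<psi> 0) / t) \<longlongrightarrow> D \<bullet> (q - p)) (at_right 0)"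
    by (rule tendsto_mono[OF at_le[OF subset_UNIV]])
  hence "D \<bullet> (q - p) \<le> f q - f p"
  proof (rule tendsto_upperbound)
    show "\<forall>\<^sub>F t in at_right 0. (\<psi> t - \<psi> 0) / t \<le> f q - f p"
    proof (rule eventually_at_rightI[of 0 1])
      fix t :: real assume t: "t \<in> {0<..<1}"
      have "p + t *\<^sub>R (q - p) = (1 - t) *\<^sub>R p + t *\<^sub>R q"
        by (simp add: scaleR_left_diff_distrib scaleR_right_diff_distrib)
      hence "\<psi> t \<le> (1 - t) * f p + t * f q"
        using convex_onD[OF conv, of t p q] t unfolding \<psi>_def by simp
      moreover have "\<psi> 0 = f p" by (simp add: \<psi>_def)
      ultimately have "\<psi> t - \<psi> 0 \<le> (f q - f p) * t" by (simp add: algebra_simps)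
      thus "(\<psi> t - \<psi> 0) / t \<le> f q - f p" using t by (simp add: pos_divide_le_eq)
    qed simp
  qed simp
  thus ?thesis by simp
qed

lemma class_C2_derivatives:
  fixes H :: "real^'n \<Rightarrow> real"
  assumes "class_C 2 H"
  shows "(H has_derivative (\<lambda>h. gradient H p \<bullet> h)) (at p)"
    "((\<lambda>p. gradient H p $ j) has_derivative (\<lambda>h. gradient (partial_deriv j H) p \<bullet> h)) (at p)"
    "continuous_on UNIV H" "continuous_on UNIV (gradient H)"
    "continuous_on UNIV (gradient (partial_deriv j H))"
proof -
  have d: "multi_deriv js H differentiable (at x)" if "length js < 2" for js x
    using assms that unfolding class_C_def by blast
  have c: "continuous_on UNIV (multi_deriv js H)" if "length js \<le> 2" for js
    using assms that unfolding class_C_def by blast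
  have g: "gradient H p $ j = partial_deriv j H p" for p j by (simp add: gradient_def)
  show "(H has_derivative (\<lambda>h. gradient H p \<bullet> h)) (at p)"
    using d[of "[]" p] by (intro has_derivative_gradient) (simp add: multi_deriv_def)
  show "((\<lambda>p. gradient H p $ j) has_derivative (\<lambda>h. gradient (partial_deriv j H) p \<bullet> h)) (at p)"
    unfolding g using d[of "[j]" p] by (intro has_derivative_gradient) (simp add: multi_deriv_def)
  show "continuous_on UNIV H" using c[of "[]"] by (simp add: multi_deriv_def)
  have "continuous_on UNIV (partial_deriv i H)" for i using c[of "[i]"] by (simp add: multi_deriv_def)
  thus "continuous_on UNIV (gradient H)"
    unfolding gradient_def by (intro continuous_on_vec_lambda) auto
  have "continuous_on UNIV (partial_deriv i (partial_deriv j H))" for i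
    using c[of "[i, j]"] by (simp add: multi_deriv_def)
  thus "continuous_on UNIV (gradient (partial_deriv j H))"
    unfolding gradient_def by (intro continuous_on_vec_lambda) auto
qed

lemma integrable_torus_mult_continuous:
  fixes h m :: "real^'n \<Rightarrow> real"
  assumes h: "continuous_on (cbox 0 1) h" and m: "integrable torus m"
  shows "integrable torus (\<lambda>x. h x * m x)"
proof -
  obtain B where B: "\<And>x. x \<in> cbox 0 1 \<Longrightarrow> norm (h x) \<le> B"
    using compact_imp_bounded[OF compact_continuous_image[OF h compact_cbox]]
    by (auto simp: bounded_iff)
  show ?thesis
  proof (rule Bochner_Integration.integrable_bound)
    show "integrable torus (\<lambda>x. B * m x)" using m by simp
    show "(\<lambda>x. h x * m x) \<in> borel_measurable torus"
      using integrable_torus_continuous[OF h] m by measurable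
    show "AE x in torus. norm (h x * m x) \<le> norm (B * m x)"
      using AE_torus_cube
    proof eventually_elim
      case (elim x)
      have "\<bar>h x\<bar> \<le> \<bar>B\<bar>" using B[OF elim] by simp
      thus ?case by (simp add: abs_mult mult_right_mono)
    qed
  qed
qed

section \<open>The mean-field game operator on classical pairs\<close>

text \<open>A density of class \<open>C\<^sup>1\<close> and a value function of class \<open>C\<^sup>2\<close>. The derivatives are part of the data,
  so that the operator is an explicit expression in continuous functions.\<close>

datatype 'n test_pair = Test_Pair (dens: "real^'n \<Rightarrow> real") (ddens: "real^'n \<Rightarrow> real^'n")
  (val: "real^'n \<Rightarrow> real") (dval: "real^'n \<Rightarrow> real^'n") (ddval: "real^'n \<Rightarrow> real^'n^'n")

definition classical :: "'n::finite test_pair \<Rightarrow> bool" where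
  "classical t \<longleftrightarrow> C1_torus (dens t) (ddens t) \<and> (\<forall>x\<in>cbox 0 1. 0 \<le> dens t x) \<and>
    C1_torus (val t) (dval t) \<and> (\<forall>j. C1_torus (\<lambda>x. dval t x $ j) (\<lambda>x. ddval t x $ j))"

locale mean_field_game =
  fixes H :: "real^'n \<Rightarrow> real" and g :: "real \<Rightarrow> real" and \<phi> V :: "real^'n \<Rightarrow> real" and \<alpha> :: real
  assumes V: "V \<in> cont_torus"
    and H: "class_C 2 H" "convex_on UNIV H"
    and g: "\<forall>s\<ge>0. g s \<ge> 0" "continuous_on {0..} g" "mono_on {0..} g"
    and \<phi>: "\<phi> \<in> cont_torus" "\<forall>x. \<phi> x > 0" "(\<integral>x. \<phi> x \<partial>torus) = 1"
    and \<alpha>: "\<alpha> > 1"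
    and H_lagrangian: "\<exists>C>0. \<forall>p. - H p + gradient H p \<bullet> p \<ge> 1 / C * norm p powr \<alpha> - C"
    and H_coercive: "\<exists>C>0. \<forall>p. H p \<ge> 1 / C * norm p powr \<alpha> - C"
    and g_superlinear: "\<forall>\<delta>\<in>{0<..<1}. \<exists>C>0. \<forall>m \<in> (Lp_torus 1 \<inter> nonneg_torus :: (real^'n \<Rightarrow> real) set).
      (\<integral>\<^sup>+x. ennreal (m x) \<partial>torus) + (\<integral>\<^sup>+x. ennreal (g (m x)) \<partial>torus)
        \<le> ennreal \<delta> * (\<integral>\<^sup>+x. ennreal (m x * g (m x)) \<partial>torus) + ennreal C"
begin

text \<open>The two components of the operator come from the Hamilton--Jacobi and the Fokker--Planck
  equation.\<close>

definition hjb :: "'n test_pair \<Rightarrow> real^'n \<Rightarrow> real" where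
  "hjb t x = - val t x - H (dval t x) + g (dens t x) - V x"

text \<open>The gradient of the \<open>j\<close>-th component of the flux \<open>w D\<^sub>pH(Dv)\<close>.\<close>

definition flux_deriv :: "'n \<Rightarrow> 'n test_pair \<Rightarrow> real^'n \<Rightarrow> real^'n" where
  "flux_deriv j t x = gradient H (dval t x) $ j *\<^sub>R ddens t x
     + dens t x *\<^sub>R (\<Sum>l\<in>UNIV. gradient (partial_deriv j H) (dval t x) $ l *\<^sub>R (ddval t x $ l))"

definition fpk :: "'n test_pair \<Rightarrow> real^'n \<Rightarrow> real" where
  "fpk t x = dens t x - (\<Sum>j\<in>UNIV. flux_deriv j t x $ j) - \<phi> x"

text \<open>The pairing of the operator at the test pair \<open>t\<close> with the difference \<open>(m, u) - t\<close>.\<close>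

definition minty :: "'n test_pair \<Rightarrow> (real^'n \<Rightarrow> real) \<Rightarrow> (real^'n \<Rightarrow> real) \<Rightarrow> real" where
  "minty t m u = (\<integral>x. hjb t x * (m x - dens t x) \<partial>torus) + (\<integral>x. fpk t x * (u x - val t x) \<partial>torus)"

lemma V_cont: "continuous_on S V" and \<phi>_cont: "continuous_on S \<phi>"
  using V \<phi> by (auto simp: cont_torus_def intro: continuous_on_subset)

lemma classical_cont:
  assumes "classical t"
  shows "continuous_on S (dens t)" "continuous_on S (ddens t)" "continuous_on S (val t)"
    "continuous_on S (dval t)" "continuous_on S (\<lambda>x. ddval t x $ j)"
    "continuous_on S (\<lambda>x. H (dval t x))" "continuous_on S (\<lambda>x. gradient H (dval t x))"
    "continuous_on S (\<lambda>x. gradient (partial_deriv j H) (dval t x))"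
    "continuous_on (cbox 0 1) (\<lambda>x. g (dens t x))"
proof -
  note c = assms[unfolded classical_def]
  show d: "continuous_on S (dens t)" "continuous_on S (ddens t)" "continuous_on S (val t)"
    "continuous_on S (dval t)" "continuous_on S (\<lambda>x. ddval t x $ j)" for S j
    using c C1_torusD(3,4) by blast+
  note H' = class_C2_derivatives[OF H(1)]
  show "continuous_on S (\<lambda>x. H (dval t x))" by (rule continuous_on_compose2[OF H'(3) d(4)]) auto
  show "continuous_on S (\<lambda>x. gradient H (dval t x))" by (rule continuous_on_compose2[OF H'(4) d(4)]) auto
  show "continuous_on S (\<lambda>x. gradient (partial_deriv j H) (dval t x))"
    by (rule continuous_on_compose2[OF H'(5) d(4)]) auto
  show "continuous_on (cbox 0 1) (\<lambda>x. g (dens t x))"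
    by (rule continuous_on_compose2[OF g(2) d(1)]) (use c in auto)
qed

lemma hjb_cont: "classical t \<Longrightarrow> continuous_on (cbox 0 1) (hjb t)"
  unfolding hjb_def by (intro continuous_intros classical_cont V_cont)

lemma flux_deriv_cont: "classical t \<Longrightarrow> continuous_on S (flux_deriv j t)"
  unfolding flux_deriv_def by (intro continuous_intros classical_cont)

lemma fpk_cont: "classical t \<Longrightarrow> continuous_on S (fpk t)"
  unfolding fpk_def by (intro continuous_intros classical_cont \<phi>_cont flux_deriv_cont)

lemma flux_C1:
  assumes t: "classical t"
  shows "C1_torus (\<lambda>x. dens t x * gradient H (dval t x) $ j) (flux_deriv j t)"
proof -
  define G where "G = (\<lambda>x. \<Sum>l\<in>UNIV. gradient (partial_deriv j H) (dval t x) $ l *\<^sub>R (ddval t x $ l))"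
  have "C1_torus (\<lambda>x. gradient H (dval t x) $ j) G"
    unfolding C1_torus_def
  proof (intro conjI allI)
    show "periodic (\<lambda>x. gradient H (dval t x) $ j)"
      using t C1_torus_gradient_periodic unfolding classical_def periodic_def by metis
    show "continuous_on UNIV G" unfolding G_def by (intro continuous_intros classical_cont t)
    fix x
    have "(dval t has_derivative (\<lambda>h. \<chi> l. ddval t x $ l \<bullet> h)) (at x)"
      unfolding has_derivative_componentwise_within[of "dval t"]
      using t by (auto simp: classical_def Basis_vec_def inner_axis intro!: C1_torusD(2))
    hence "((\<lambda>x. gradient H (dval t x) $ j) has_derivative
        (\<lambda>h. gradient (partial_deriv j H) (dval t x) \<bullet> (\<chi> l. ddval t x $ l \<bullet> h))) (at x)"
      by (rule has_derivative_compose[where g = "\<lambda>p. gradient H p $ j"])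
        (rule class_C2_derivatives[OF H(1)])
    moreover have "gradient (partial_deriv j H) (dval t x) \<bullet> (\<chi> l. ddval t x $ l \<bullet> h) = G x \<bullet> h" for h
      by (simp add: G_def inner_vec_def[of "gradient _ _"] inner_sum_left)
    ultimately show "((\<lambda>x. gradient H (dval t x) $ j) has_derivative (\<lambda>h. G x \<bullet> h)) (at x)" by simp
  qed
  from C1_torus_mult[OF _ this, of "dens t" "ddens t"] t
  show ?thesis by (simp add: classical_def flux_deriv_def[abs_def] G_def add.commute)
qed

lemma integral_fpk:
  assumes t: "classical t" and u: "C1_torus u D"
  shows "(\<integral>x. fpk t x * u x \<partial>torus)
    = (\<integral>x. (dens t x - \<phi> x) * u x + dens t x * (gradient H (dval t x) \<bullet> D x) \<partial>torus)"
proof -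
  have uc: "continuous_on S u" "continuous_on S D" for S by (rule C1_torusD[OF u])+
  have i: "integrable torus (\<lambda>x. (dens t x - \<phi> x) * u x)"
    "integrable torus (\<lambda>x. flux_deriv j t x $ j * u x)"
    "integrable torus (\<lambda>x. dens t x * gradient H (dval t x) $ j * D x $ j)" for j
    by (intro integrable_torus_continuous continuous_intros classical_cont \<phi>_cont flux_deriv_cont t uc)+
  have "(\<integral>x. fpk t x * u x \<partial>torus)
    = (\<integral>x. (dens t x - \<phi> x) * u x - (\<Sum>j\<in>UNIV. flux_deriv j t x $ j * u x) \<partial>torus)"
    unfolding fpk_def sum_distrib_right[symmetric] left_diff_distrib[symmetric]
    by (intro Bochner_Integration.integral_cong refl) simp
  also have "\<dots> = (\<integral>x. (dens t x - \<phi> x) * u x \<partial>torus) - (\<Sum>j\<in>UNIV. \<integral>x. flux_deriv j t x $ j * u x \<partial>torus)"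
    using i by simp
  also have "(\<Sum>j\<in>UNIV. \<integral>x. flux_deriv j t x $ j * u x \<partial>torus)
    = - (\<Sum>j\<in>UNIV. \<integral>x. dens t x * gradient H (dval t x) $ j * D x $ j \<partial>torus)"
    using integration_by_parts_torus[OF flux_C1[OF t] u] by (simp add: sum_negf)
  also have "(\<integral>x. (dens t x - \<phi> x) * u x \<partial>torus) - \<dots>
    = (\<integral>x. (dens t x - \<phi> x) * u x + (\<Sum>j\<in>UNIV. dens t x * gradient H (dval t x) $ j * D x $ j) \<partial>torus)"
    using i by simp
  finally show ?thesis by (simp add: inner_vec_def sum_distrib_left mult.assoc)
qed

text \<open>Integration by parts removes the divergence, at the price of a derivative of \<open>u\<close>; in this form the
  pairing contains only first derivatives of the test pair.\<close>

lemma minty_eq: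
  assumes t: "classical t" and m: "continuous_on (cbox 0 1) m" and u: "C1_torus u D"
  shows "minty t m u = (\<integral>x. hjb t x * (m x - dens t x) + (dens t x - \<phi> x) * (u x - val t x)
     + dens t x * (gradient H (dval t x) \<bullet> (D x - dval t x)) \<partial>torus)"
proof -
  have d: "C1_torus (\<lambda>x. u x - val t x) (\<lambda>x. D x - dval t x)"
    using C1_torus_add[OF u C1_torus_scale[of "val t" "dval t" "-1"]] t by (simp add: classical_def)
  note dc = C1_torusD(3,4)[OF d]
  have "integrable torus (\<lambda>x. hjb t x * (m x - dens t x))"
    "integrable torus (\<lambda>x. (dens t x - \<phi> x) * (u x - val t x)
     + dens t x * (gradient H (dval t x) \<bullet> (D x - dval t x)))"
    by (intro integrable_torus_continuous continuous_intros classical_cont[OF t] m hjb_cont[OF t] \<phi>_cont dc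
       C1_torusD[OF u])+
  thus ?thesis unfolding minty_def integral_fpk[OF t d] by (simp add: add.assoc)
qed

text \<open>Monotonicity of the operator: the products of densities and value functions cancel, and what
  remains has a sign because \<open>H\<close> lies above its tangents and \<open>g\<close> is increasing.\<close>

lemma minty_monotone:
  assumes t: "classical t" and s: "classical s"
  shows "minty t (dens s) (val s) + minty s (dens t) (val t) \<le> 0"
proof -
  define F where "F = (\<lambda>t s x. hjb t x * (dens s x - dens t x) + (dens t x - \<phi> x) * (val s x - val t x)
     + dens t x * (gradient H (dval t x) \<bullet> (dval s x - dval t x)))"
  have i: "integrable torus (F t s)" if "classical t" "classical s" for t s
    unfolding F_def
    by (intro integrable_torus_continuous continuous_intros classical_cont that hjb_cont \<phi>_cont)
  have e: "minty t (dens s) (val s) = (\<integral>x. F t s x \<partial>torus)" if "classical t" "classical s" for t s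
    unfolding F_def using that(2) by (intro minty_eq that(1) classical_cont) (auto simp: classical_def)
  have le: "F t s x + F s t x \<le> 0" if x: "x \<in> cbox 0 1" for x
  proof -
    have tang: "H p + gradient H p \<bullet> (q - p) \<le> H q" for p q
      by (rule convex_above_gradient[OF H(2) class_C2_derivatives(1)[OF H(1)]])
    define a b where "a = dens t x" and "b = dens s x"
    define p q where "p = dval t x" and "q = dval s x"
    have ab: "a \<ge> 0" "b \<ge> 0" using s t x by (auto simp: classical_def a_def b_def)
    have gm: "(g b - g a) * (b - a) \<ge> 0"
    proof (cases "a \<le> b")
      case True
      thus ?thesis using mono_onD[OF g(3), of a b] ab by simp
    next
      case False
      thus ?thesis using mono_onD[OF g(3), of b a] ab by (simp add: mult_nonpos_nonpos)
    qed
    have "a * (H p + gradient H p \<bullet> (q - p) - H q) \<le> 0" "b * (H q + gradient H q \<bullet> (p - q) - H p) \<le> 0"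
      using tang[of p q] tang[of q p] ab by (intro mult_nonneg_nonpos; simp)+
    moreover have "F t s x + F s t x = - ((g b - g a) * (b - a)) + a * (H p + gradient H p \<bullet> (q - p) - H q)
       + b * (H q + gradient H q \<bullet> (p - q) - H p)"
      by (simp add: F_def hjb_def a_def[symmetric] b_def[symmetric] p_def[symmetric] q_def[symmetric] algebra_simps)
    ultimately show ?thesis using gm by linarith
  qed
  have "(\<integral>x. F t s x + F s t x \<partial>torus) \<le> (\<integral>x. 0 \<partial>(torus :: (real^'n) measure))"
    by (rule integral_mono) (use i[OF t s] i[OF s t] le in auto)
  thus ?thesis using i[OF t s] i[OF s t] by (simp add: e t s)
qed

text \<open>The part of the pairing that does not depend on \<open>(m, u)\<close>; up to this constant the pairing is
  linear in \<open>(m, u)\<close>, and it extends continuously to all integrable \<open>m\<close> and \<open>u\<close>.\<close>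

definition minty_const :: "'n test_pair \<Rightarrow> real" where
  "minty_const t = (\<integral>x. hjb t x * dens t x \<partial>torus) + (\<integral>x. fpk t x * val t x \<partial>torus)"

lemma minty_affine:
  assumes t: "classical t" and m: "integrable torus m" and u: "integrable torus u"
  shows "minty t m u = (\<integral>x. hjb t x * m x \<partial>torus) + (\<integral>x. fpk t x * u x \<partial>torus) - minty_const t"
proof -
  have "integrable torus (\<lambda>x. hjb t x * m x)" "integrable torus (\<lambda>x. fpk t x * u x)"
    by (intro integrable_torus_mult_continuous hjb_cont fpk_cont t m u)+
  moreover have "integrable torus (\<lambda>x. hjb t x * dens t x)" "integrable torus (\<lambda>x. fpk t x * val t x)"
    by (intro integrable_torus_continuous continuous_intros hjb_cont fpk_cont classical_cont t)+
  ultimately show ?thesis by (simp add: minty_def minty_const_def right_diff_distrib)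
qed

lemma minty_sum:
  assumes t: "classical t" and I: "finite I" "(\<Sum>i\<in>I. \<mu> i) = 1"
    and m: "\<And>i. i \<in> I \<Longrightarrow> integrable torus (m i)" and u: "\<And>i. i \<in> I \<Longrightarrow> integrable torus (u i)"
  shows "minty t (\<lambda>x. \<Sum>i\<in>I. \<mu> i * m i x) (\<lambda>x. \<Sum>i\<in>I. \<mu> i * u i x) = (\<Sum>i\<in>I. \<mu> i * minty t (m i) (u i))"
proof -
  have im: "integrable torus (\<lambda>x. hjb t x * m i x)" "integrable torus (\<lambda>x. fpk t x * u i x)" if "i \<in> I" for i
    by (intro integrable_torus_mult_continuous hjb_cont fpk_cont t m u that)+
  have "minty t (\<lambda>x. \<Sum>i\<in>I. \<mu> i * m i x) (\<lambda>x. \<Sum>i\<in>I. \<mu> i * u i x)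
    = (\<integral>x. (\<Sum>i\<in>I. \<mu> i * (hjb t x * m i x)) \<partial>torus) + (\<integral>x. (\<Sum>i\<in>I. \<mu> i * (fpk t x * u i x)) \<partial>torus)
      - minty_const t"
    by (subst minty_affine[OF t]) (auto intro!: m u simp: sum_distrib_left mult.left_commute)
  also have "\<dots> = (\<Sum>i\<in>I. \<mu> i * (\<integral>x. hjb t x * m i x \<partial>torus)) + (\<Sum>i\<in>I. \<mu> i * (\<integral>x. fpk t x * u i x \<partial>torus))
      - (\<Sum>i\<in>I. \<mu> i * minty_const t)"
    using im I by (simp flip: sum_distrib_right)
  also have "\<dots> = (\<Sum>i\<in>I. \<mu> i * minty t (m i) (u i))"
    by (simp add: minty_affine[OF t m u] algebra_simps sum.distrib sum_subtractf)
  finally show ?thesis .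
qed

lemma minty_convex_combination:
  assumes "classical t" "integrable torus m" "integrable torus u" "integrable torus m'" "integrable torus u'"
  shows "minty t (\<lambda>x. (1 - r) * m x + r * m' x) (\<lambda>x. (1 - r) * u x + r * u' x)
    = (1 - r) * minty t m u + r * minty t m' u'"
  using minty_sum[of t UNIV "\<lambda>b. if b then r else 1 - r" "\<lambda>b. if b then m' else m" "\<lambda>b. if b then u' else u"]
  assms by (simp add: UNIV_bool)

end

context mean_field_game begin

section \<open>A priori bounds\<close>

text \<open>Constant densities turn the integral condition into a pointwise one.\<close>

lemma g_superlinear_pointwise:
  assumes \<delta>: "0 < \<delta>" "\<delta> < 1"
  shows "\<exists>C>0. \<forall>s\<ge>0. s + g s \<le> \<delta> * (s * g s) + C"
proof -
  obtain C where C: "C > 0" "\<forall>m \<in> (Lp_torus 1 \<inter> nonneg_torus :: (real^'n \<Rightarrow> real) set).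
      (\<integral>\<^sup>+x. ennreal (m x) \<partial>torus) + (\<integral>\<^sup>+x. ennreal (g (m x)) \<partial>torus)
        \<le> ennreal \<delta> * (\<integral>\<^sup>+x. ennreal (m x * g (m x)) \<partial>torus) + ennreal C"
    using bspec[OF g_superlinear, of \<delta>] \<delta> unfolding greaterThanLessThan_iff by blast
  have "s + g s \<le> \<delta> * (s * g s) + C" if s: "s \<ge> 0" for s
  proof -
    have "(\<lambda>_. s) \<in> (Lp_torus 1 \<inter> nonneg_torus :: (real^'n \<Rightarrow> real) set)"
      using s by (auto simp: Lp_torus_def nonneg_torus_def periodic_def)
    note bspec[OF C(2) this]
    hence "ennreal s + ennreal (g s) \<le> ennreal \<delta> * ennreal (s * g s) + ennreal C"
      by (simp add: emeasure_torus)
    moreover have "ennreal s + ennreal (g s) = ennreal (s + g s)" using g(1) s by simp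
    moreover have "ennreal \<delta> * ennreal (s * g s) + ennreal C = ennreal (\<delta> * (s * g s) + C)"
      using g(1) s \<delta> C(1) by (simp add: ennreal_mult)
    ultimately have "ennreal (s + g s) \<le> ennreal (\<delta> * (s * g s) + C)" by simp
    moreover have "0 \<le> \<delta> * (s * g s) + C" using g(1) s \<delta> C(1) by simp
    ultimately show ?thesis by (simp only: ennreal_le_iff)
  qed
  thus ?thesis using C(1) by blast
qed

definition gconst :: "real \<Rightarrow> real" where
  "gconst \<delta> = (SOME C. C > 0 \<and> (\<forall>s\<ge>0. s + g s \<le> \<delta> * (s * g s) + C))"

lemma gconst:
  assumes "0 < \<delta>" "\<delta> < 1"
  shows "gconst \<delta> > 0" "s \<ge> 0 \<Longrightarrow> s + g s \<le> \<delta> * (s * g s) + gconst \<delta>"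
proof -
  have "\<exists>C. C > 0 \<and> (\<forall>s\<ge>0. s + g s \<le> \<delta> * (s * g s) + C)" using g_superlinear_pointwise[OF assms] .
  hence *: "gconst \<delta> > 0 \<and> (\<forall>s\<ge>0. s + g s \<le> \<delta> * (s * g s) + gconst \<delta>)"
    unfolding gconst_def by (rule someI_ex)
  thus "gconst \<delta> > 0" "s \<ge> 0 \<Longrightarrow> s + g s \<le> \<delta> * (s * g s) + gconst \<delta>" by blast+
qed

text \<open>Where \<open>s\<close> exceeds twice the constant, at least half of \<open>s\<close> is left after subtracting it.\<close>

lemma excess_le:
  assumes \<delta>: "0 < \<delta>" "\<delta> < 1" and s: "s \<ge> 0"
  shows "max 0 (s - 2 * gconst \<delta>) \<le> 2 * \<delta> * (s * g s)"
proof -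
  have gs: "g s \<ge> 0" using g(1) s by simp
  have "0 \<le> 2 * \<delta> * (s * g s)" using \<delta> s gs by simp
  moreover have "s - 2 * gconst \<delta> \<le> 2 * \<delta> * (s * g s)"
    using gconst(2)[OF \<delta> s] gs s by linarith
  ultimately show ?thesis by simp
qed

text \<open>The bound on the excess of \<open>m\<close> expresses uniform integrability, and it is convex in \<open>m\<close>,
  unlike, in general, a bound on the integral of \<open>m g(m)\<close>.\<close>

definition admissible :: "real \<Rightarrow> (real^'n \<Rightarrow> real) \<Rightarrow> (real^'n \<Rightarrow> real) \<Rightarrow> (real^'n \<Rightarrow> real^'n) \<Rightarrow> bool" where
  "admissible K m u D \<longleftrightarrow> periodic m \<and> continuous_on UNIV m \<and> (\<forall>x\<in>cbox 0 1. 0 \<le> m x) \<and> C1_torus u D \<and>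
    (\<forall>\<delta>. 0 < \<delta> \<and> \<delta> < 1 \<longrightarrow> (\<integral>x. max 0 (m x - 2 * gconst \<delta>) \<partial>torus) \<le> \<delta> * K) \<and>
    (\<integral>x. norm (D x) powr \<alpha> \<partial>torus) \<le> K \<and> \<bar>\<integral>x. u x \<partial>torus\<bar> \<le> K"

lemma continuous_on_norm_powr:
  fixes D :: "real^'n \<Rightarrow> real^'n"
  assumes "continuous_on S D"
  shows "continuous_on S (\<lambda>x. norm (D x) powr \<alpha>)"
  using continuous_on_powr_abs[OF continuous_on_norm[OF assms] \<alpha>] by simp

lemma admissible_combination:
  assumes I: "finite I" "\<And>i. i \<in> I \<Longrightarrow> 0 \<le> \<mu> i" "(\<Sum>i\<in>I. \<mu> i) = 1"
    and m: "\<And>i. i \<in> I \<Longrightarrow> periodic (m i) \<and> continuous_on UNIV (m i) \<and> (\<forall>x\<in>cbox 0 1. 0 \<le> m i x)"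
    and u: "\<And>i. i \<in> I \<Longrightarrow> C1_torus (u i) (D i)"
    and K: "\<And>\<delta>. 0 < \<delta> \<Longrightarrow> \<delta> < 1 \<Longrightarrow> (\<Sum>i\<in>I. \<mu> i * (\<integral>x. max 0 (m i x - 2 * gconst \<delta>) \<partial>torus)) \<le> \<delta> * K"
      "(\<Sum>i\<in>I. \<mu> i * (\<integral>x. norm (D i x) powr \<alpha> \<partial>torus)) \<le> K"
      "\<bar>\<Sum>i\<in>I. \<mu> i * (\<integral>x. u i x \<partial>torus)\<bar> \<le> K"
  shows "admissible K (\<lambda>x. \<Sum>i\<in>I. \<mu> i * m i x) (\<lambda>x. \<Sum>i\<in>I. \<mu> i * u i x) (\<lambda>x. \<Sum>i\<in>I. \<mu> i *\<^sub>R D i x)"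
  unfolding admissible_def
proof (intro conjI allI impI)
  have mc: "continuous_on S (m i)" if "i \<in> I" for S i using m[OF that] continuous_on_subset by blast
  have uc: "continuous_on S (u i)" "continuous_on S (D i)" if "i \<in> I" for S i
    using C1_torusD[OF u[OF that]] by auto
  show "periodic (\<lambda>x. \<Sum>i\<in>I. \<mu> i * m i x)" unfolding periodic_def
    using m by (auto simp: periodic_add_axis intro!: sum.cong)
  show "continuous_on UNIV (\<lambda>x. \<Sum>i\<in>I. \<mu> i * m i x)" by (intro continuous_intros mc)
  show "\<forall>x\<in>cbox 0 1. 0 \<le> (\<Sum>i\<in>I. \<mu> i * m i x)" using m I(2) by (auto intro!: sum_nonneg)
  show "C1_torus (\<lambda>x. \<Sum>i\<in>I. \<mu> i * u i x) (\<lambda>x. \<Sum>i\<in>I. \<mu> i *\<^sub>R D i x)"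
    by (intro C1_torus_sum I C1_torus_scale u)
  fix \<delta> :: real assume \<delta>: "0 < \<delta> \<and> \<delta> < 1"
  define L where "L = 2 * gconst \<delta>"
  have i: "integrable torus (\<lambda>x. max 0 (m i x - L))" if "i \<in> I" for i
    by (intro integrable_torus_continuous continuous_intros mc that)
  have "(\<integral>x. max 0 ((\<Sum>i\<in>I. \<mu> i * m i x) - L) \<partial>torus) \<le> (\<integral>x. (\<Sum>i\<in>I. \<mu> i * max 0 (m i x - L)) \<partial>torus)"
  proof (rule integral_mono)
    show "integrable torus (\<lambda>x. max 0 ((\<Sum>i\<in>I. \<mu> i * m i x) - L))"
      by (intro integrable_torus_continuous continuous_intros mc)
    show "integrable torus (\<lambda>x. \<Sum>i\<in>I. \<mu> i * max 0 (m i x - L))" using i by auto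
    fix x :: "real^'n"
    have "(\<Sum>i\<in>I. \<mu> i * m i x) - L = (\<Sum>i\<in>I. \<mu> i * m i x) - (\<Sum>i\<in>I. \<mu> i) * L" using I by simp
    also have "\<dots> = (\<Sum>i\<in>I. \<mu> i * (m i x - L))"
      by (simp add: right_diff_distrib sum_subtractf sum_distrib_right)
    also have "\<dots> \<le> (\<Sum>i\<in>I. \<mu> i * max 0 (m i x - L))" using I by (intro sum_mono mult_left_mono) auto
    finally show "max 0 ((\<Sum>i\<in>I. \<mu> i * m i x) - L) \<le> (\<Sum>i\<in>I. \<mu> i * max 0 (m i x - L))"
      using I by (auto intro!: sum_nonneg)
  qed
  also have "\<dots> = (\<Sum>i\<in>I. \<mu> i * (\<integral>x. max 0 (m i x - L) \<partial>torus))" using i by simp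
  finally show "(\<integral>x. max 0 ((\<Sum>i\<in>I. \<mu> i * m i x) - 2 * gconst \<delta>) \<partial>torus) \<le> \<delta> * K"
    using K(1)[of \<delta>] \<delta> by (simp add: L_def)
next
  have mc: "continuous_on S (u i)" "continuous_on S (D i)" if "i \<in> I" for S i
    using C1_torusD[OF u[OF that]] by auto
  have i: "integrable torus (\<lambda>x. norm (D i x) powr \<alpha>)" if "i \<in> I" for i
    by (intro integrable_torus_continuous continuous_on_norm_powr mc that)
  have "(\<integral>x. norm (\<Sum>i\<in>I. \<mu> i *\<^sub>R D i x) powr \<alpha> \<partial>torus) \<le> (\<integral>x. (\<Sum>i\<in>I. \<mu> i * norm (D i x) powr \<alpha>) \<partial>torus)"
  proof (rule integral_mono)
    show "integrable torus (\<lambda>x. norm (\<Sum>i\<in>I. \<mu> i *\<^sub>R D i x) powr \<alpha>)"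
      by (intro integrable_torus_continuous continuous_on_norm_powr continuous_intros mc)
    show "integrable torus (\<lambda>x. \<Sum>i\<in>I. \<mu> i * norm (D i x) powr \<alpha>)" using i by auto
    fix x
    have "norm (\<Sum>i\<in>I. \<mu> i *\<^sub>R D i x) \<le> (\<Sum>i\<in>I. \<mu> i * norm (D i x))"
      using I by (intro sum_norm_le) auto
    hence "norm (\<Sum>i\<in>I. \<mu> i *\<^sub>R D i x) powr \<alpha> \<le> (\<Sum>i\<in>I. \<mu> i * norm (D i x)) powr \<alpha>"
      using \<alpha> by (intro powr_mono2) auto
    also have "\<dots> \<le> (\<Sum>i\<in>I. \<mu> i * norm (D i x) powr \<alpha>)" by (intro powr_sum_convex \<alpha> I) auto
    finally show "norm (\<Sum>i\<in>I. \<mu> i *\<^sub>R D i x) powr \<alpha> \<le> (\<Sum>i\<in>I. \<mu> i * norm (D i x) powr \<alpha>)" .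
  qed
  also have "\<dots> = (\<Sum>i\<in>I. \<mu> i * (\<integral>x. norm (D i x) powr \<alpha> \<partial>torus))" using i by simp
  finally show "(\<integral>x. norm (\<Sum>i\<in>I. \<mu> i *\<^sub>R D i x) powr \<alpha> \<partial>torus) \<le> K" using K(2) by linarith
  have "integrable torus (u i)" if "i \<in> I" for i by (intro integrable_torus_continuous mc that)
  hence "(\<integral>x. (\<Sum>i\<in>I. \<mu> i * u i x) \<partial>torus) = (\<Sum>i\<in>I. \<mu> i * (\<integral>x. u i x \<partial>torus))" by simp
  thus "\<bar>\<integral>x. (\<Sum>i\<in>I. \<mu> i * u i x) \<partial>torus\<bar> \<le> K" using K(3) by simp
qed

lemma admissible_convex:
  assumes a: "admissible K m u D" and a': "admissible K m' u' D'" and r: "0 \<le> r" "r \<le> 1"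
  shows "admissible K (\<lambda>x. (1 - r) * m x + r * m' x) (\<lambda>x. (1 - r) * u x + r * u' x)
    (\<lambda>x. (1 - r) *\<^sub>R D x + r *\<^sub>R D' x)"
proof -
  have conv: "(1 - r) * a + r * b \<le> c" if "a \<le> c" "b \<le> c" for a b c :: real
  proof -
    have "(1 - r) * a + r * b \<le> (1 - r) * c + r * c" using r that by (intro add_mono mult_left_mono) auto
    thus ?thesis by (simp add: algebra_simps)
  qed
  have ab: "\<bar>(1 - r) * (\<integral>x. u x \<partial>torus) + r * (\<integral>x. u' x \<partial>torus)\<bar> \<le> K"
    using conv[of "\<integral>x. u x \<partial>torus" K "\<integral>x. u' x \<partial>torus"] conv[of "- (\<integral>x. u x \<partial>torus)" K "- (\<integral>x. u' x \<partial>torus)"]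
      a a' by (auto simp: admissible_def abs_le_iff)
  have "admissible K (\<lambda>x. \<Sum>b\<in>UNIV. (if b then r else 1 - r) * (if b then m' else m) x)
     (\<lambda>x. \<Sum>b\<in>UNIV. (if b then r else 1 - r) * (if b then u' else u) x)
     (\<lambda>x. \<Sum>b\<in>UNIV. (if b then r else 1 - r) *\<^sub>R (if b then D' else D) x)"
    by (rule admissible_combination)
       (use a a' r ab conv in \<open>auto simp: admissible_def UNIV_bool intro!: add_nonneg_nonneg\<close>)
  thus ?thesis by (simp add: UNIV_bool add.commute)
qed

text \<open>Pairing the operator at \<open>(w, v)\<close> with \<open>(w - \<phi>, v)\<close> makes the terms linear in \<open>v\<close> cancel. What is
  left is \<open>w (Dv \<bullet> D\<^sub>pH(Dv) - H(Dv)) + \<phi> H(Dv) + w g(w) - \<phi> g(w) - V (w - \<phi>)\<close>. The first term is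
  bounded below by a multiple of \<open>w\<close>, the second is coercive because \<open>\<phi>\<close> is bounded below by a positive
  constant, and half of \<open>w g(w)\<close> absorbs all multiples of \<open>w\<close> and \<open>g(w)\<close> up to a
  constant.\<close>

lemma energy_estimate:
  obtains c C K where "c > 0" "C > 0" "K \<ge> 0" "\<And>p. norm p powr \<alpha> / C \<le> H p + C"
    "\<And>x. x \<in> cbox 0 1 \<Longrightarrow> c \<le> \<phi> x"
    "\<And>t. classical t \<Longrightarrow> minty t \<phi> (\<lambda>x. 0) \<le>
      K - c * (\<integral>x. H (dval t x) + C \<partial>torus) - (\<integral>x. dens t x * g (dens t x) \<partial>torus) / 2"
proof -
  obtain C1 where C1: "C1 > 0" "\<And>p. - H p + gradient H p \<bullet> p \<ge> 1 / C1 * norm p powr \<alpha> - C1"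
    using H_lagrangian by blast
  obtain C where C: "C > 0" "\<And>p. H p \<ge> 1 / C * norm p powr \<alpha> - C" using H_coercive by blast
  have HC: "norm p powr \<alpha> / C \<le> H p + C" for p using C(2)[of p] by simp
  have HC0: "0 \<le> H p + C" for p
  proof -
    have "0 \<le> norm p powr \<alpha> / C" using C(1) by simp
    thus ?thesis using HC[of p] by linarith
  qed
  have L0: "- C1 \<le> - H p + gradient H p \<bullet> p" for p
  proof -
    have "0 \<le> 1 / C1 * norm p powr \<alpha>" using C1(1) by simp
    thus ?thesis using C1(2)[of p] by linarith
  qed
  have ne: "cbox 0 (1::real^'n) \<noteq> {}" by (auto simp: interval_ne_empty_cart)
  obtain x0 where x0: "\<And>x. x \<in> cbox 0 1 \<Longrightarrow> \<phi> x0 \<le> \<phi> x"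
    using continuous_attains_inf[OF compact_cbox ne \<phi>_cont] by blast
  obtain x1 where x1: "\<And>x. x \<in> cbox 0 1 \<Longrightarrow> \<phi> x \<le> \<phi> x1"
    using continuous_attains_sup[OF compact_cbox ne \<phi>_cont] by blast
  obtain x2 where x2: "\<And>x. x \<in> cbox 0 1 \<Longrightarrow> \<bar>V x\<bar> \<le> \<bar>V x2\<bar>"
    using continuous_attains_sup[OF compact_cbox ne continuous_on_rabs[OF V_cont]] by blast
  define c M W where "c = \<phi> x0" and "M = \<phi> x1" and "W = \<bar>V x2\<bar>"
  have c: "c > 0" using \<phi>(2) by (simp add: c_def)
  have M: "M > 0" using \<phi>(2) by (simp add: M_def)
  have W: "W \<ge> 0" by (simp add: W_def)
  define N where "N = C1 + W + M"
  have N: "N > 0" using C1 M W by (simp add: N_def)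
  define \<delta> where "\<delta> = 1 / (2 * N + 2)"
  have \<delta>: "0 < \<delta>" "\<delta> < 1" "N * \<delta> \<le> 1/2" using N by (auto simp: \<delta>_def field_simps)
  define K where "K = N * gconst \<delta> + (C + W) * M"
  have K: "K \<ge> 0" using N gconst(1)[OF \<delta>(1,2)] C W M by (simp add: K_def)
  have est: "minty t \<phi> (\<lambda>x. 0) \<le>
      K - c * (\<integral>x. H (dval t x) + C \<partial>torus) - (\<integral>x. dens t x * g (dens t x) \<partial>torus) / 2" if t: "classical t" for t
  proof -
    have e: "minty t \<phi> (\<lambda>x. 0) = (\<integral>x. hjb t x * (\<phi> x - dens t x) + (dens t x - \<phi> x) * (0 - val t x)
     + dens t x * (gradient H (dval t x) \<bullet> (0 - dval t x)) \<partial>torus)"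
      by (rule minty_eq[OF t \<phi>_cont C1_torus_const])
    have i: "integrable torus (\<lambda>x. H (dval t x) + C)" "integrable torus (\<lambda>x. dens t x * g (dens t x))"
      by (intro integrable_torus_continuous continuous_intros classical_cont[OF t])+
    have "minty t \<phi> (\<lambda>x. 0) \<le> (\<integral>x. K - c * (H (dval t x) + C) - (dens t x * g (dens t x)) / 2 \<partial>torus)"
      unfolding e
    proof (rule integral_mono)
      show "integrable torus (\<lambda>x. hjb t x * (\<phi> x - dens t x) + (dens t x - \<phi> x) * (0 - val t x)
         + dens t x * (gradient H (dval t x) \<bullet> (0 - dval t x)))"
        by (intro integrable_torus_continuous continuous_intros classical_cont[OF t] hjb_cont[OF t] \<phi>_cont)
      show "integrable torus (\<lambda>x. K - c * (H (dval t x) + C) - (dens t x * g (dens t x)) / 2)"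
        using i by auto
      fix x :: "real^'n" assume "x \<in> space torus"
      hence x: "x \<in> cbox 0 1" by simp
      define w p f b where "w = dens t x" and "p = dval t x" and "f = \<phi> x" and "b = V x"
      have w: "w \<ge> 0" using t x by (auto simp: classical_def w_def)
      have f: "c \<le> f" "f \<le> M" "0 \<le> f" using x0[OF x] x1[OF x] c by (auto simp: f_def c_def M_def)
      have b: "\<bar>b\<bar> \<le> W" using x2[OF x] by (simp add: b_def W_def)
      have gw: "g w \<ge> 0" using g(1) w by simp
      have 1: "- (C1 * w) \<le> w * (- H p + gradient H p \<bullet> p)" 
        using mult_left_mono[OF L0[of p] w] by (simp add: mult.commute)
      have 2: "c * (H p + C) \<le> f * (H p + C)" using f HC0[of p] by (intro mult_right_mono) auto
      have 3: "f * g w \<le> M * g w" using f gw by (intro mult_right_mono) auto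
      have 4: "w * b \<le> w * W" "- (f * b) \<le> f * W"
        using b w f mult_left_mono[of b W w] mult_left_mono[of "-b" W f] by (auto simp: abs_le_iff)
      have 5: "f * (C + W) \<le> M * (C + W)" using f C W by (intro mult_right_mono) auto
      have "N * (w + g w) \<le> N * (\<delta> * (w * g w) + gconst \<delta>)"
        using gconst(2)[OF \<delta>(1,2) w] N by (intro mult_left_mono) auto
      also have "\<dots> = (N * \<delta>) * (w * g w) + N * gconst \<delta>" by (simp add: distrib_left)
      also have "\<dots> \<le> (1/2) * (w * g w) + N * gconst \<delta>"
        by (rule add_mono[OF mult_right_mono order_refl]) (use \<delta>(3) w gw in auto)
      finally have 6: "N * (w + g w) \<le> (1/2) * (w * g w) + N * gconst \<delta>" .
      have 7: "C1 * w + w * W + M * g w \<le> N * (w + g w)"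
      proof -
        have "N * (w + g w) = C1 * w + w * W + M * g w + (M * w + (C1 + W) * g w)"
          by (simp add: N_def algebra_simps)
        moreover have "0 \<le> M * w + (C1 + W) * g w" using M w C1 W gw by simp
        ultimately show ?thesis by linarith
      qed
      have "hjb t x * (\<phi> x - dens t x) + (dens t x - \<phi> x) * (0 - val t x)
         + dens t x * (gradient H (dval t x) \<bullet> (0 - dval t x))
        = - (w * (- H p + gradient H p \<bullet> p)) - f * (H p + C) + f * C - w * g w + f * g w + w * b - f * b"
        by (simp add: hjb_def w_def[symmetric] p_def[symmetric] f_def[symmetric] b_def[symmetric] algebra_simps)
      also have "\<dots> \<le> K - c * (H p + C) - (w * g w) / 2"
        using 1 2 3 4 5 6 7 by (simp add: K_def algebra_simps)
      finally show "hjb t x * (\<phi> x - dens t x) + (dens t x - \<phi> x) * (0 - val t x)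
         + dens t x * (gradient H (dval t x) \<bullet> (0 - dval t x)) \<le>
         K - c * (H (dval t x) + C) - (dens t x * g (dens t x)) / 2" by (simp add: w_def p_def)
    qed
    also have "\<dots> = K - c * (\<integral>x. H (dval t x) + C \<partial>torus) - (\<integral>x. dens t x * g (dens t x) \<partial>torus) / 2"
    proof -
      have "integrable torus (\<lambda>x. K - c * (H (dval t x) + C))" "integrable torus (\<lambda>x. dens t x * g (dens t x) / 2)"
        "integrable torus (\<lambda>x. c * (H (dval t x) + C))"
        using i by auto
      thus ?thesis by (simp del: distrib_left)
    qed
    finally show ?thesis .
  qed
  show ?thesis by (rule that[OF c C(1) K HC _ est]) (use x0 c_def in auto)
qed

section \<open>Admissible approximate solutions of finite systems\<close>

lemma admissible_shifted_source:
  assumes s: "-c \<le> s" "s \<le> 1" and c: "\<And>x. x \<in> cbox 0 1 \<Longrightarrow> c \<le> \<phi> x" and M: "\<And>x. x \<in> cbox 0 1 \<Longrightarrow> \<phi> x + 1 \<le> M"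
    and K: "2 * (M * g M) \<le> K" "0 \<le> K"
  shows "admissible K (\<lambda>x. \<phi> x + s) (\<lambda>x. 0) (\<lambda>x. 0)"
  unfolding admissible_def
proof (intro conjI allI impI)
  show "periodic (\<lambda>x. \<phi> x + s)" using \<phi>(1) by (auto simp: cont_torus_def periodic_def)
  show "continuous_on UNIV (\<lambda>x. \<phi> x + s)" by (intro continuous_intros \<phi>_cont)
  show nn: "\<forall>x\<in>cbox 0 1. 0 \<le> \<phi> x + s" using c s(1) by force
  fix \<delta> :: real assume \<delta>: "0 < \<delta> \<and> \<delta> < 1"
  have "(\<integral>x. max 0 (\<phi> x + s - 2 * gconst \<delta>) \<partial>torus) \<le> (\<integral>x. \<delta> * K \<partial>(torus :: (real^'n) measure))"
  proof (rule integral_mono)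
    show "integrable torus (\<lambda>x. max 0 (\<phi> x + s - 2 * gconst \<delta>))"
      by (intro integrable_torus_continuous continuous_intros \<phi>_cont)
    fix x :: "real^'n" assume "x \<in> space torus"
    hence x: "x \<in> cbox 0 1" by simp
    define r where "r = \<phi> x + s"
    have r: "0 \<le> r" "r \<le> M" using nn x M[OF x] s by (auto simp: r_def)
    have "max 0 (r - 2 * gconst \<delta>) \<le> 2 * \<delta> * (r * g r)" by (rule excess_le) (use \<delta> r in auto)
    also have "r * g r \<le> M * g M"
      using r g(1) mono_onD[OF g(3), of r M] by (intro mult_mono) auto
    hence "2 * \<delta> * (r * g r) \<le> \<delta> * (2 * (M * g M))" using \<delta> by simp
    also have "\<dots> \<le> \<delta> * K" using \<delta> K by (intro mult_left_mono) auto
    finally show "max 0 (\<phi> x + s - 2 * gconst \<delta>) \<le> \<delta> * K" by (simp add: r_def)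
  qed simp
  thus "(\<integral>x. max 0 (\<phi> x + s - 2 * gconst \<delta>) \<partial>torus) \<le> \<delta> * K" by simp
qed (use K \<alpha> in auto)

text \<open>For every weighting of finitely many test pairs, one of four explicit candidates works. If the
  weighted energy is non-negative, the pair \<open>(\<phi>, 0)\<close> satisfies the weighted inequality. Otherwise the
  energy estimate bounds the densities and the gradients of the test pairs in the weighted mean, and
  the weighted mean of the test pairs satisfies the inequality by monotonicity. Its value function may
  have a large mean; in that case the mean of the first component of the operator is large with the
  opposite sign, and it pays to add a constant to \<open>\<phi>\<close> or to subtract one.\<close>

lemma weighted_admissible:
  obtains K c where "admissible K \<phi> (\<lambda>x. 0) (\<lambda>x. 0)"
    "\<And>F \<mu>. finite F \<Longrightarrow> (\<And>t. t \<in> F \<Longrightarrow> classical t) \<Longrightarrow> (\<And>t. t \<in> F \<Longrightarrow> 0 \<le> \<mu> t) \<Longrightarrow> (\<Sum>t\<in>F. \<mu> t) = 1 \<Longrightarrow>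
      \<exists>m u D. admissible K m u D \<and> (\<Sum>t\<in>F. \<mu> t * minty t m u) \<le> 0 \<and>
        ((m = (\<lambda>x. \<Sum>t\<in>F. \<mu> t * dens t x) \<and> u = (\<lambda>x. \<Sum>t\<in>F. \<mu> t * val t x)) \<or>
         (\<exists>s\<in>{0, 1, -c}. m = (\<lambda>x. \<phi> x + s) \<and> u = (\<lambda>x. 0)))"
proof -
  obtain c C K0 where c: "c > 0" and C: "C > 0" and K0: "K0 \<ge> 0"
    and HC: "\<And>p. norm p powr \<alpha> / C \<le> H p + C" and \<phi>c: "\<And>x. x \<in> cbox 0 1 \<Longrightarrow> c \<le> \<phi> x"
    and energy: "\<And>t. classical t \<Longrightarrow> minty t \<phi> (\<lambda>x. 0) \<le>
      K0 - c * (\<integral>x. H (dval t x) + C \<partial>torus) - (\<integral>x. dens t x * g (dens t x) \<partial>torus) / 2"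
    by (rule energy_estimate) blast
  have ne: "cbox 0 (1::real^'n) \<noteq> {}" by (auto simp: interval_ne_empty_cart)
  obtain x1 where x1: "\<And>x. x \<in> cbox 0 1 \<Longrightarrow> \<phi> x \<le> \<phi> x1"
    using continuous_attains_sup[OF compact_cbox ne \<phi>_cont] by blast
  define M where "M = \<phi> x1 + 1"
  have M: "M \<ge> 0" "\<And>x. x \<in> cbox 0 1 \<Longrightarrow> \<phi> x + 1 \<le> M" 
    using spec[OF \<phi>(2), of x1] x1 by (simp_all add: M_def)
  have gM: "0 \<le> 2 * (M * g M)" using M g(1) by simp
  define G where "G = gconst (1/2)"
  have G: "G > 0" unfolding G_def by (rule gconst) auto
  define K5 where "K5 = K0 / c + C + (K0 + G) + \<bar>\<integral>x. V x \<partial>torus\<bar>"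
  define K where "K = 4 * K0 + C * (K0 / c) + (K5 + K0 + K0 / c) + 2 * (M * g M)"
  have K0c: "K0 / c \<ge> 0" using K0 c by simp
  have K5: "K5 \<ge> 0" using K0c C K0 G by (simp add: K5_def)
  have CK: "C * (K0 / c) \<ge> 0" using C K0c by (intro mult_nonneg_nonneg) simp_all
  have K: "4 * K0 \<le> K" "C * (K0 / c) \<le> K" "K5 + K0 + K0 / c \<le> K" "2 * (M * g M) \<le> K" "0 \<le> K"
    using K0 K0c K5 CK gM by (auto simp: K_def)
  have shifted: "admissible K (\<lambda>x. \<phi> x + s) (\<lambda>x. 0) (\<lambda>x. 0)" if "s \<in> {0, 1, -c}" for s
    by (rule admissible_shifted_source[OF _ _ \<phi>c M(2) K(4,5)]) (use that c in auto)
  have main: "\<exists>m u D. admissible K m u D \<and> (\<Sum>t\<in>F. \<mu> t * minty t m u) \<le> 0 \<and>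
        ((m = (\<lambda>x. \<Sum>t\<in>F. \<mu> t * dens t x) \<and> u = (\<lambda>x. \<Sum>t\<in>F. \<mu> t * val t x)) \<or>
         (\<exists>s\<in>{0, 1, -c}. m = (\<lambda>x. \<phi> x + s) \<and> u = (\<lambda>x. 0)))"
    if F: "finite F" "\<And>t. t \<in> F \<Longrightarrow> classical t" and \<mu>: "\<And>t. t \<in> F \<Longrightarrow> 0 \<le> \<mu> t" "(\<Sum>t\<in>F. \<mu> t) = 1" for F \<mu>
  proof -
    define h p :: "'n test_pair \<Rightarrow> real" where "h = (\<lambda>t. \<integral>x. H (dval t x) + C \<partial>torus)" and "p = (\<lambda>t. \<integral>x. dens t x * g (dens t x) \<partial>torus)"
    define E where "E = (\<Sum>t\<in>F. \<mu> t * minty t \<phi> (\<lambda>x. 0))"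
    define A where "A = (\<Sum>t\<in>F. \<mu> t * (\<integral>x. hjb t x \<partial>torus))"
    have nn: "dens t x \<ge> 0" "g (dens t x) \<ge> 0" if "t \<in> F" "x \<in> cbox 0 1" for t x
      using F(2)[OF that(1)] that(2) g(1) by (auto simp: classical_def)
    have h0: "h t \<ge> 0" for t
    proof -
      have "0 \<le> H q + C" for q
        by (rule order_trans[OF _ HC]) (use C in simp)
      thus ?thesis unfolding h_def by (intro Bochner_Integration.integral_nonneg)
    qed
    have p0: "p t \<ge> 0" if "t \<in> F" for t
      unfolding p_def using nn[OF that] by (intro Bochner_Integration.integral_nonneg_AE) (use AE_torus_cube in eventually_elim, simp)
    define hs ps where "hs = (\<Sum>t\<in>F. \<mu> t * h t)" and "ps = (\<Sum>t\<in>F. \<mu> t * p t)"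
    have hs0: "hs \<ge> 0" unfolding hs_def by (intro sum_nonneg mult_nonneg_nonneg \<mu> h0)
    have ps0: "ps \<ge> 0" unfolding ps_def by (intro sum_nonneg mult_nonneg_nonneg \<mu> p0)
    have "E \<le> (\<Sum>t\<in>F. \<mu> t * (K0 - c * h t - p t / 2))"
      unfolding E_def h_def p_def by (intro sum_mono mult_left_mono energy F \<mu>)
    also have "\<dots> = (\<Sum>t\<in>F. \<mu> t) * K0 - c * hs - ps / 2"
      by (simp add: hs_def ps_def right_diff_distrib sum_subtractf sum_distrib_left sum_distrib_right
          sum_divide_distrib mult.left_commute)
    finally have Eub: "E \<le> K0 - c * hs - ps / 2" using \<mu> by simp
    have Eub': "E \<le> K0" using Eub hs0 ps0 c mult_nonneg_nonneg[of c hs] by linarith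
    have i: "integrable torus (hjb t)" "integrable torus (dens t)" "integrable torus (val t)"
      "integrable torus (\<lambda>x. H (dval t x))" "integrable torus (\<lambda>x. g (dens t x))" "integrable torus V"
      "integrable torus (\<lambda>x. dens t x * g (dens t x))" if "t \<in> F" for t
      by (intro integrable_torus_continuous continuous_intros hjb_cont classical_cont V_cont F that)+
    have i\<phi>: "integrable torus \<phi>" by (intro integrable_torus_continuous \<phi>_cont)
    have shift: "(\<Sum>t\<in>F. \<mu> t * minty t (\<lambda>x. \<phi> x + s) (\<lambda>x. 0)) = E + s * A" for s
    proof -
      have "minty t (\<lambda>x. \<phi> x + s) (\<lambda>x. 0) = minty t \<phi> (\<lambda>x. 0) + s * (\<integral>x. hjb t x \<partial>torus)" if t: "t \<in> F" for t
      proof -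
        have "integrable torus (\<lambda>x. hjb t x * \<phi> x)" "integrable torus (\<lambda>x. hjb t x * s)"
          using i(1)[OF t] integrable_torus_mult_continuous[OF hjb_cont i\<phi>] F(2)[OF t] by auto
        thus ?thesis using i\<phi>
          by (simp add: minty_affine F(2)[OF t] distrib_left)
      qed
      thus ?thesis by (simp add: E_def A_def distrib_left sum.distrib sum_distrib_left mult.left_commute)
    qed
    have point: ?thesis if s: "s \<in> {0, 1, -c}" "E + s * A \<le> 0" for s
    proof (rule exI, rule exI, rule exI, rule conjI[OF shifted[OF s(1)]], rule conjI[OF _ disjI2])
      show "(\<Sum>t\<in>F. \<mu> t * minty t (\<lambda>x. \<phi> x + s) (\<lambda>x. 0)) \<le> 0" using s(2) by (simp only: shift)
      show "\<exists>s'\<in>{0, 1, -c}. (\<lambda>x. \<phi> x + s) = (\<lambda>x. \<phi> x + s') \<and> (\<lambda>x. 0) = (\<lambda>x. 0)"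
        by (rule bexI[OF _ s(1)]) simp
    qed
    \<comment> \<open>Here \<open>- E\<close> is the weighted energy, and \<open>A\<close> is the weighted mean of the first component of the
      operator, up to bounded terms the negative of the mean of the averaged value function.\<close>
    consider (a) "E \<le> 0" | (b) "E > 0" "A \<le> - K0" | (c) "E > 0" "A \<ge> K0 / c" | (d) "E > 0" "- K0 < A" "A < K0 / c"
      by linarith
    thus ?thesis
    proof cases
      case a
      thus ?thesis by (intro point[of 0]) auto
    next
      case b
      thus ?thesis using Eub' by (intro point[of 1]) auto
    next
      case c
      have "K0 \<le> c * A" using c(2) \<open>c > 0\<close> by (simp add: field_simps)
      hence "E + (- c) * A \<le> 0" using Eub' by simp
      thus ?thesis by (intro point[of "-c"]) auto
    next
      case d
      have hsK: "hs \<le> K0 / c" and psK: "ps \<le> 2 * K0"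
      proof -
        have "0 \<le> c * hs" using c hs0 by simp
        hence "c * hs \<le> K0" "ps \<le> 2 * K0" using Eub d(1) ps0 by linarith+
        thus "hs \<le> K0 / c" "ps \<le> 2 * K0" using c by (simp_all add: pos_le_divide_eq mult.commute)
      qed
      define vs where "vs = (\<Sum>t\<in>F. \<mu> t * (\<integral>x. val t x \<partial>torus))"
      define gs where "gs = (\<Sum>t\<in>F. \<mu> t * (\<integral>x. g (dens t x) \<partial>torus))"
      have gs: "0 \<le> gs" "gs \<le> K0 + G"
      proof -
        show "0 \<le> gs" unfolding gs_def using nn(2)
          by (intro sum_nonneg mult_nonneg_nonneg \<mu> Bochner_Integration.integral_nonneg_AE)
            (auto intro: AE_mp[OF AE_torus_cube])
        have "(\<integral>x. g (dens t x) \<partial>torus) \<le> p t / 2 + G" if t: "t \<in> F" for t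
        proof -
          have "(\<integral>x. g (dens t x) \<partial>torus) \<le> (\<integral>x. (dens t x * g (dens t x)) / 2 + G \<partial>torus)"
          proof (rule integral_mono)
            show "integrable torus (\<lambda>x. g (dens t x))" "integrable torus (\<lambda>x. (dens t x * g (dens t x)) / 2 + G)"
              using i[OF t] by auto
            fix x :: "real^'n" assume "x \<in> space torus"
            hence "dens t x \<ge> 0" using nn[OF t] by simp
            thus "g (dens t x) \<le> (dens t x * g (dens t x)) / 2 + G"
              using gconst(2)[of "1/2" "dens t x"] by (simp add: G_def)
          qed
          thus ?thesis using i[OF t] by (simp add: p_def)
        qed
        hence "gs \<le> (\<Sum>t\<in>F. \<mu> t * (p t / 2 + G))" unfolding gs_def by (intro sum_mono mult_left_mono \<mu>)
        also have "\<dots> = ps / 2 + (\<Sum>t\<in>F. \<mu> t) * G"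
          by (simp add: ps_def distrib_left sum.distrib sum_distrib_right sum_divide_distrib)
        finally show "gs \<le> K0 + G" using \<mu> psK by simp
      qed
      have "A = (\<Sum>t\<in>F. \<mu> t * (- (\<integral>x. val t x \<partial>torus) - (h t - C) + (\<integral>x. g (dens t x) \<partial>torus) - (\<integral>x. V x \<partial>torus)))"
        unfolding A_def
      proof (intro sum.cong refl arg_cong2[where f = "(*)"])
        fix t assume t: "t \<in> F"
        show "(\<integral>x. hjb t x \<partial>torus) = - (\<integral>x. val t x \<partial>torus) - (h t - C) + (\<integral>x. g (dens t x) \<partial>torus) - (\<integral>x. V x \<partial>torus)"
          unfolding hjb_def h_def using i[OF t] by simp
      qed
      also have "\<dots> = - vs - hs + gs + (\<Sum>t\<in>F. \<mu> t) * (C - (\<integral>x. V x \<partial>torus))"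
      proof -
        have "(\<Sum>t\<in>F. \<mu> t * (- a t - (b t - x) + d t - y))
          = - (\<Sum>t\<in>F. \<mu> t * a t) - (\<Sum>t\<in>F. \<mu> t * b t) + (\<Sum>t\<in>F. \<mu> t * d t) + (\<Sum>t\<in>F. \<mu> t) * (x - y)"
          for a b d :: "'n test_pair \<Rightarrow> real" and x y
          by (simp add: algebra_simps sum.distrib sum_subtractf sum_negf sum_distrib_left sum_distrib_right)
        thus ?thesis by (simp add: vs_def hs_def gs_def)
      qed
      finally have "A = - vs - hs + gs + (C - (\<integral>x. V x \<partial>torus))" using \<mu> by simp
      hence vsK: "\<bar>vs\<bar> \<le> K5 + K0 + K0 / c"
        using d gs hs0 hsK C K0 K0c by (auto simp: K5_def abs_le_iff)
      have adm: "admissible K (\<lambda>x. \<Sum>t\<in>F. \<mu> t * dens t x) (\<lambda>x. \<Sum>t\<in>F. \<mu> t * val t x) (\<lambda>x. \<Sum>t\<in>F. \<mu> t *\<^sub>R dval t x)"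
      proof (rule admissible_combination)
        show "periodic (dens t) \<and> continuous_on UNIV (dens t) \<and> (\<forall>x\<in>cbox 0 1. 0 \<le> dens t x)" if "t \<in> F" for t
          using F(2)[OF that] classical_cont(1) C1_torusD(1) unfolding classical_def by blast
        show "C1_torus (val t) (dval t)" if "t \<in> F" for t
          using F(2)[OF that] unfolding classical_def by blast
        show "\<bar>\<Sum>t\<in>F. \<mu> t * (\<integral>x. val t x \<partial>torus)\<bar> \<le> K" using vsK K(3) by (simp add: vs_def)
      next
        have "(\<integral>x. norm (dval t x) powr \<alpha> \<partial>torus) \<le> C * h t" if t: "t \<in> F" for t
        proof -
          have "(\<integral>x. norm (dval t x) powr \<alpha> \<partial>torus) \<le> (\<integral>x. C * (H (dval t x) + C) \<partial>torus)"
          proof (rule integral_mono)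
            show "integrable torus (\<lambda>x. norm (dval t x) powr \<alpha>)"
              by (intro integrable_torus_continuous continuous_on_norm_powr classical_cont F t)
            show "integrable torus (\<lambda>x. C * (H (dval t x) + C))" using i[OF t] by auto
            show "norm (dval t x) powr \<alpha> \<le> C * (H (dval t x) + C)" for x
              using HC[of "dval t x"] C by (simp add: field_simps)
          qed
          thus ?thesis by (simp add: h_def del: distrib_left_numeral)
        qed
        hence "(\<Sum>t\<in>F. \<mu> t * (\<integral>x. norm (dval t x) powr \<alpha> \<partial>torus)) \<le> (\<Sum>t\<in>F. \<mu> t * (C * h t))"
          by (intro sum_mono mult_left_mono \<mu>)
        also have "\<dots> = C * hs" by (simp add: hs_def sum_distrib_left mult.left_commute)
        also have "\<dots> \<le> C * (K0 / c)" using hsK C by (intro mult_left_mono) auto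
        finally show "(\<Sum>t\<in>F. \<mu> t * (\<integral>x. norm (dval t x) powr \<alpha> \<partial>torus)) \<le> K" using K(2) by linarith
      next
        fix \<delta> :: real assume \<delta>: "0 < \<delta>" "\<delta> < 1"
        have "(\<integral>x. max 0 (dens t x - 2 * gconst \<delta>) \<partial>torus) \<le> 2 * \<delta> * p t" if t: "t \<in> F" for t
        proof -
          have "(\<integral>x. max 0 (dens t x - 2 * gconst \<delta>) \<partial>torus) \<le> (\<integral>x. 2 * \<delta> * (dens t x * g (dens t x)) \<partial>torus)"
          proof (rule integral_mono)
            show "integrable torus (\<lambda>x. max 0 (dens t x - 2 * gconst \<delta>))"
              by (intro integrable_torus_continuous continuous_intros classical_cont F t)
            show "integrable torus (\<lambda>x. 2 * \<delta> * (dens t x * g (dens t x)))" using i[OF t] by auto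
            show "max 0 (dens t x - 2 * gconst \<delta>) \<le> 2 * \<delta> * (dens t x * g (dens t x))" if "x \<in> space torus" for x
              by (rule excess_le[OF \<delta>]) (use nn[OF t] that in auto)
          qed
          thus ?thesis by (simp add: p_def)
        qed
        hence "(\<Sum>t\<in>F. \<mu> t * (\<integral>x. max 0 (dens t x - 2 * gconst \<delta>) \<partial>torus)) \<le> (\<Sum>t\<in>F. \<mu> t * (2 * \<delta> * p t))"
          by (intro sum_mono mult_left_mono \<mu>)
        also have "\<dots> = 2 * \<delta> * ps" by (simp add: ps_def sum_distrib_left mult.left_commute)
        also have "\<dots> \<le> 2 * \<delta> * (2 * K0)" using psK \<delta> by (intro mult_left_mono) auto
        also have "\<dots> = \<delta> * (4 * K0)" by simp
        also have "\<dots> \<le> \<delta> * K" using K(1) \<delta> by (intro mult_left_mono) auto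
        finally show "(\<Sum>t\<in>F. \<mu> t * (\<integral>x. max 0 (dens t x - 2 * gconst \<delta>) \<partial>torus)) \<le> \<delta> * K" .
      qed (rule F \<mu>; assumption?)+
      define S where "S = (\<Sum>t\<in>F. \<Sum>s\<in>F. \<mu> t * \<mu> s * minty t (dens s) (val s))"
      have "(\<Sum>t\<in>F. \<mu> t * minty t (\<lambda>x. \<Sum>s\<in>F. \<mu> s * dens s x) (\<lambda>x. \<Sum>s\<in>F. \<mu> s * val s x)) = S"
        unfolding S_def
      proof (intro sum.cong refl)
        fix t assume t: "t \<in> F"
        show "\<mu> t * minty t (\<lambda>x. \<Sum>s\<in>F. \<mu> s * dens s x) (\<lambda>x. \<Sum>s\<in>F. \<mu> s * val s x) = (\<Sum>s\<in>F. \<mu> t * \<mu> s * minty t (dens s) (val s))"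
          by (subst minty_sum[OF F(2)[OF t] F(1) \<mu>(2)]) (auto simp: i sum_distrib_left mult.assoc)
      qed
      moreover have "S \<le> 0"
      proof -
        have "S = (\<Sum>t\<in>F. \<Sum>s\<in>F. \<mu> t * \<mu> s * minty s (dens t) (val t))"
          unfolding S_def by (subst sum.swap) (simp add: mult.commute)
        hence "S + S = (\<Sum>t\<in>F. \<Sum>s\<in>F. \<mu> t * \<mu> s * (minty t (dens s) (val s) + minty s (dens t) (val t)))"
          by (simp add: S_def distrib_left sum.distrib)
        also have "\<dots> \<le> 0"
          by (intro sum_nonpos mult_nonneg_nonpos mult_nonneg_nonneg \<mu> minty_monotone F)
        finally show ?thesis by simp
      qed
      ultimately have le: "(\<Sum>t\<in>F. \<mu> t * minty t (\<lambda>x. \<Sum>s\<in>F. \<mu> s * dens s x) (\<lambda>x. \<Sum>s\<in>F. \<mu> s * val s x)) \<le> 0"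
        by simp
      show ?thesis
        by (rule exI, rule exI, rule exI, rule conjI[OF adm], rule conjI[OF le disjI1]) simp
    qed
  qed
  have "admissible K \<phi> (\<lambda>x. 0) (\<lambda>x. 0)" using shifted[of 0] by simp
  from that[OF this main] show ?thesis by blast
qed

text \<open>The minimax argument needs bounded values. The weighted mean of the test pairs and the shifts of
  \<open>\<phi>\<close> satisfy a bound that depends only on the finite set of tests, because the pairing is affine.\<close>

theorem finite_system_admissible:
  obtains K where "\<And>F \<epsilon>. finite F \<Longrightarrow> (\<And>t. t \<in> F \<Longrightarrow> classical t) \<Longrightarrow> \<epsilon> > 0 \<Longrightarrow>
    \<exists>m u D. admissible K m u D \<and> (\<forall>t\<in>F. minty t m u \<le> \<epsilon>)"
proof -
  obtain K c where K: "admissible K \<phi> (\<lambda>x. 0) (\<lambda>x. 0)"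
    and W: "\<And>F \<mu>. finite F \<Longrightarrow> (\<And>t. t \<in> F \<Longrightarrow> classical t) \<Longrightarrow> (\<And>t. t \<in> F \<Longrightarrow> 0 \<le> \<mu> t) \<Longrightarrow> (\<Sum>t\<in>F. \<mu> t) = 1 \<Longrightarrow>
      \<exists>m u D. admissible K m u D \<and> (\<Sum>t\<in>F. \<mu> t * minty t m u) \<le> 0 \<and>
        ((m = (\<lambda>x. \<Sum>t\<in>F. \<mu> t * dens t x) \<and> u = (\<lambda>x. \<Sum>t\<in>F. \<mu> t * val t x)) \<or>
         (\<exists>s\<in>{0, 1, -c}. m = (\<lambda>x. \<phi> x + s) \<and> u = (\<lambda>x. 0)))"
    by (rule weighted_admissible) blast
  have main: "\<exists>m u D. admissible K m u D \<and> (\<forall>t\<in>F. minty t m u \<le> \<epsilon>)"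
    if F: "finite F" "\<And>t. t \<in> F \<Longrightarrow> classical t" and \<epsilon>: "\<epsilon> > 0" for F \<epsilon>
  proof -
    \<comment> \<open>\<open>P\<close> bounds the values at means of test pairs, and \<open>R\<close> the values at the shifts of \<open>\<phi>\<close>.\<close>
    define P where "P = (\<Sum>t\<in>F. \<Sum>s\<in>F. \<bar>minty t (dens s) (val s)\<bar>)"
    define R where "R = (\<Sum>t\<in>F. \<Sum>s\<in>{0, 1, -c}. \<bar>minty t (\<lambda>x. \<phi> x + s) (\<lambda>x. 0)\<bar>)"
    have P: "(\<Sum>s\<in>F. \<bar>minty t (dens s) (val s)\<bar>) \<le> P" if "t \<in> F" for t
      unfolding P_def by (rule member_le_sum[OF that]) (auto intro!: sum_nonneg F)
    have R: "\<bar>minty t (\<lambda>x. \<phi> x + s) (\<lambda>x. 0)\<bar> \<le> R" if "t \<in> F" "s \<in> {0, 1, -c}" for t s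
    proof -
      have "\<bar>minty t (\<lambda>x. \<phi> x + s) (\<lambda>x. 0)\<bar> \<le> (\<Sum>s\<in>{0, 1, -c}. \<bar>minty t (\<lambda>x. \<phi> x + s) (\<lambda>x. 0)\<bar>)"
        by (rule member_le_sum[OF that(2)]) auto
      also have "\<dots> \<le> R" unfolding R_def by (rule member_le_sum[OF that(1)]) (auto intro!: sum_nonneg F)
      finally show ?thesis .
    qed
    have P0: "P \<ge> 0" "R \<ge> 0" unfolding P_def R_def by (auto intro!: sum_nonneg)
    define Y where "Y = {y. \<exists>m u D. admissible K m u D \<and> y = (\<lambda>t. if t \<in> F then minty t m u else 0) \<and>
        (\<forall>t\<in>F. \<bar>y t\<bar> \<le> P + R)}"
    have im: "integrable torus m" "integrable torus u" if "admissible K m u D" for m u D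
    proof -
      have "continuous_on UNIV m" "C1_torus u D" using that by (auto simp: admissible_def)
      thus "integrable torus m" "integrable torus u"
        using C1_torusD(4)[of u D "cbox 0 1"] continuous_on_subset[of UNIV m "cbox 0 1"]
        by (simp_all add: integrable_torus_continuous)
    qed
    have i: "integrable torus (dens t)" "integrable torus (val t)" if "t \<in> F" for t
      by (intro integrable_torus_continuous classical_cont F that)+
    have "\<exists>y\<in>Y. \<forall>t\<in>F. y t \<le> \<epsilon>"
    proof (rule finite_convex_system[OF F(1)])
      fix y z r assume y: "y \<in> Y" and z: "z \<in> Y" and r: "0 \<le> (r::real)" "r \<le> 1"
      obtain m u D where a: "admissible K m u D" "y = (\<lambda>t. if t \<in> F then minty t m u else 0)"
        "\<forall>t\<in>F. \<bar>y t\<bar> \<le> P + R" using y by (auto simp: Y_def)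
      obtain m' u' D' where a': "admissible K m' u' D'" "z = (\<lambda>t. if t \<in> F then minty t m' u' else 0)"
        "\<forall>t\<in>F. \<bar>z t\<bar> \<le> P + R" using z by (auto simp: Y_def)
      have e: "(\<lambda>t. (1 - r) * y t + r * z t) = (\<lambda>t. if t \<in> F then
         minty t (\<lambda>x. (1 - r) * m x + r * m' x) (\<lambda>x. (1 - r) * u x + r * u' x) else 0)"
        using minty_convex_combination[OF F(2) im[OF a(1)] im[OF a'(1)]] by (auto simp: a(2) a'(2) fun_eq_iff)
      have "\<bar>(1 - r) * y t + r * z t\<bar> \<le> P + R" if t: "t \<in> F" for t
      proof -
        have "\<bar>(1 - r) * y t + r * z t\<bar> \<le> (1 - r) * \<bar>y t\<bar> + r * \<bar>z t\<bar>"
          using r by (intro order_trans[OF abs_triangle_ineq]) (simp add: abs_mult)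
        also have "\<dots> \<le> (1 - r) * (P + R) + r * (P + R)"
          using a(3) a'(3) t r by (intro add_mono mult_left_mono) auto
        finally show ?thesis by (simp add: algebra_simps)
      qed
      thus "(\<lambda>t. (1 - r) * y t + r * z t) \<in> Y"
        unfolding Y_def using admissible_convex[OF a(1) a'(1) r] e by blast
    next
      show "\<bar>y t\<bar> \<le> P + R" if "y \<in> Y" "t \<in> F" for y t using that by (auto simp: Y_def)
      have "(\<lambda>t. if t \<in> F then minty t \<phi> (\<lambda>x. 0) else 0) \<in> Y"
        unfolding Y_def mem_Collect_eq
      proof (rule exI, rule exI, rule exI, rule conjI[OF K], rule conjI[OF refl], rule ballI)
        fix t assume "t \<in> F"
        thus "\<bar>if t \<in> F then minty t \<phi> (\<lambda>x. 0) else 0\<bar> \<le> P + R" using R[of t 0] P0 by simp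
      qed
      thus "Y \<noteq> {}" by blast
    next
      fix \<mu> :: "'n test_pair \<Rightarrow> real" assume \<mu>: "\<And>i. i \<in> F \<Longrightarrow> 0 \<le> \<mu> i" "sum \<mu> F = 1"
      obtain m u D where a: "admissible K m u D" "(\<Sum>t\<in>F. \<mu> t * minty t m u) \<le> 0"
        "(m = (\<lambda>x. \<Sum>t\<in>F. \<mu> t * dens t x) \<and> u = (\<lambda>x. \<Sum>t\<in>F. \<mu> t * val t x)) \<or>
         (\<exists>s\<in>{0, 1, -c}. m = (\<lambda>x. \<phi> x + s) \<and> u = (\<lambda>x. 0))"
        using W[OF F \<mu>] by blast
      have b: "\<bar>minty t m u\<bar> \<le> P + R" if t: "t \<in> F" for t
        using a(3)
      proof
        assume mu: "m = (\<lambda>x. \<Sum>t\<in>F. \<mu> t * dens t x) \<and> u = (\<lambda>x. \<Sum>t\<in>F. \<mu> t * val t x)"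
        have "minty t m u = (\<Sum>s\<in>F. \<mu> s * minty t (dens s) (val s))"
          using minty_sum[OF F(2)[OF t] F(1) \<mu>(2) i] mu by simp
        also have "\<bar>\<dots>\<bar> \<le> (\<Sum>s\<in>F. \<mu> s * \<bar>minty t (dens s) (val s)\<bar>)"
          using \<mu>(1) by (intro order_trans[OF sum_abs] sum_mono) (simp add: abs_mult)
        also have "\<dots> \<le> (\<Sum>s\<in>F. 1 * \<bar>minty t (dens s) (val s)\<bar>)"
          using \<mu> member_le_sum[of _ F \<mu>] F(1) by (intro sum_mono mult_right_mono) auto
        also have "\<dots> \<le> P" using P[OF t] by simp
        finally show ?thesis using P0 by simp
      next
        assume "\<exists>s\<in>{0, 1, -c}. m = (\<lambda>x. \<phi> x + s) \<and> u = (\<lambda>x. 0)"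
        then obtain s where "s \<in> {0, 1, -c}" "m = (\<lambda>x. \<phi> x + s)" "u = (\<lambda>x. 0)" by blast
        thus ?thesis using R[OF t, of s] P0 by simp
      qed
      define z where "z = (\<lambda>t. if t \<in> F then minty t m u else 0)"
      have "z \<in> Y" unfolding Y_def z_def using a(1) b by auto
      moreover have "(\<Sum>t\<in>F. \<mu> t * z t) \<le> 0" using a(2) by (simp add: z_def)
      ultimately show "\<exists>z\<in>Y. (\<Sum>t\<in>F. \<mu> t * z t) \<le> 0" by blast
    qed (rule \<epsilon>)
    then obtain y where y: "y \<in> Y" "\<forall>t\<in>F. y t \<le> \<epsilon>" by blast
    then obtain m u D where "admissible K m u D" "y = (\<lambda>t. if t \<in> F then minty t m u else 0)"
      by (auto simp: Y_def)
    thus ?thesis using y(2) by (metis (no_types, lifting))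
  qed
  from that[OF main] show ?thesis by blast
qed

end

section \<open>A solution tested against classical pairs\<close>

lemma test_torus_C1:
  assumes "\<psi> \<in> test_torus"
  shows "C1_torus \<psi> (gradient \<psi>)"
  using assms class_C2_derivatives(1,4)[of \<psi>] by (auto simp: test_torus_def C1_torus_def)

lemma bounded_on_cube:
  fixes h :: "real^'n \<Rightarrow> real"
  assumes "continuous_on (cbox 0 1) h"
  obtains B where "B \<ge> 0" "\<And>x. x \<in> cbox 0 1 \<Longrightarrow> \<bar>h x\<bar> \<le> B"
proof -
  obtain B where "\<And>x. x \<in> cbox 0 1 \<Longrightarrow> norm (h x) \<le> B"
    using compact_imp_bounded[OF compact_continuous_image[OF assms compact_cbox]]
    by (auto simp: bounded_iff)
  thus ?thesis by (intro that[of "max 0 B"]) (auto simp: le_max_iff_disj)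
qed

lemma tendsto_integral_mult_L1:
  fixes h :: "real^'n \<Rightarrow> real"
  assumes h: "continuous_on (cbox 0 1) h" and f: "\<And>n. integrable torus (f n)" "integrable torus l"
    and conv: "(\<lambda>n. \<integral>x. \<bar>f n x - l x\<bar> \<partial>torus) \<longlonglongrightarrow> 0"
  shows "(\<lambda>n. \<integral>x. h x * f n x \<partial>torus) \<longlonglongrightarrow> (\<integral>x. h x * l x \<partial>torus)"
proof -
  obtain B where B: "B \<ge> 0" "\<And>x. x \<in> cbox 0 1 \<Longrightarrow> \<bar>h x\<bar> \<le> B" using bounded_on_cube[OF h] by blast
  note i = integrable_torus_mult_continuous[OF h]
  have "(\<lambda>n. (\<integral>x. h x * f n x \<partial>torus) - (\<integral>x. h x * l x \<partial>torus)) \<longlonglongrightarrow> 0"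
  proof (rule Lim_null_comparison)
    show "(\<lambda>n. B * (\<integral>x. \<bar>f n x - l x\<bar> \<partial>torus)) \<longlonglongrightarrow> 0" using tendsto_mult_left[OF conv, of B] by simp
    have "norm ((\<integral>x. h x * f n x \<partial>torus) - (\<integral>x. h x * l x \<partial>torus)) \<le> B * (\<integral>x. \<bar>f n x - l x\<bar> \<partial>torus)" for n
    proof -
      have "(\<integral>x. h x * f n x \<partial>torus) - (\<integral>x. h x * l x \<partial>torus) = (\<integral>x. h x * (f n x - l x) \<partial>torus)"
        using i[OF f(1)] i[OF f(2)] by (simp add: right_diff_distrib)
      also have "norm \<dots> \<le> (\<integral>x. B * \<bar>f n x - l x\<bar> \<partial>torus)"
      proof (rule order_trans[OF integral_norm_bound integral_mono])
        show "integrable torus (\<lambda>x. norm (h x * (f n x - l x)))" using i[of "\<lambda>x. f n x - l x"] f by auto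
        show "integrable torus (\<lambda>x. B * \<bar>f n x - l x\<bar>)" using f by auto
        show "norm (h x * (f n x - l x)) \<le> B * \<bar>f n x - l x\<bar>" if "x \<in> space torus" for x
          using B(2)[of x] that by (simp add: abs_mult mult_right_mono)
      qed
      finally show ?thesis by simp
    qed
    thus "\<forall>\<^sub>F n in sequentially. norm ((\<integral>x. h x * f n x \<partial>torus) - (\<integral>x. h x * l x \<partial>torus))
       \<le> B * (\<integral>x. \<bar>f n x - l x\<bar> \<partial>torus)" by simp
  qed
  thus ?thesis by (simp add: LIM_zero_iff)
qed

lemma integrable_powr_limit:
  fixes f :: "nat \<Rightarrow> 'a \<Rightarrow> real"
  assumes m: "\<And>n. f n \<in> borel_measurable M" "l \<in> borel_measurable M" and \<alpha>: "\<alpha> > 1"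
    and conv: "AE x in M. (\<lambda>n. f n x) \<longlonglongrightarrow> l x"
    and i: "\<And>n. integrable M (\<lambda>x. \<bar>f n x\<bar> powr \<alpha>)" and K: "\<And>n. (\<integral>x. \<bar>f n x\<bar> powr \<alpha> \<partial>M) \<le> K"
  shows "integrable M (\<lambda>x. \<bar>l x\<bar> powr \<alpha>)"
proof -
  note [measurable] = m
  have "(\<integral>\<^sup>+x. ennreal (\<bar>l x\<bar> powr \<alpha>) \<partial>M) = (\<integral>\<^sup>+x. liminf (\<lambda>n. ennreal (\<bar>f n x\<bar> powr \<alpha>)) \<partial>M)"
  proof (rule nn_integral_cong_AE)
    show "AE x in M. ennreal (\<bar>l x\<bar> powr \<alpha>) = liminf (\<lambda>n. ennreal (\<bar>f n x\<bar> powr \<alpha>))"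
      using conv
    proof eventually_elim
      case (elim x)
      have "(\<lambda>n. \<bar>f n x\<bar> powr \<alpha>) \<longlonglongrightarrow> \<bar>l x\<bar> powr \<alpha>"
        by (intro tendsto_powr' tendsto_rabs elim tendsto_const) (use \<alpha> in auto)
      hence "(\<lambda>n. ennreal (\<bar>f n x\<bar> powr \<alpha>)) \<longlonglongrightarrow> ennreal (\<bar>l x\<bar> powr \<alpha>)" by (rule tendsto_ennrealI)
      from lim_imp_Liminf[OF trivial_limit_sequentially this] show ?case by simp
    qed
  qed
  also have "\<dots> \<le> liminf (\<lambda>n. \<integral>\<^sup>+x. ennreal (\<bar>f n x\<bar> powr \<alpha>) \<partial>M)"
    by (rule nn_integral_liminf) simp
  also have "\<dots> \<le> liminf (\<lambda>n. ennreal K)"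
    using K by (intro Liminf_mono always_eventually allI) (simp add: nn_integral_eq_integral[OF i] ennreal_leI)
  also have "\<dots> = ennreal K" by (simp add: Liminf_const)
  finally have "(\<integral>\<^sup>+x. ennreal (\<bar>l x\<bar> powr \<alpha>) \<partial>M) < \<infinity>" by (simp add: order_le_less_trans)
  thus ?thesis by (intro integrableI_nonneg) auto
qed

lemma powr_add_le:
  fixes a b :: real
  assumes "a \<ge> 0" "b \<ge> 0" "\<alpha> > 1"
  shows "(a + b) powr \<alpha> \<le> 2 powr \<alpha> * (a powr \<alpha> + b powr \<alpha>)"
proof -
  have "(a + b) powr \<alpha> \<le> (2 * max a b) powr \<alpha>" using assms by (intro powr_mono2) auto
  also have "\<dots> = 2 powr \<alpha> * (max a b) powr \<alpha>" using assms by (simp add: powr_mult)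
  also have "(max a b) powr \<alpha> \<le> a powr \<alpha> + b powr \<alpha>" by (auto simp: max_def)
  finally show ?thesis by simp
qed

lemma excess_powr_le:
  fixes r S :: real
  assumes "r \<ge> 0" "S > 0" "\<alpha> > 1"
  shows "max 0 (r - S) \<le> S powr (1 - \<alpha>) * r powr \<alpha>"
proof (cases "r \<le> S")
  case False
  have "r = r powr (1 - \<alpha>) * r powr \<alpha>" using False assms by (simp flip: powr_add)
  also have "\<dots> \<le> S powr (1 - \<alpha>) * r powr \<alpha>"
    using False assms by (intro mult_right_mono powr_mono2') auto
  finally show ?thesis using assms by simp
qed (use assms in auto)

context mean_field_game begin

lemma admissible_integrable:
  assumes a: "admissible K m u D"
  shows "integrable torus m" "integrable torus u" "integrable torus D" "integrable torus (\<lambda>x. \<bar>u x\<bar> powr \<alpha>)"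
    "integrable torus (\<lambda>x. norm (D x) powr \<alpha>)" "integrable torus (\<lambda>x. max 0 (m x - s))"
proof -
  have "continuous_on UNIV m" "C1_torus u D" using a by (auto simp: admissible_def)
  hence c: "continuous_on (cbox 0 1) m" "continuous_on (cbox 0 1) u" "continuous_on (cbox 0 1) D"
    using C1_torusD[of u D] continuous_on_subset[of UNIV m "cbox 0 1"] by auto
  show "integrable torus m" "integrable torus u" "integrable torus D" "integrable torus (\<lambda>x. \<bar>u x\<bar> powr \<alpha>)"
    "integrable torus (\<lambda>x. norm (D x) powr \<alpha>)" "integrable torus (\<lambda>x. max 0 (m x - s))"
    by (intro integrable_torus_continuous continuous_intros continuous_on_norm_powr c \<alpha>)+
qed

lemma admissible_powr_bound:
  obtains K' where "K' \<ge> 0" "\<And>m u D. admissible K m u D \<Longrightarrow> (\<integral>x. \<bar>u x\<bar> powr \<alpha> \<partial>torus) \<le> K'"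
proof -
  define K' where "K' = 2 powr \<alpha> * (real CARD('n) powr \<alpha> * \<bar>K\<bar> + \<bar>K\<bar> powr \<alpha>)"
  have "(\<integral>x. \<bar>u x\<bar> powr \<alpha> \<partial>torus) \<le> K'" if a: "admissible K m u D" for m u D
  proof -
    define b where "b = (\<integral>x. u x \<partial>torus)"
    have u: "C1_torus u D" and b: "\<bar>b\<bar> \<le> K" and D: "(\<integral>x. norm (D x) powr \<alpha> \<partial>torus) \<le> K"
      using a by (auto simp: admissible_def b_def)
    have i: "integrable torus (\<lambda>x. \<bar>u x - b\<bar> powr \<alpha>)"
      by (intro integrable_torus_continuous continuous_intros C1_torusD[OF u] \<alpha>)
    have "(\<integral>x. \<bar>u x\<bar> powr \<alpha> \<partial>torus) \<le> (\<integral>x. 2 powr \<alpha> * (\<bar>u x - b\<bar> powr \<alpha> + \<bar>b\<bar> powr \<alpha>) \<partial>torus)"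
    proof (rule integral_mono[OF admissible_integrable(4)[OF a]])
      show "integrable torus (\<lambda>x. 2 powr \<alpha> * (\<bar>u x - b\<bar> powr \<alpha> + \<bar>b\<bar> powr \<alpha>))" using i by auto
      fix x
      have "\<bar>u x\<bar> powr \<alpha> \<le> (\<bar>u x - b\<bar> + \<bar>b\<bar>) powr \<alpha>" using \<alpha> by (intro powr_mono2) auto
      also have "\<dots> \<le> 2 powr \<alpha> * (\<bar>u x - b\<bar> powr \<alpha> + \<bar>b\<bar> powr \<alpha>)" by (intro powr_add_le \<alpha>) auto
      finally show "\<bar>u x\<bar> powr \<alpha> \<le> 2 powr \<alpha> * (\<bar>u x - b\<bar> powr \<alpha> + \<bar>b\<bar> powr \<alpha>)" .
    qed
    also have "\<dots> = 2 powr \<alpha> * ((\<integral>x. \<bar>u x - b\<bar> powr \<alpha> \<partial>torus) + \<bar>b\<bar> powr \<alpha>)" using i by simp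
    also have "\<dots> \<le> K'"
    proof -
      have "(\<integral>x. \<bar>u x - b\<bar> powr \<alpha> \<partial>torus) \<le> real CARD('n) powr \<alpha> * (\<integral>x. norm (D x) powr \<alpha> \<partial>torus)"
        unfolding b_def by (rule poincare_torus[OF u \<alpha>])
      also have "\<dots> \<le> real CARD('n) powr \<alpha> * \<bar>K\<bar>" using D by (intro mult_left_mono) auto
      finally have "(\<integral>x. \<bar>u x - b\<bar> powr \<alpha> \<partial>torus) \<le> real CARD('n) powr \<alpha> * \<bar>K\<bar>" .
      moreover have "\<bar>b\<bar> powr \<alpha> \<le> \<bar>K\<bar> powr \<alpha>" using b \<alpha> by (intro powr_mono2) auto
      ultimately show ?thesis unfolding K'_def by (intro mult_left_mono add_mono) auto
    qed
    finally show ?thesis .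
  qed
  thus ?thesis by (intro that[of K']) (auto simp: K'_def)
qed

text \<open>Uniform integrability of the triples: the density by the bound on its excess, the value function
  and its gradient because they are bounded in \<open>L\<^sup>\<alpha>\<close> with \<open>\<alpha> > 1\<close>.\<close>

lemma admissible_uniformly_integrable:
  assumes \<epsilon>: "\<epsilon> > 0"
  shows "\<exists>S\<ge>0. \<forall>m u D. admissible K m u D \<longrightarrow> (\<integral>x. max 0 (norm (m x, u x, D x) - S) \<partial>torus) \<le> \<epsilon>"
proof -
  obtain K' where K': "K' \<ge> 0" "\<And>m u D. admissible K m u D \<Longrightarrow> (\<integral>x. \<bar>u x\<bar> powr \<alpha> \<partial>torus) \<le> K'"
    using admissible_powr_bound by blast
  define B where "B = \<bar>K\<bar> + K' + 1"
  have B: "B > 0" "K \<le> B" "K' \<le> B" using K' by (auto simp: B_def)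
  define \<delta> where "\<delta> = min (1/2) (\<epsilon> / (3 * B))"
  have \<delta>: "0 < \<delta>" "\<delta> < 1" "\<delta> * B \<le> \<epsilon> / 3"
  proof -
    have "\<delta> * B \<le> \<epsilon> / (3 * B) * B" using B by (intro mult_right_mono) (auto simp: \<delta>_def)
    thus "\<delta> * B \<le> \<epsilon> / 3" using B by simp
  qed (use \<epsilon> B in \<open>auto simp: \<delta>_def\<close>)
  have "((\<lambda>S::real. S powr (1 - \<alpha>)) \<longlongrightarrow> 0) at_top"
    by (rule tendsto_neg_powr) (use \<alpha> in \<open>auto intro: filterlim_ident\<close>)
  hence "\<forall>\<^sub>F S::real in at_top. S powr (1 - \<alpha>) < \<epsilon> / (3 * B)"
    by (rule order_tendstoD) (use \<epsilon> B in auto)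
  moreover have "\<forall>\<^sub>F S::real in at_top. S \<ge> max 1 (2 * gconst \<delta>)" by (rule eventually_ge_at_top)
  ultimately have "\<forall>\<^sub>F S::real in at_top. S powr (1 - \<alpha>) < \<epsilon> / (3 * B) \<and> S \<ge> max 1 (2 * gconst \<delta>)"
    by eventually_elim simp
  then obtain S where S: "S powr (1 - \<alpha>) < \<epsilon> / (3 * B)" "S \<ge> max 1 (2 * gconst \<delta>)"
    using eventually_happens'[OF trivial_limit_at_top_linorder] by blast
  have S1: "S \<ge> 1" "2 * gconst \<delta> \<le> S" using S(2) by auto
  have SB: "S powr (1 - \<alpha>) * B \<le> \<epsilon> / 3"
  proof -
    have "S powr (1 - \<alpha>) * B \<le> \<epsilon> / (3 * B) * B" using S(1) B by (intro mult_right_mono) auto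
    thus ?thesis using B by simp
  qed
  have "(\<integral>x. max 0 (norm (m x, u x, D x) - 3 * S) \<partial>torus) \<le> \<epsilon>" if a: "admissible K m u D" for m u D
  proof -
    note ai = admissible_integrable[OF a]
    have "(\<integral>x. max 0 (norm (m x, u x, D x) - 3 * S) \<partial>torus)
        \<le> (\<integral>x. max 0 (m x - 2 * gconst \<delta>) + S powr (1 - \<alpha>) * \<bar>u x\<bar> powr \<alpha> + S powr (1 - \<alpha>) * norm (D x) powr \<alpha> \<partial>torus)"
    proof (rule integral_mono)
      have "continuous_on UNIV m" "C1_torus u D" using a by (auto simp: admissible_def)
      hence c: "continuous_on (cbox 0 1) m" "continuous_on (cbox 0 1) u" "continuous_on (cbox 0 1) D"
        using C1_torusD[of u D] continuous_on_subset[of UNIV m "cbox 0 1"] by auto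
      show "integrable torus (\<lambda>x. max 0 (norm (m x, u x, D x) - 3 * S))"
        by (intro integrable_torus_continuous continuous_intros c)
      show "integrable torus (\<lambda>x. max 0 (m x - 2 * gconst \<delta>) + S powr (1 - \<alpha>) * \<bar>u x\<bar> powr \<alpha> + S powr (1 - \<alpha>) * norm (D x) powr \<alpha>)"
        using ai(4,5) ai(6) by auto
      fix x :: "real^'n" assume "x \<in> space torus"
      hence mx: "0 \<le> m x" using a by (auto simp: admissible_def)
      have "norm (m x, u x, D x) \<le> m x + (\<bar>u x\<bar> + norm (D x))"
        using norm_Pair_le[of "m x" "(u x, D x)"] norm_Pair_le[of "u x" "D x"] mx by simp
      hence "max 0 (norm (m x, u x, D x) - 3 * S)
          \<le> max 0 (m x - S) + max 0 (\<bar>u x\<bar> - S) + max 0 (norm (D x) - S)" by linarith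
      moreover have "max 0 (m x - S) \<le> max 0 (m x - 2 * gconst \<delta>)" using S1 by simp
      moreover have "max 0 (\<bar>u x\<bar> - S) \<le> S powr (1 - \<alpha>) * \<bar>u x\<bar> powr \<alpha>"
        by (rule excess_powr_le) (use S1 \<alpha> in auto)
      moreover have "max 0 (norm (D x) - S) \<le> S powr (1 - \<alpha>) * norm (D x) powr \<alpha>"
        by (rule excess_powr_le) (use S1 \<alpha> in auto)
      ultimately show "max 0 (norm (m x, u x, D x) - 3 * S)
        \<le> max 0 (m x - 2 * gconst \<delta>) + S powr (1 - \<alpha>) * \<bar>u x\<bar> powr \<alpha> + S powr (1 - \<alpha>) * norm (D x) powr \<alpha>"
        by linarith
    qed
    also have "\<dots> = (\<integral>x. max 0 (m x - 2 * gconst \<delta>) \<partial>torus) + S powr (1 - \<alpha>) * (\<integral>x. \<bar>u x\<bar> powr \<alpha> \<partial>torus)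
        + S powr (1 - \<alpha>) * (\<integral>x. norm (D x) powr \<alpha> \<partial>torus)"
      using ai(4,5) ai(6) by simp
    also have "\<dots> \<le> \<delta> * B + S powr (1 - \<alpha>) * B + S powr (1 - \<alpha>) * B"
    proof (intro add_mono mult_left_mono)
      have "(\<integral>x. max 0 (m x - 2 * gconst \<delta>) \<partial>torus) \<le> \<delta> * K" using a \<delta> by (auto simp: admissible_def)
      also have "\<dots> \<le> \<delta> * B" using B \<delta> by (intro mult_left_mono) auto
      finally show "(\<integral>x. max 0 (m x - 2 * gconst \<delta>) \<partial>torus) \<le> \<delta> * B" .
      show "(\<integral>x. \<bar>u x\<bar> powr \<alpha> \<partial>torus) \<le> B" using K'(2)[OF a] B by linarith
      show "(\<integral>x. norm (D x) powr \<alpha> \<partial>torus) \<le> B" using a B by (auto simp: admissible_def)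
    qed auto
    also have "\<dots> \<le> \<epsilon>" using \<delta>(3) SB by linarith
    finally show ?thesis .
  qed
  thus ?thesis using S1 by (intro exI[of _ "3 * S"]) auto
qed

lemma minty_tendsto:
  assumes t: "classical t" and i: "\<And>n. integrable torus (m n)" "\<And>n. integrable torus (u n)" "integrable torus m'" "integrable torus u'"
    and conv: "(\<lambda>n. \<integral>x. \<bar>m n x - m' x\<bar> \<partial>torus) \<longlonglongrightarrow> 0" "(\<lambda>n. \<integral>x. \<bar>u n x - u' x\<bar> \<partial>torus) \<longlonglongrightarrow> 0"
  shows "(\<lambda>n. minty t (m n) (u n)) \<longlonglongrightarrow> minty t m' u'"
  unfolding minty_affine[OF t i(1,2)] minty_affine[OF t i(3,4)]
  by (intro tendsto_intros tendsto_integral_mult_L1 hjb_cont fpk_cont t i conv)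

text \<open>Each constraint is one inequality with one positive error, so that finitely many constraints have
  a common error. The nested limit theorem is applied to the triples of density, value function and
  gradient; the limit of the gradients is the weak gradient of the limit.\<close>

theorem exists_minty_solution:
  "\<exists>m u. m \<in> Lp_torus 1 \<inter> nonneg_torus \<and> u \<in> Lp_torus 1 \<and> integrable torus m \<and> integrable torus u \<and>
     u \<in> sobolev_torus 1 \<alpha> \<and> (\<forall>t. classical t \<longrightarrow> minty t m u \<le> 0)"
proof -
  obtain K where K: "\<And>F \<epsilon>. finite F \<Longrightarrow> (\<And>t. t \<in> F \<Longrightarrow> classical t) \<Longrightarrow> \<epsilon> > 0 \<Longrightarrow>
    \<exists>m u D. admissible K m u D \<and> (\<forall>t\<in>F. minty t m u \<le> \<epsilon>)" by (rule finite_system_admissible) blast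
  define pm where "pm = (\<lambda>(P :: real^'n \<Rightarrow> real \<times> real \<times> (real^'n)) x. fst (P x))"
  define pu where "pu = (\<lambda>(P :: real^'n \<Rightarrow> real \<times> real \<times> (real^'n)) x. fst (snd (P x)))"
  define pD where "pD = (\<lambda>(P :: real^'n \<Rightarrow> real \<times> real \<times> (real^'n)) x. snd (snd (P x)))"
  have P: "P = (\<lambda>x. (pm P x, pu P x, pD P x))" for P by (simp add: pm_def pu_def pD_def)
  define X where "X = {P. admissible K (pm P) (pu P) (pD P)}"
  define I where "I = {(t :: 'n test_pair, \<epsilon> :: real). classical t \<and> \<epsilon> > 0}"
  define C where "C = (\<lambda>(t, \<epsilon>). {P. minty t (pm P) (pu P) \<le> \<epsilon>})"
  have mid: "pm (\<lambda>x. (1/2) *\<^sub>R (P x + Q x)) = (\<lambda>x. (1 - 1/2) * pm P x + (1/2) * pm Q x)"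
    "pu (\<lambda>x. (1/2) *\<^sub>R (P x + Q x)) = (\<lambda>x. (1 - 1/2) * pu P x + (1/2) * pu Q x)"
    "pD (\<lambda>x. (1/2) *\<^sub>R (P x + Q x)) = (\<lambda>x. (1 - 1/2) *\<^sub>R pD P x + (1/2) *\<^sub>R pD Q x)" for P Q
    by (simp_all add: pm_def pu_def pD_def fun_eq_iff distrib_left scaleR_add_right)
  have ai: "integrable torus (pm P)" "integrable torus (pu P)" "integrable torus (pD P)"
    "integrable torus (\<lambda>x. \<bar>pu P x\<bar> powr \<alpha>)" "integrable torus (\<lambda>x. norm (pD P x) powr \<alpha>)" if "P \<in> X" for P
    using admissible_integrable[of K "pm P" "pu P" "pD P"] that by (auto simp: X_def)
  have XI: "integrable torus P" if "P \<in> X" for P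
  proof -
    have "continuous_on UNIV (pm P)" "C1_torus (pu P) (pD P)" using that by (auto simp: X_def admissible_def)
    hence "continuous_on (cbox 0 1) (pm P)" "continuous_on (cbox 0 1) (pu P)" "continuous_on (cbox 0 1) (pD P)"
      using C1_torusD[of "pu P" "pD P"] continuous_on_subset[of UNIV "pm P" "cbox 0 1"] by auto
    hence "integrable torus (\<lambda>x. (pm P x, pu P x, pD P x))"
      by (intro integrable_torus_continuous continuous_intros)
    thus ?thesis using P[of P] by simp
  qed
  obtain Q L where Q: "\<And>n. Q n \<in> X" and L: "L = (\<lambda>x. lim (\<lambda>n. Q n x))" and Li: "integrable torus L"
    and ae: "AE x in torus. (\<lambda>n. Q n x) \<longlonglongrightarrow> L x" and QL: "(\<lambda>n. \<integral>x. norm (Q n x - L x) \<partial>torus) \<longlonglongrightarrow> 0"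
    and R: "\<And>i. i \<in> I \<Longrightarrow> \<exists>R. (\<forall>n. R n \<in> X \<inter> C i) \<and> (\<lambda>n. \<integral>x. norm (R n x - L x) \<partial>torus) \<longlonglongrightarrow> 0"
  proof (rule nested_convex_L1_limit[of torus X I C])
    show "finite_measure (torus :: (real^'n) measure)" by (rule torus.finite_measure_axioms)
    show "integrable torus P" if "P \<in> X" for P by (rule XI[OF that])
    show "\<exists>S\<ge>0. \<forall>P\<in>X. (\<integral>x. max 0 (norm (P x) - S) \<partial>torus) \<le> \<epsilon>" if \<epsilon>: "\<epsilon> > 0" for \<epsilon>
    proof -
      obtain S where S: "S \<ge> 0" "\<And>m u D. admissible K m u D \<Longrightarrow> (\<integral>x. max 0 (norm (m x, u x, D x) - S) \<partial>torus) \<le> \<epsilon>"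
        using admissible_uniformly_integrable[OF \<epsilon>, of K] by blast
      have "(\<integral>x. max 0 (norm (P x) - S) \<partial>torus) \<le> \<epsilon>" if "P \<in> X" for P
        using S(2)[of "pm P" "pu P" "pD P"] that by (simp add: X_def pm_def pu_def pD_def)
      thus ?thesis using S(1) by blast
    qed
    show "(\<lambda>x. (1/2) *\<^sub>R (P x + Q x)) \<in> X" if "P \<in> X" "Q \<in> X" for P Q
      using admissible_convex[of K "pm P" "pu P" "pD P" "pm Q" "pu Q" "pD Q" "1/2"] that
      unfolding X_def mem_Collect_eq mid by simp
    show "(\<lambda>x. (1/2) *\<^sub>R (P x + Q x)) \<in> C i" if iI: "i \<in> I" and PQ: "P \<in> X \<inter> C i" "Q \<in> X \<inter> C i" for i P Q
    proof -
      obtain t \<epsilon> where i: "i = (t, \<epsilon>)" "classical t" using iI by (auto simp: I_def)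
      have X: "P \<in> X" "Q \<in> X" and le: "minty t (pm P) (pu P) \<le> \<epsilon>" "minty t (pm Q) (pu Q) \<le> \<epsilon>"
        using PQ by (auto simp: C_def i(1))
      show ?thesis
        using minty_convex_combination[OF i(2) ai(1,2)[OF X(1)] ai(1,2)[OF X(2)], of "1/2"] le
        unfolding C_def i(1) case_prod_conv mem_Collect_eq mid by simp
    qed
    show "\<exists>P\<in>X. \<forall>i\<in>F. P \<in> C i" if F: "finite F" "F \<subseteq> I" for F
    proof -
      define \<epsilon> where "\<epsilon> = Min (insert 1 (snd ` F))"
      have \<epsilon>: "\<epsilon> > 0" "\<And>i. i \<in> F \<Longrightarrow> \<epsilon> \<le> snd i"
        using F by (auto simp: \<epsilon>_def I_def)
      obtain m u D where a: "admissible K m u D" "\<forall>t\<in>fst ` F. minty t m u \<le> \<epsilon>"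
        using K[of "fst ` F" \<epsilon>] F \<epsilon>(1) by (fastforce simp: I_def)
      have "(\<lambda>x. (m x, u x, D x)) \<in> X" using a(1) by (simp add: X_def pm_def pu_def pD_def)
      moreover have "(\<lambda>x. (m x, u x, D x)) \<in> C i" if "i \<in> F" for i
        using a(2) \<epsilon>(2)[OF that] that
        by (cases i) (force simp: C_def pm_def pu_def)
      ultimately show ?thesis by blast
    qed
  next
    fix Q P
    assume "\<And>n. Q n \<in> X" "P = (\<lambda>x. lim (\<lambda>n. Q n x))" "integrable torus P"
      "AE x in torus. (\<lambda>n. Q n x) \<longlonglongrightarrow> P x" "(\<lambda>n. \<integral>x. norm (Q n x - P x) \<partial>torus) \<longlonglongrightarrow> 0"
      "\<And>i. i \<in> I \<Longrightarrow> \<exists>R. (\<forall>n. R n \<in> X \<inter> C i) \<and> (\<lambda>n. \<integral>x. norm (R n x - P x) \<partial>torus) \<longlonglongrightarrow> 0"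
    thus thesis by (rule that)
  qed
  have nb: "\<bar>pm P x - pm P' x\<bar> \<le> norm (P x - P' x)" "\<bar>pu P x - pu P' x\<bar> \<le> norm (P x - P' x)"
     "norm (pD P x - pD P' x) \<le> norm (P x - P' x)" for P P' x
  proof -
    have n: "norm (fst a) \<le> norm a" "norm (snd a) \<le> norm a" for a :: "'x::real_normed_vector \<times> 'y::real_normed_vector"
      using norm_fst_le[of "fst a" "snd a"] norm_snd_le[of "snd a" "fst a"] by auto
    show "\<bar>pm P x - pm P' x\<bar> \<le> norm (P x - P' x)" using n(1)[of "P x - P' x"] by (simp add: pm_def)
    show "\<bar>pu P x - pu P' x\<bar> \<le> norm (P x - P' x)"
      using order_trans[OF n(1)[of "snd (P x - P' x)"] n(2)] by (simp add: pu_def)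
    show "norm (pD P x - pD P' x) \<le> norm (P x - P' x)"
      using order_trans[OF n(2)[of "snd (P x - P' x)"] n(2)] by (simp add: pD_def)
  qed
  define m u D where "m = pm L" and "u = pu L" and "D = pD L"
  have mi: "integrable torus m" and ui: "integrable torus u" and Di: "integrable torus (\<lambda>x. D x $ i)" for i
  proof -
    show "integrable torus m"
      unfolding m_def pm_def by (rule integrable_bounded_linear[OF bounded_linear_fst Li])
    have s: "integrable torus (\<lambda>x. snd (L x))" by (rule integrable_bounded_linear[OF bounded_linear_snd Li])
    show "integrable torus u"
      unfolding u_def pu_def by (rule integrable_bounded_linear[OF bounded_linear_fst s])
    show "integrable torus (\<lambda>x. D x $ i)" unfolding D_def pD_def
      by (rule integrable_bounded_linear[OF bounded_linear_vec_nth integrable_bounded_linear[OF bounded_linear_snd s]])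
  qed
  have L1: "(\<lambda>n. \<integral>x. \<bar>pm (R n) x - m x\<bar> \<partial>torus) \<longlonglongrightarrow> 0" "(\<lambda>n. \<integral>x. \<bar>pu (R n) x - u x\<bar> \<partial>torus) \<longlonglongrightarrow> 0"
    "(\<lambda>n. \<integral>x. \<bar>pD (R n) x $ i - D x $ i\<bar> \<partial>torus) \<longlonglongrightarrow> 0"
    if R: "\<And>n. R n \<in> X" "(\<lambda>n. \<integral>x. norm (R n x - L x) \<partial>torus) \<longlonglongrightarrow> 0" for R i
  proof -
    have gen: "(\<lambda>n. \<integral>x. \<bar>f n x\<bar> \<partial>torus) \<longlonglongrightarrow> 0"
      if f: "\<And>n. integrable torus (f n)" "\<And>n x. \<bar>f n x\<bar> \<le> norm (R n x - L x)" for f :: "nat \<Rightarrow> real^'n \<Rightarrow> real"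
    proof (rule tendsto_sandwich[OF _ _ tendsto_const R(2)])
      show "\<forall>\<^sub>F n in sequentially. (\<integral>x. \<bar>f n x\<bar> \<partial>torus) \<le> (\<integral>x. norm (R n x - L x) \<partial>torus)"
        using f XI[OF R(1)] Li by (intro always_eventually allI integral_mono) auto
    qed simp
    have iD: "integrable torus (\<lambda>x. pD (R n) x $ i)" for n
      using integrable_bounded_linear[OF bounded_linear_vec_nth ai(3)[OF R(1)]] .
    show "(\<lambda>n. \<integral>x. \<bar>pm (R n) x - m x\<bar> \<partial>torus) \<longlonglongrightarrow> 0"
      by (rule gen) (use ai(1)[OF R(1)] mi nb(1) in \<open>auto simp: m_def\<close>)
    show "(\<lambda>n. \<integral>x. \<bar>pu (R n) x - u x\<bar> \<partial>torus) \<longlonglongrightarrow> 0"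
      by (rule gen) (use ai(2)[OF R(1)] ui nb(2) in \<open>auto simp: u_def\<close>)
    show "(\<lambda>n. \<integral>x. \<bar>pD (R n) x $ i - D x $ i\<bar> \<partial>torus) \<longlonglongrightarrow> 0"
    proof (rule gen)
      show "integrable torus (\<lambda>x. pD (R n) x $ i - D x $ i)" for n using iD Di by auto
      show "\<bar>pD (R n) x $ i - D x $ i\<bar> \<le> norm (R n x - L x)" for n x
        using order_trans[OF component_le_norm_cart[of "pD (R n) x - pD L x" i] nb(3)[of "R n" x L]]
        by (simp add: D_def)
    qed
  qed
  have per: "periodic m" "periodic u" "periodic (\<lambda>x. D x $ i)" for i
  proof -
    have "Q n (x + axis j 1) = Q n x" for n x j
    proof -
      have "periodic (pm (Q n))" "C1_torus (pu (Q n)) (pD (Q n))" using Q[of n] by (auto simp: X_def admissible_def)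
      hence "pm (Q n) (x + axis j 1) = pm (Q n) x" "pu (Q n) (x + axis j 1) = pu (Q n) x"
        "pD (Q n) (x + axis j 1) = pD (Q n) x"
        using C1_torus_gradient_periodic[of "pu (Q n)" "pD (Q n)"] C1_torusD(1)[of "pu (Q n)" "pD (Q n)"]
        by (auto simp: periodic_def)
      thus ?thesis using P[of "Q n"] by metis
    qed
    hence "L (x + axis j 1) = L x" for x j by (simp add: L)
    thus "periodic m" "periodic u" "periodic (\<lambda>x. D x $ i)"
      by (simp_all add: periodic_def m_def u_def D_def pm_def pu_def pD_def)
  qed
  have conv: "AE x in torus. (\<lambda>n. pm (Q n) x) \<longlonglongrightarrow> m x" "AE x in torus. (\<lambda>n. pu (Q n) x) \<longlonglongrightarrow> u x"
    "AE x in torus. (\<lambda>n. pD (Q n) x $ i) \<longlonglongrightarrow> D x $ i" for i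
    using ae
    by (eventually_elim, simp add: pm_def pu_def pD_def m_def u_def D_def tendsto_intros)+
  have nonneg: "m \<in> nonneg_torus"
    unfolding nonneg_torus_def mem_Collect_eq using conv(1) AE_torus_cube
  proof eventually_elim
    case (elim x)
    have "pm (Q n) x \<ge> 0" for n using Q[of n] elim(2) by (auto simp: X_def admissible_def)
    thus ?case using elim(1) by (intro tendsto_lowerbound[of _ _ sequentially]) auto
  qed
  obtain K' where K': "K' \<ge> 0" "\<And>m u D. admissible K m u D \<Longrightarrow> (\<integral>x. \<bar>u x\<bar> powr \<alpha> \<partial>torus) \<le> K'"
    using admissible_powr_bound by blast
  have up: "integrable torus (\<lambda>x. \<bar>u x\<bar> powr \<alpha>)"
  proof (rule integrable_powr_limit[OF _ _ \<alpha> conv(2) ai(4)[OF Q]])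
    show "(\<integral>x. \<bar>pu (Q n) x\<bar> powr \<alpha> \<partial>torus) \<le> K'" for n using K'(2) Q[of n] by (auto simp: X_def)
  qed (use ai(2)[OF Q] ui in auto)
  have Dp: "integrable torus (\<lambda>x. \<bar>D x $ i\<bar> powr \<alpha>)" for i
  proof (rule integrable_powr_limit[OF _ _ \<alpha> conv(3)])
    fix n
    have le: "\<bar>pD (Q n) x $ i\<bar> powr \<alpha> \<le> norm (pD (Q n) x) powr \<alpha>" for x
      using component_le_norm_cart[of "pD (Q n) x" i] \<alpha> by (intro powr_mono2) auto
    have m: "integrable torus (\<lambda>x. pD (Q n) x $ i)"
      using integrable_bounded_linear[OF bounded_linear_vec_nth ai(3)[OF Q]] .
    thus [measurable]: "(\<lambda>x. pD (Q n) x $ i) \<in> borel_measurable torus" by auto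
    show i: "integrable torus (\<lambda>x. \<bar>pD (Q n) x $ i\<bar> powr \<alpha>)"
      by (rule Bochner_Integration.integrable_bound[OF ai(5)[OF Q[of n]]]) (use le in auto)
    have "(\<integral>x. \<bar>pD (Q n) x $ i\<bar> powr \<alpha> \<partial>torus) \<le> (\<integral>x. norm (pD (Q n) x) powr \<alpha> \<partial>torus)"
      by (rule integral_mono[OF i ai(5)[OF Q] le])
    also have "\<dots> \<le> K" using Q[of n] by (auto simp: X_def admissible_def)
    finally show "(\<integral>x. \<bar>pD (Q n) x $ i\<bar> powr \<alpha> \<partial>torus) \<le> K" .
  qed (use Di in auto)
  have wd: "is_weak_deriv [i] u (\<lambda>x. D x $ i)" for i
    unfolding is_weak_deriv_def
  proof
    fix \<psi> :: "real^'n \<Rightarrow> real" assume "\<psi> \<in> test_torus"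
    hence \<psi>: "C1_torus \<psi> (gradient \<psi>)" by (rule test_torus_C1)
    have e: "multi_deriv [i] \<psi> x = gradient \<psi> x $ i" for x by (simp add: multi_deriv_def gradient_def)
    have c: "continuous_on (cbox 0 1) (\<lambda>x. gradient \<psi> x $ i)" "continuous_on (cbox 0 1) \<psi>"
      by (intro continuous_intros C1_torusD[OF \<psi>])+
    have iD: "integrable torus (\<lambda>x. pD (Q n) x $ i)" for n
      using integrable_bounded_linear[OF bounded_linear_vec_nth ai(3)[OF Q]] .
    have l1: "(\<lambda>n. \<integral>x. gradient \<psi> x $ i * pu (Q n) x \<partial>torus) \<longlonglongrightarrow> (\<integral>x. gradient \<psi> x $ i * u x \<partial>torus)"
      by (rule tendsto_integral_mult_L1[OF c(1) ai(2)[OF Q] ui L1(2)[OF Q QL]])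
    have l2: "(\<lambda>n. \<integral>x. \<psi> x * pD (Q n) x $ i \<partial>torus) \<longlonglongrightarrow> (\<integral>x. \<psi> x * D x $ i \<partial>torus)"
      by (rule tendsto_integral_mult_L1[OF c(2) iD Di L1(3)[OF Q QL]])
    have "(\<integral>x. gradient \<psi> x $ i * pu (Q n) x \<partial>torus) = - (\<integral>x. \<psi> x * pD (Q n) x $ i \<partial>torus)" for n
      using integration_by_parts_torus[of "pu (Q n)" "pD (Q n)" \<psi> "gradient \<psi>" i] Q[of n] \<psi>
      by (simp add: X_def admissible_def mult.commute)
    hence "(\<lambda>n. \<integral>x. gradient \<psi> x $ i * pu (Q n) x \<partial>torus) \<longlonglongrightarrow> - (\<integral>x. \<psi> x * D x $ i \<partial>torus)"
      using tendsto_minus[OF l2] by simp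
    from LIMSEQ_unique[OF l1 this]
    have "(\<integral>x. gradient \<psi> x $ i * u x \<partial>torus) = - (\<integral>x. \<psi> x * D x $ i \<partial>torus)" .
    thus "(\<integral>x. u x * multi_deriv [i] \<psi> x \<partial>torus) = (-1) ^ length [i] * (\<integral>x. D x $ i * \<psi> x \<partial>torus)"
      by (simp add: e mult.commute)
  qed
  have "u \<in> Lp_torus \<alpha>" using per(2) ui up by (auto simp: Lp_torus_def)
  moreover have "(\<lambda>x. D x $ i) \<in> Lp_torus \<alpha>" for i using per(3) Di Dp by (auto simp: Lp_torus_def)
  moreover have "is_weak_deriv [] u u" by (simp add: is_weak_deriv_def multi_deriv_def)
  ultimately have sob: "u \<in> sobolev_torus 1 \<alpha>"
    unfolding sobolev_torus_def using wd by (auto simp: le_Suc_eq length_Suc_conv)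
  have minty: "minty t m u \<le> 0" if t: "classical t" for t
  proof (rule field_le_epsilon)
    fix \<epsilon> :: real assume "\<epsilon> > 0"
    hence "(t, \<epsilon>) \<in> I" using t by (simp add: I_def)
    then obtain R where R: "\<And>n. R n \<in> X" "\<And>n. minty t (pm (R n)) (pu (R n)) \<le> \<epsilon>"
      "(\<lambda>n. \<integral>x. norm (R n x - L x) \<partial>torus) \<longlonglongrightarrow> 0" using R by (force simp: C_def)
    have "(\<lambda>n. minty t (pm (R n)) (pu (R n))) \<longlonglongrightarrow> minty t m u"
      by (rule minty_tendsto[OF t ai(1,2)[OF R(1)] mi ui L1(1,2)[OF R(1,3)]])
    thus "minty t m u \<le> 0 + \<epsilon>" using R(2) by (intro tendsto_upperbound[of _ _ sequentially]) auto
  qed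
  have "m \<in> Lp_torus 1" "u \<in> Lp_torus 1" using per mi ui by (auto simp: Lp_torus_def)
  thus ?thesis using nonneg mi ui sob minty by blast
qed

end

section \<open>Trigonometric waves\<close>

definition lattice :: "(real^'n) set" where
  "lattice = {\<xi>. \<forall>i. \<xi> $ i \<in> \<int>}"

definition wave :: "real^'n \<Rightarrow> real \<Rightarrow> real^'n \<Rightarrow> real" where
  "wave \<xi> \<theta> x = cos (2 * pi * (\<xi> \<bullet> x) + \<theta>)"

lemma lattice_simps [simp, intro]:
  "0 \<in> lattice" "\<xi> \<in> lattice \<Longrightarrow> \<eta> \<in> lattice \<Longrightarrow> \<xi> + \<eta> \<in> lattice"
  "\<xi> \<in> lattice \<Longrightarrow> \<eta> \<in> lattice \<Longrightarrow> \<xi> - \<eta> \<in> lattice" "\<xi> \<in> lattice \<Longrightarrow> - \<xi> \<in> lattice"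
  "axis i 1 \<in> lattice"
  by (auto simp: lattice_def axis_def)

lemma abs_wave_le: "\<bar>wave \<xi> \<theta> x\<bar> \<le> 1" by (simp add: wave_def)

lemma wave_zero [simp]: "wave 0 \<theta> x = cos \<theta>" by (simp add: wave_def)

lemma wave_periodic: "\<xi> \<in> lattice \<Longrightarrow> periodic (wave \<xi> \<theta>)"
  unfolding periodic_def
proof (intro allI)
  fix i x assume "\<xi> \<in> lattice"
  then obtain k where k: "\<xi> $ i = of_int k" by (auto simp: lattice_def elim: Ints_cases)
  have "2 * pi * (\<xi> \<bullet> (x + axis i 1)) + \<theta> = (2 * pi * (\<xi> \<bullet> x) + \<theta>) + (2 * pi) * of_int k"
    by (simp add: inner_add_right inner_axis k algebra_simps)
  moreover have "cos (y + (2 * pi) * of_int k) = cos y" for y :: real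
    by (simp only: cos_add cos_int_2pin sin_int_2pin)
  ultimately show "wave \<xi> \<theta> (x + axis i 1) = wave \<xi> \<theta> x" by (simp only: wave_def)
qed

lemma continuous_on_wave [continuous_intros]: "continuous_on S (wave \<xi> \<theta>)"
  unfolding wave_def by (intro continuous_intros)

lemma wave_has_derivative:
  "(wave \<xi> \<theta> has_derivative (\<lambda>h. ((2 * pi * wave \<xi> (\<theta> + pi/2) x) *\<^sub>R \<xi>) \<bullet> h)) (at x)"
proof -
  have w: "wave \<xi> (\<theta> + pi/2) x = - sin (2 * pi * (\<xi> \<bullet> x) + \<theta>)"
    by (simp add: wave_def minus_sin_cos_eq add.assoc)
  have "((\<lambda>x. cos (2 * pi * (\<xi> \<bullet> x) + \<theta>)) has_derivative
      (\<lambda>h. - sin (2 * pi * (\<xi> \<bullet> x) + \<theta>) * (2 * pi * (\<xi> \<bullet> h)))) (at x)"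
    by (auto intro!: derivative_eq_intros)
  moreover have "(\<lambda>h. - sin (2 * pi * (\<xi> \<bullet> x) + \<theta>) * (2 * pi * (\<xi> \<bullet> h)))
      = (\<lambda>h. ((2 * pi * (- sin (2 * pi * (\<xi> \<bullet> x) + \<theta>))) *\<^sub>R \<xi>) \<bullet> h)"
    by (simp add: fun_eq_iff)
  ultimately show ?thesis unfolding w unfolding wave_def[abs_def] by simp
qed

lemma wave_C1: "\<xi> \<in> lattice \<Longrightarrow> C1_torus (wave \<xi> \<theta>) (\<lambda>x. (2 * pi * wave \<xi> (\<theta> + pi/2) x) *\<^sub>R \<xi>)"
  unfolding C1_torus_def by (intro conjI allI wave_periodic wave_has_derivative continuous_intros)

lemma partial_deriv_wave:
  "partial_deriv i (\<lambda>x. c * wave \<xi> \<theta> x) = (\<lambda>x. (c * (2 * pi * \<xi> $ i)) * wave \<xi> (\<theta> + pi/2) x)"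
proof
  fix x
  have "((\<lambda>x. c * wave \<xi> \<theta> x) has_derivative (\<lambda>h. (c *\<^sub>R ((2 * pi * wave \<xi> (\<theta> + pi/2) x) *\<^sub>R \<xi>)) \<bullet> h)) (at x)"
    by (auto intro!: derivative_eq_intros wave_has_derivative)
  from has_derivative_imp_partial_deriv[OF this, of i]
  show "partial_deriv i (\<lambda>x. c * wave \<xi> \<theta> x) x = (c * (2 * pi * \<xi> $ i)) * wave \<xi> (\<theta> + pi/2) x" by simp
qed

lemma multi_deriv_wave:
  "multi_deriv js (wave \<xi> \<theta>)
    = (\<lambda>x. (\<Prod>j\<leftarrow>js. 2 * pi * \<xi> $ j) * wave \<xi> (\<theta> + real (length js) * (pi/2)) x)"
proof (induction js)
  case Nil
  thus ?case by (simp add: multi_deriv_def)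
next
  case (Cons j js)
  have "multi_deriv (j # js) (wave \<xi> \<theta>) = partial_deriv j (multi_deriv js (wave \<xi> \<theta>))"
    by (simp add: multi_deriv_def)
  also have "\<dots> = (\<lambda>x. ((\<Prod>j\<leftarrow>js. 2 * pi * \<xi> $ j) * (2 * pi * \<xi> $ j)) * wave \<xi> (\<theta> + real (length js) * (pi/2) + pi/2) x)"
    unfolding Cons.IH by (rule partial_deriv_wave)
  also have "\<theta> + real (length js) * (pi/2) + pi/2 = \<theta> + real (length (j # js)) * (pi/2)"
    by (simp add: algebra_simps)
  finally show ?case by (simp add: mult.commute)
qed

lemma wave_test: "\<xi> \<in> lattice \<Longrightarrow> wave \<xi> \<theta> \<in> test_torus"
  by (auto simp: test_torus_def class_C_def multi_deriv_wave intro!: wave_periodic continuous_intros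
      differentiable_mult differentiableI[OF wave_has_derivative])

lemma wave_mult: "wave \<xi> \<theta> x * wave \<eta> \<tau> x = (wave (\<xi> + \<eta>) (\<theta> + \<tau>) x + wave (\<xi> - \<eta>) (\<theta> - \<tau>) x) / 2"
proof -
  have 1: "2 * pi * ((\<xi> + \<eta>) \<bullet> x) + (\<theta> + \<tau>) = (2 * pi * (\<xi> \<bullet> x) + \<theta>) + (2 * pi * (\<eta> \<bullet> x) + \<tau>)"
    and 2: "2 * pi * ((\<xi> - \<eta>) \<bullet> x) + (\<theta> - \<tau>) = (2 * pi * (\<xi> \<bullet> x) + \<theta>) - (2 * pi * (\<eta> \<bullet> x) + \<tau>)"
    by (simp_all add: inner_add_left inner_diff_left algebra_simps)
  show ?thesis unfolding wave_def 1 2 by (simp only: cos_add cos_diff) simp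
qed

lemma wave_shift_phase: "wave \<xi> (\<theta> + \<tau>) x = cos \<tau> * wave \<xi> \<theta> x - sin \<tau> * wave \<xi> (\<theta> - pi/2) x"
  by (simp add: wave_def cos_add cos_diff sin_add sin_diff algebra_simps)

text \<open>A translation by half a period changes the sign.\<close>

lemma integral_wave:
  assumes "\<xi> \<in> lattice"
  shows "(\<integral>x. wave \<xi> \<theta> x \<partial>torus) = (if \<xi> = 0 then cos \<theta> else 0)"
proof (cases "\<xi> = 0")
  case False
  then obtain i where i: "\<xi> $ i \<noteq> 0" by (auto simp: vec_eq_iff)
  have "wave \<xi> \<theta> (x + axis i (1 / (2 * \<xi> $ i))) = - wave \<xi> \<theta> x" for x
  proof -
    have "2 * pi * (\<xi> \<bullet> (x + axis i (1 / (2 * \<xi> $ i)))) + \<theta> = (2 * pi * (\<xi> \<bullet> x) + \<theta>) + pi"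
      using i by (simp add: inner_add_right inner_axis field_simps)
    thus ?thesis unfolding wave_def by (simp only: cos_periodic_pi)
  qed
  hence "(\<integral>x. wave \<xi> \<theta> x \<partial>torus) = (\<integral>x. - wave \<xi> \<theta> x \<partial>torus)"
    using integral_torus_translate[OF continuous_on_wave wave_periodic[OF assms], of \<theta> "axis i (1 / (2 * \<xi> $ i))"] by simp
  thus ?thesis using False by simp
qed simp

section \<open>Uniqueness of Fourier coefficients\<close>

text \<open>The continuous functions \<open>q\<close> for which all Fourier coefficients of \<open>q f\<close> vanish are closed under
  multiplication by waves, because a product of two waves is a mean of two waves. If all
  Fourier coefficients of \<open>f\<close> vanish, they contain the constants, hence all polynomials in the functions
  \<open>cos (2 \<pi> (x i - c i))\<close>, and indicator functions of boxes are bounded pointwise limits of such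
  polynomials.\<close>

definition wave_null :: "(real^'n \<Rightarrow> real) \<Rightarrow> (real^'n \<Rightarrow> real) \<Rightarrow> bool" where
  "wave_null f q \<longleftrightarrow> continuous_on UNIV q \<and> (\<forall>\<xi>\<in>lattice. \<forall>\<theta>. (\<integral>x. (wave \<xi> \<theta> x * q x) * f x \<partial>torus) = 0)"

context
  fixes f :: "real^'n \<Rightarrow> real"
  assumes f: "integrable torus f"
begin

lemma wave_null_integrable:
  "continuous_on UNIV q \<Longrightarrow> integrable torus (\<lambda>x. (wave \<xi> \<theta> x * q x) * f x)"
  by (intro integrable_torus_mult_continuous f continuous_intros) (auto intro: continuous_on_subset)

lemma wave_null_add:
  assumes "wave_null f q" "wave_null f r"
  shows "wave_null f (\<lambda>x. q x + r x)"
  using assms wave_null_integrable[of q] wave_null_integrable[of r] unfolding wave_null_def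
  by (auto intro!: continuous_intros simp: distrib_left distrib_right)

lemma wave_null_scale:
  assumes "wave_null f q"
  shows "wave_null f (\<lambda>x. c * q x)"
  using assms unfolding wave_null_def
  by (auto intro!: continuous_intros simp: mult.left_commute[of _ c] mult.assoc)

lemma wave_null_sum:
  assumes "finite I" "\<And>i. i \<in> I \<Longrightarrow> wave_null f (q i)"
  shows "wave_null f (\<lambda>x. \<Sum>i\<in>I. q i x)"
  using assms
proof (induction I rule: finite_induct)
  case (insert i I)
  from wave_null_add[of "q i" "\<lambda>x. \<Sum>i\<in>I. q i x"] insert show ?case by simp
qed (simp add: wave_null_def)

lemma wave_null_wave:
  assumes q: "wave_null f q" and \<eta>: "\<eta> \<in> lattice"
  shows "wave_null f (\<lambda>x. wave \<eta> \<tau> x * q x)"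
  unfolding wave_null_def
proof (intro conjI ballI allI)
  show "continuous_on UNIV (\<lambda>x. wave \<eta> \<tau> x * q x)"
    using q by (auto simp: wave_null_def intro!: continuous_intros)
  fix \<xi> \<theta> assume \<xi>: "\<xi> \<in> (lattice :: (real^'n) set)"
  have "wave \<xi> \<theta> x * (wave \<eta> \<tau> x * q x) * f x
     = ((wave (\<xi> + \<eta>) (\<theta> + \<tau>) x * q x) * f x + (wave (\<xi> - \<eta>) (\<theta> - \<tau>) x * q x) * f x) / 2" for x
    unfolding mult.assoc[symmetric] wave_mult by (simp add: algebra_simps)
  hence "(\<integral>x. wave \<xi> \<theta> x * (wave \<eta> \<tau> x * q x) * f x \<partial>torus)
    = (\<integral>x. ((wave (\<xi> + \<eta>) (\<theta> + \<tau>) x * q x) * f x + (wave (\<xi> - \<eta>) (\<theta> - \<tau>) x * q x) * f x) / 2 \<partial>torus)"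
    by (simp only:)
  also have "\<dots> = 0"
    using q \<xi> \<eta> wave_null_integrable[of q] by (simp add: wave_null_def)
  finally show "(\<integral>x. wave \<xi> \<theta> x * (wave \<eta> \<tau> x * q x) * f x \<partial>torus) = 0" .
qed

lemma wave_null_power:
  fixes c :: "real^'n" and i :: 'n
  defines "t \<equiv> \<lambda>x. (1 + wave (axis i 1) (- (2 * pi * c $ i)) x) / 2"
  assumes q: "wave_null f q"
  shows "wave_null f (\<lambda>x. t x ^ k * (1 - t x) ^ l * q x)"
proof -
  have 1: "wave_null f (\<lambda>x. t x * r x)" "wave_null f (\<lambda>x. (1 - t x) * r x)" if r: "wave_null f r" for r
  proof -
    note w = wave_null_wave[OF r, of "axis i 1" "- (2 * pi * c $ i)"]
    have "wave_null f (\<lambda>x. (1/2) * r x + (1/2) * (wave (axis i 1) (- (2 * pi * c $ i)) x * r x))"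
      by (intro wave_null_add wave_null_scale r w) auto
    moreover have "wave_null f (\<lambda>x. (1/2) * r x + (-1/2) * (wave (axis i 1) (- (2 * pi * c $ i)) x * r x))"
      by (intro wave_null_add wave_null_scale r w) auto
    ultimately show "wave_null f (\<lambda>x. t x * r x)" "wave_null f (\<lambda>x. (1 - t x) * r x)"
      by (simp_all add: t_def field_simps)
  qed
  have 2: "wave_null f (\<lambda>x. (1 - t x) ^ l * q x)"
  proof (induction l)
    case (Suc l)
    from 1(2)[OF this] show ?case by (simp add: mult.assoc)
  qed (use q in simp)
  show ?thesis
  proof (induction k)
    case (Suc k)
    from 1(1)[OF this] show ?case by (simp add: mult.assoc)
  qed (use 2 in simp)
qed

end

text \<open>Bernstein polynomials approximating steeper and steeper ramps.\<close>

lemma step_approximation: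
  fixes \<kappa> :: real
  obtains a :: "nat \<Rightarrow> nat \<Rightarrow> real" and n :: "nat \<Rightarrow> nat" where
    "\<And>N t. t \<in> {0..1} \<Longrightarrow> \<bar>\<Sum>k\<le>n N. a N k * Bernstein (n N) k t\<bar> \<le> 2"
    "\<And>t. t \<in> {0..1} \<Longrightarrow> (\<lambda>N. \<Sum>k\<le>n N. a N k * Bernstein (n N) k t) \<longlonglongrightarrow> (if t > \<kappa> then 1 else 0)"
proof -
  define \<psi> where "\<psi> = (\<lambda>(N::nat) (t::real). min 1 (max 0 (real N * (t - \<kappa>))))"
  have "\<exists>n. \<forall>t\<in>{0..1}. \<bar>\<psi> N t - (\<Sum>k\<le>n. \<psi> N (real k / real n) * Bernstein n k t)\<bar> < 1 / real (Suc N)" for N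
  proof -
    have "continuous_on {0..1} (\<psi> N)" unfolding \<psi>_def by (intro continuous_intros)
    from Bernstein_Weierstrass[OF this, of "1 / real (Suc N)"] obtain n where
      "\<forall>m t. n \<le> m \<and> t \<in> {0..1} \<longrightarrow> \<bar>\<psi> N t - (\<Sum>k\<le>m. \<psi> N (real k / real m) * Bernstein m k t)\<bar> < 1 / real (Suc N)"
      by auto
    thus ?thesis by blast
  qed
  then obtain n where n: "\<And>N t. t \<in> {0..1} \<Longrightarrow>
      \<bar>\<psi> N t - (\<Sum>k\<le>n N. \<psi> N (real k / real (n N)) * Bernstein (n N) k t)\<bar> < 1 / real (Suc N)" by metis
  define B where "B = (\<lambda>N t. \<Sum>k\<le>n N. \<psi> N (real k / real (n N)) * Bernstein (n N) k t)"
  have nB: "\<bar>\<psi> N t - B N t\<bar> < 1 / real (Suc N)" if "t \<in> {0..1}" for N t using n[OF that] by (simp add: B_def)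
  have "\<bar>B N t\<bar> \<le> 2" if "t \<in> {0..1}" for N t
  proof -
    have "1 / real (Suc N) \<le> 1" by simp
    moreover have "0 \<le> \<psi> N t" "\<psi> N t \<le> 1" by (auto simp: \<psi>_def)
    ultimately show ?thesis using nB[OF that, of N] by linarith
  qed
  moreover have "(\<lambda>N. B N t) \<longlonglongrightarrow> (if t > \<kappa> then 1 else 0)" if t: "t \<in> {0..1}" for t
  proof -
    have "\<forall>\<^sub>F N in sequentially. \<psi> N t = (if t > \<kappa> then 1 else 0)"
    proof (cases "t > \<kappa>")
      case True
      obtain N0 where N0: "1 / (t - \<kappa>) \<le> real N0" using real_arch_simple by blast
      have "\<psi> N t = 1" if "N \<ge> N0" for N
      proof -
        have "1 / (t - \<kappa>) \<le> real N" using N0 that by linarith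
        hence "1 \<le> real N * (t - \<kappa>)" using True by (simp add: field_simps)
        thus ?thesis by (simp add: \<psi>_def)
      qed
      thus ?thesis using True by (auto simp: eventually_sequentially)
    next
      case False
      hence "\<psi> N t = 0" for N by (simp add: \<psi>_def mult_nonneg_nonpos)
      thus ?thesis using False by simp
    qed
    hence 1: "(\<lambda>N. \<psi> N t) \<longlonglongrightarrow> (if t > \<kappa> then 1 else 0)" by (rule tendsto_eventually)
    have "(\<lambda>N. B N t - \<psi> N t) \<longlonglongrightarrow> 0"
      by (rule Lim_null_comparison[OF _ LIMSEQ_Suc[OF lim_1_over_n]])
        (use nB[OF t] in \<open>auto simp: abs_minus_commute intro!: always_eventually less_imp_le\<close>)
    from tendsto_add[OF this 1] show ?thesis by simp
  qed
  ultimately show ?thesis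
    by (intro that[of "\<lambda>N k. \<psi> N (real k / real (n N))" n]) (auto simp: B_def)
qed

text \<open>Near the centre of the interval \<open>(0, \<beta>)\<close> the cosine is larger than at its ends, and the
  translates of this interval by a period miss the unit interval.\<close>

lemma cos_interval:
  assumes x: "0 \<le> x" "x \<le> 1" and \<beta>: "0 \<le> \<beta>" "\<beta> \<le> 1"
  shows "cos (2 * pi * (x - \<beta> / 2)) > cos (pi * \<beta>) \<longleftrightarrow> 0 < x \<and> x < \<beta>"
proof -
  define d where "d = \<bar>x - \<beta> / 2\<bar>"
  have c: "cos (2 * pi * (x - \<beta> / 2)) = cos (2 * pi * d)"
    by (auto simp: d_def abs_if) (metis cos_minus minus_diff_eq mult_minus_right)
  have dlt: "d < \<beta> / 2 \<longleftrightarrow> 0 < x \<and> x < \<beta>" by (auto simp: d_def abs_if)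
  have d1: "0 \<le> d" "d \<le> 1 - \<beta> / 2" using x \<beta> by (auto simp: d_def abs_if)
  have p: "2 * pi * y = pi * (2 * y)" for y by simp
  have "cos (2 * pi * d) > cos (pi * \<beta>)" if "d < \<beta> / 2"
  proof (rule cos_monotone_0_pi)
    show "2 * pi * d < pi * \<beta>" unfolding p using that by (intro mult_strict_left_mono) auto
    show "pi * \<beta> \<le> pi" using mult_left_mono[of \<beta> 1 pi] \<beta> by simp
  qed (use d1 in simp)
  moreover have "cos (2 * pi * d) \<le> cos (pi * \<beta>)" if "\<beta> / 2 \<le> d"
  proof (cases "d \<le> 1/2")
    case True
    show ?thesis
    proof (rule cos_monotone_0_pi_le)
      show "pi * \<beta> \<le> 2 * pi * d" unfolding p using that by (intro mult_left_mono) auto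
      show "2 * pi * d \<le> pi" using mult_left_mono[of "2 * d" 1 pi] True by simp
    qed (use \<beta> in simp)
  next
    case False
    have "2 * pi * (1 - d) = 2 * pi - 2 * pi * d" by (simp add: algebra_simps)
    hence "cos (2 * pi * d) = cos (2 * pi * (1 - d))" by (simp only: cos_diff) simp
    also have "\<dots> \<le> cos (pi * \<beta>)"
    proof (rule cos_monotone_0_pi_le)
      show "pi * \<beta> \<le> 2 * pi * (1 - d)" unfolding p using d1 by (intro mult_left_mono) auto
      show "2 * pi * (1 - d) \<le> pi" using mult_left_mono[of "2 * (1 - d)" 1 pi] False by simp
    qed (use \<beta> in simp)
    finally show ?thesis .
  qed
  ultimately show ?thesis unfolding c dlt[symmetric] by force
qed

lemma AE_torus_not_coordinate: "AE x::real^'n in torus. x $ i \<noteq> c"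
proof -
  have "negligible {x::real^'n. axis i 1 \<bullet> x = c}"
    by (rule negligible_hyperplane) simp
  hence "{x::real^'n. x $ i = c} \<in> null_sets lebesgue"
    by (simp add: inner_axis' negligible_iff_null_sets)
  hence "AE x::real^'n in lebesgue. x $ i \<noteq> c" using AE_not_in by force
  thus ?thesis unfolding torus_def by (subst AE_restrict_space_iff) auto
qed

lemma borel_measurable_torus_indicator:
  assumes "A \<in> sets borel"
  shows "(indicator A :: real^'n \<Rightarrow> real) \<in> borel_measurable torus"
proof -
  have "(indicator A :: real^'n \<Rightarrow> real) \<in> borel_measurable lborel"
    using assms by (intro borel_measurable_indicator) simp
  thus ?thesis unfolding torus_def by (intro measurable_restrict_space1 measurable_completion)
qed

lemma integrable_torus_mult_indicator:
  fixes f :: "real^'n \<Rightarrow> real"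
  assumes f: "integrable torus f" and A: "A \<in> sets borel"
  shows "integrable torus (\<lambda>x. f x * indicator A x)"
proof (rule Bochner_Integration.integrable_bound[OF f])
  have [measurable]: "f \<in> borel_measurable torus" using f by auto
  note [measurable] = borel_measurable_torus_indicator[OF A]
  show "(\<lambda>x. f x * indicator A x) \<in> borel_measurable torus" by measurable
qed (auto simp: indicator_def)

text \<open>Inside the unit cube an orthant is a box with one corner at the origin, up to a null set, and a
  box is described by lower bounds for cosines centred at its midpoint.\<close>

lemma integral_orthant_eq_0:
  fixes f :: "real^'n \<Rightarrow> real"
  assumes f: "integrable torus f"
    and orth: "\<And>\<xi> \<theta>. \<xi> \<in> lattice \<Longrightarrow> (\<integral>x. wave \<xi> \<theta> x * f x \<partial>torus) = 0"
  shows "(\<integral>x. f x * indicator {..b} x \<partial>torus) = 0"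
proof (cases "\<exists>i. b $ i < 0")
  case True
  then obtain i where i: "b $ i < 0" by blast
  have "(\<integral>x. f x * indicator {..b} x \<partial>torus) = (\<integral>x. 0 \<partial>(torus :: (real^'n) measure))"
  proof (rule Bochner_Integration.integral_cong[OF refl])
    fix x :: "real^'n" assume "x \<in> space torus"
    hence "0 \<le> x $ i" by (simp add: mem_box_cart)
    hence "\<not> x \<le> b" using i by (auto simp: less_eq_vec_def not_le intro!: exI[of _ i])
    thus "f x * indicator {..b} x = 0" by simp
  qed
  thus ?thesis by simp
next
  case False
  define \<beta> where "\<beta> = (\<lambda>i. min (b $ i) 1)"
  have \<beta>: "0 \<le> \<beta> i" "\<beta> i \<le> 1" for i using False by (auto simp: \<beta>_def not_less)
  define t where "t = (\<lambda>i (x::real^'n). (1 + wave (axis i 1) (- (2 * pi * (\<chi> i. \<beta> i / 2) $ i)) x) / 2)"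
  have t: "t i x = (1 + cos (2 * pi * (x $ i - \<beta> i / 2))) / 2" for i x
    by (simp add: t_def wave_def inner_axis' algebra_simps)
  have t01: "t i x \<in> {0..1}" for i x
  proof -
    have "(1 + cos y) / 2 \<in> {0..1}" for y :: real
    proof -
      have "0 \<le> 1 + cos y" using cos_ge_minus_one[of y] by linarith
      thus ?thesis by simp
    qed
    thus ?thesis unfolding t .
  qed
  define \<kappa> where "\<kappa> = (\<lambda>i. (1 + cos (pi * \<beta> i)) / 2)"
  define G where "G = (\<lambda>i (a :: nat \<Rightarrow> nat \<Rightarrow> real) (n :: nat \<Rightarrow> nat).
      (\<forall>N t. t \<in> {0..1} \<longrightarrow> \<bar>\<Sum>k\<le>n N. a N k * Bernstein (n N) k t\<bar> \<le> 2) \<and>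
      (\<forall>t. t \<in> {0..1} \<longrightarrow> (\<lambda>N. \<Sum>k\<le>n N. a N k * Bernstein (n N) k t) \<longlonglongrightarrow> (if t > \<kappa> i then 1 else 0)))"
  have "\<exists>a n. G i a n" for i
    unfolding G_def by (rule step_approximation[of "\<kappa> i"]) blast
  then obtain a n where "\<And>i. G i (a i) (n i)" by metis
  hence an: "\<And>i N t. t \<in> {0..1} \<Longrightarrow> \<bar>\<Sum>k\<le>n i N. a i N k * Bernstein (n i N) k t\<bar> \<le> 2"
      "\<And>i t. t \<in> {0..1} \<Longrightarrow> (\<lambda>N. \<Sum>k\<le>n i N. a i N k * Bernstein (n i N) k t) \<longlonglongrightarrow> (if t > \<kappa> i then 1 else 0)"
    unfolding G_def by blast+
  define p where "p = (\<lambda>i N x. \<Sum>k\<le>n i N. a i N k * Bernstein (n i N) k (t i x))"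
  define q where "q = (\<lambda>N x. \<Prod>i\<in>UNIV. p i N x)"
  have null1: "wave_null f (\<lambda>x. 1)" using orth by (auto simp: wave_null_def)
  have step: "wave_null f (\<lambda>x. p i N x * r x)" if r: "wave_null f r" for i N r
  proof -
    have "wave_null f (\<lambda>x. \<Sum>k\<le>n i N. (a i N k * real (n i N choose k)) * (t i x ^ k * (1 - t i x) ^ (n i N - k) * r x))"
      unfolding t_def by (intro wave_null_sum f wave_null_scale wave_null_power r) auto
    moreover have "(\<Sum>k\<le>n i N. (a i N k * real (n i N choose k)) * (t i x ^ k * (1 - t i x) ^ (n i N - k) * r x))
       = p i N x * r x" for x
      by (simp add: p_def Bernstein_def sum_distrib_right mult.assoc)
    ultimately show ?thesis by simp
  qed
  have "wave_null f (\<lambda>x. \<Prod>i\<in>J. p i N x)" if "finite J" for J N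
    using that by (induction J rule: finite_induct) (use null1 step in auto)
  hence qn: "wave_null f (q N)" for N by (simp add: q_def)
  hence q0: "(\<integral>x. q N x * f x \<partial>torus) = 0" for N
    using lattice_simps(1) unfolding wave_null_def by (metis (no_types, lifting) wave_zero cos_zero mult_1 Bochner_Integration.integral_cong)
  define c where "c = (\<lambda>x. \<Prod>i\<in>UNIV. if t i x > \<kappa> i then 1 else (0::real))"
  have fm [measurable]: "f \<in> borel_measurable torus" using f by auto
  have qm [measurable]: "q N \<in> borel_measurable torus" for N
  proof -
    have "continuous_on (cbox 0 1) (q N)" using qn[of N] continuous_on_subset unfolding wave_null_def by blast
    thus ?thesis using integrable_torus_continuous[of "q N"] by auto
  qed
  have qc: "(\<lambda>N. q N x) \<longlonglongrightarrow> c x" for x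
    unfolding q_def c_def p_def by (intro tendsto_prod an(2) t01)
  have cm [measurable]: "c \<in> borel_measurable torus"
    by (rule borel_measurable_LIMSEQ_real[OF qc qm])
  have "(\<lambda>N. \<integral>x. q N x * f x \<partial>torus) \<longlonglongrightarrow> (\<integral>x. c x * f x \<partial>torus)"
  proof (rule integral_dominated_convergence[where w = "\<lambda>x. 2 ^ CARD('n) * \<bar>f x\<bar>"])
    show "integrable torus (\<lambda>x. 2 ^ CARD('n) * \<bar>f x\<bar>)" using f by auto
    show "AE x in torus. (\<lambda>N. q N x * f x) \<longlonglongrightarrow> c x * f x" by (intro AE_I2 tendsto_intros qc)
    show "AE x in torus. norm (q N x * f x) \<le> 2 ^ CARD('n) * \<bar>f x\<bar>" for N
    proof (rule AE_I2)
      fix x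
      have "\<bar>q N x\<bar> = (\<Prod>i\<in>UNIV. \<bar>p i N x\<bar>)" by (simp add: q_def abs_prod)
      also have "\<dots> \<le> (\<Prod>i\<in>(UNIV::'n set). 2)"
        unfolding p_def by (intro prod_mono conjI an(1) t01) auto
      finally show "norm (q N x * f x) \<le> 2 ^ CARD('n) * \<bar>f x\<bar>" by (simp add: abs_mult mult_right_mono)
    qed
  qed auto
  hence c0: "(\<integral>x. c x * f x \<partial>torus) = 0" using q0 LIMSEQ_unique[OF _ tendsto_const] by simp
  have ae: "AE x in torus. \<forall>i. x $ i \<noteq> 0 \<and> x $ i \<noteq> \<beta> i"
    using AE_torus_not_coordinate by (subst AE_all_countable) auto
  have "AE x in torus. f x * indicator {..b} x = c x * f x"
    using ae AE_torus_cube
  proof eventually_elim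
    case (elim x)
    have x: "0 \<le> x $ i" "x $ i \<le> 1" for i using elim(2) by (auto simp: mem_box_cart)
    have "t i x > \<kappa> i \<longleftrightarrow> x $ i \<le> b $ i" for i
    proof -
      have "t i x > \<kappa> i \<longleftrightarrow> cos (2 * pi * (x $ i - \<beta> i / 2)) > cos (pi * \<beta> i)" by (simp add: t \<kappa>_def)
      also have "\<dots> \<longleftrightarrow> 0 < x $ i \<and> x $ i < \<beta> i" by (rule cos_interval[OF x \<beta>])
      also have "\<dots> \<longleftrightarrow> x $ i \<le> b $ i" using x[of i] elim(1)[rule_format, of i] by (auto simp: \<beta>_def min_def split: if_splits)
      finally show ?thesis .
    qed
    hence "c x = (\<Prod>i\<in>UNIV. if x $ i \<le> b $ i then 1 else (0::real))" by (simp add: c_def)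
    also have "\<dots> = indicator {..b} x"
      by (auto simp: indicator_def less_eq_vec_def)
    finally show ?case by simp
  qed
  hence "(\<integral>x. f x * indicator {..b} x \<partial>torus) = (\<integral>x. c x * f x \<partial>torus)"
    by (intro integral_cong_AE borel_measurable_times fm cm borel_measurable_torus_indicator) auto
  thus ?thesis using c0 by simp
qed

text \<open>The Borel sets over which the integral of \<open>f\<close> vanishes form a Dynkin system that contains the
  orthants, hence all Borel sets, in particular the set where \<open>f\<close> is positive up to a null set.\<close>

lemma AE_nonpos_if_orthogonal_waves:
  fixes f :: "real^'n \<Rightarrow> real"
  assumes f: "integrable torus f"
    and orth: "\<And>\<xi> \<theta>. \<xi> \<in> lattice \<Longrightarrow> (\<integral>x. wave \<xi> \<theta> x * f x \<partial>torus) = 0"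
  shows "AE x in torus. f x \<le> 0"
proof -
  note ii = integrable_torus_mult_indicator[OF f]
  have borel0: "(\<integral>x. f x * indicator A x \<partial>torus) = 0" if A: "A \<in> sets borel" for A
  proof -
    have gen: "sets borel = sigma_sets UNIV (range (\<lambda>a::real^'n. {..a}))"
      by (subst borel_eq_atMost) (simp add: sets_measure_of)
    have A': "A \<in> sigma_sets UNIV (range (\<lambda>a::real^'n. {..a}))" using A by (simp add: gen)
    have stable: "Int_stable (range (\<lambda>a::real^'n. {..a}))"
    proof (rule Int_stableI_image)
      fix a b :: "real^'n"
      show "\<exists>c\<in>UNIV. {..a} \<inter> {..b} = {..c}" by (intro bexI[of _ "inf a b"]) auto
    qed
    show ?thesis
      using stable subset_UNIV[of "range (\<lambda>a::real^'n. {..a})", folded Pow_UNIV] A'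
    proof (induction rule: sigma_sets_induct_disjoint[where \<Omega> = UNIV])
      case (basic A)
      then obtain b where "A = {..b}" by blast
      thus ?case using integral_orthant_eq_0[OF f orth] by simp
    next
      case (compl A)
      hence A: "A \<in> sets borel" by (simp add: gen)
      have "f x * indicator (UNIV - A) x = f x - f x * indicator A x" for x by (auto simp: indicator_def)
      hence "(\<integral>x. f x * indicator (UNIV - A) x \<partial>torus) = (\<integral>x. f x \<partial>torus) - (\<integral>x. f x * indicator A x \<partial>torus)"
        using f ii[OF A] by simp
      also have "(\<integral>x. f x \<partial>torus) = 0" using orth[of 0 0] by simp
      finally show ?case using compl by simp
    next
      case (union A)
      have A: "A i \<in> sets borel" for i using union by (auto simp: gen)
      have sums: "(\<lambda>i. indicator (A i) x :: real) sums indicator (\<Union>i. A i) x" for x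
        using indicator_sums[of A x] union(1) by (auto simp: disjoint_family_on_def)
      have part: "(\<integral>x. f x * (\<Sum>i<n. indicator (A i) x) \<partial>torus) = 0" for n
        unfolding sum_distrib_left
        by (subst Bochner_Integration.integral_sum) (use union(3) ii[OF A] in auto)
      have m [measurable]: "f \<in> borel_measurable torus" using f by auto
      note im [measurable] = borel_measurable_torus_indicator[OF A]
      have "(\<lambda>n. \<integral>x. f x * (\<Sum>i<n. indicator (A i) x) \<partial>torus) \<longlonglongrightarrow> (\<integral>x. f x * indicator (\<Union>i. A i) x \<partial>torus)"
      proof (rule integral_dominated_convergence[where w = "\<lambda>x. \<bar>f x\<bar>"])
        have "(\<Union>i. A i) \<in> sets borel" using A by blast
        from borel_measurable_torus_indicator[OF this]
        show "(\<lambda>x. f x * indicator (\<Union>i. A i) x) \<in> borel_measurable torus" by (intro borel_measurable_times m)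
        show "AE x in torus. (\<lambda>n. f x * (\<Sum>i<n. indicator (A i) x)) \<longlonglongrightarrow> f x * indicator (\<Union>i. A i) x"
          using sums by (intro AE_I2 tendsto_intros) (simp add: sums_def)
        show "AE x in torus. norm (f x * (\<Sum>i<n. indicator (A i) x)) \<le> \<bar>f x\<bar>" for n
        proof (rule AE_I2)
          fix x
          have "(\<Sum>i<n. indicator (A i) x :: real) \<le> indicator (\<Union>i. A i) x"
            unfolding sums_unique[OF sums] by (rule sum_le_suminf[OF sums_summable[OF sums]]) auto
          also have "\<dots> \<le> 1" by (auto simp: indicator_def)
          finally have "\<bar>\<Sum>i<n. indicator (A i) x :: real\<bar> \<le> 1"
            by (simp add: sum_nonneg)
          thus "norm (f x * (\<Sum>i<n. indicator (A i) x)) \<le> \<bar>f x\<bar>"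
            by (simp add: abs_mult mult_left_le)
        qed
        show "integrable torus (\<lambda>x. \<bar>f x\<bar>)" using f by auto
      qed measurable
      thus ?case unfolding part by (simp add: LIMSEQ_const_iff)
    qed simp
  qed
  have fm [measurable]: "f \<in> borel_measurable torus" using f by auto
  define S where "S = {x \<in> cbox 0 1. f x > 0}"
  have "S \<in> sets torus"
    using borel_measurable_less[of "\<lambda>x. 0" torus f] fm by (simp add: S_def)
  hence "S \<in> sets lebesgue" unfolding torus_def by (simp add: sets_restrict_space_iff)
  then obtain B N N' where B: "S = B \<union> N" "N \<subseteq> N'" "N' \<in> null_sets lborel" "B \<in> sets lborel"
    by (rule sets_completionE)
  have "AE x in lborel. x \<notin> N'" using B(3) by (rule AE_not_in)
  hence "AE x in lebesgue. x \<notin> N'" by (rule AE_completion)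
  hence N': "AE x in torus. x \<notin> N'" unfolding torus_def by (subst AE_restrict_space_iff) auto
  have Bb: "B \<in> sets borel" using B(4) by simp
  have Bi: "integrable torus (\<lambda>x. f x * indicator B x)" by (rule ii[OF Bb])
  have nn: "AE x in torus. 0 \<le> f x * indicator B x"
  proof (rule AE_I2)
    fix x
    have "f x > 0" if "x \<in> B" using B(1) that by (auto simp: S_def)
    thus "0 \<le> f x * indicator B x" by (auto simp: indicator_def)
  qed
  have "AE x in torus. f x * indicator B x = 0"
    using integral_nonneg_eq_0_iff_AE[OF Bi nn] borel0[OF Bb] by simp
  thus ?thesis using N' AE_torus_cube
  proof eventually_elim
    case (elim x)
    show ?case
    proof (rule ccontr)
      assume "\<not> f x \<le> 0"
      hence "x \<in> S" using elim by (simp add: S_def)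
      hence "x \<in> B" using B elim by auto
      thus False using elim \<open>\<not> f x \<le> 0\<close> by simp
    qed
  qed
qed

theorem AE_zero_if_orthogonal_waves:
  fixes f :: "real^'n \<Rightarrow> real"
  assumes f: "integrable torus f"
    and orth: "\<And>\<xi> \<theta>. \<xi> \<in> lattice \<Longrightarrow> (\<integral>x. wave \<xi> \<theta> x * f x \<partial>torus) = 0"
  shows "AE x in torus. f x = 0"
proof -
  have "AE x in torus. - f x \<le> 0" "AE x in torus. f x \<le> 0"
    by (rule AE_nonpos_if_orthogonal_waves; use f orth in auto)+
  thus ?thesis by eventually_elim auto
qed

section \<open>Fourier series of Sobolev functions\<close>

definition fourier :: "(real^'n \<Rightarrow> real) \<Rightarrow> real^'n \<Rightarrow> real \<Rightarrow> real" where
  "fourier f \<xi> \<theta> = (\<integral>x. wave \<xi> \<theta> x * f x \<partial>torus)"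

definition lattice_box :: "nat \<Rightarrow> (real^'n) set" where
  "lattice_box N = {\<xi> \<in> lattice. \<forall>i. \<bar>\<xi> $ i\<bar> \<le> real N}"

text \<open>The phases \<open>0\<close> and \<open>- \<pi> / 2\<close> give the cosine and the sine.\<close>

definition fourier_sum :: "(real^'n \<Rightarrow> real) \<Rightarrow> nat \<Rightarrow> real^'n \<Rightarrow> real" where
  "fourier_sum f N x = (\<Sum>\<xi>\<in>lattice_box N. fourier f \<xi> 0 * wave \<xi> 0 x + fourier f \<xi> (- (pi/2)) * wave \<xi> (- (pi/2)) x)"

lemma lattice_box_eq_image:
  "lattice_box N = vec_lambda ` (UNIV \<rightarrow>\<^sub>E real_of_int ` {- int N..int N} :: ('n::finite \<Rightarrow> real) set)"
proof (intro equalityI subsetI)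
  fix \<xi> :: "real^'n" assume \<xi>: "\<xi> \<in> lattice_box N"
  have "\<xi> $ i \<in> real_of_int ` {- int N..int N}" for i
  proof -
    have "\<xi> $ i \<in> \<int>" using \<xi> by (simp add: lattice_box_def lattice_def)
    then obtain k where k: "\<xi> $ i = of_int k" by (rule Ints_cases)
    have "\<bar>\<xi> $ i\<bar> \<le> real N" using \<xi> by (simp add: lattice_box_def)
    hence "\<bar>of_int k\<bar> \<le> real N" unfolding k .
    hence "k \<in> {- int N..int N}" by simp linarith
    thus ?thesis using k by auto
  qed
  hence "vec_nth \<xi> \<in> (UNIV \<rightarrow>\<^sub>E real_of_int ` {- int N..int N})" by auto
  thus "\<xi> \<in> vec_lambda ` (UNIV \<rightarrow>\<^sub>E real_of_int ` {- int N..int N})"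
    by (intro image_eqI[of _ _ "vec_nth \<xi>"]) auto
next
  fix \<xi> :: "real^'n" assume "\<xi> \<in> vec_lambda ` (UNIV \<rightarrow>\<^sub>E real_of_int ` {- int N..int N})"
  then obtain h where h: "\<xi> = vec_lambda h" "\<And>i. h i \<in> real_of_int ` {- int N..int N}" by auto
  have "h i \<in> \<int> \<and> \<bar>h i\<bar> \<le> real N" for i using h(2)[of i] by auto
  thus "\<xi> \<in> lattice_box N" by (simp add: lattice_box_def lattice_def h(1))
qed

lemma finite_lattice_box [simp]: "finite (lattice_box N :: (real^'n) set)"
  unfolding lattice_box_eq_image by (intro finite_imageI finite_PiE) auto

lemma lattice_box_mono: "M \<le> N \<Longrightarrow> lattice_box M \<subseteq> lattice_box N"
  by (auto simp: lattice_box_def intro: order_trans[of _ "real M" "real N"])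

lemma lattice_box_exhausts:
  assumes "\<xi> \<in> lattice"
  obtains N where "\<xi> \<in> lattice_box N"
proof -
  obtain N :: nat where N: "norm \<xi> \<le> real N" using real_arch_simple by blast
  have "\<bar>\<xi> $ i\<bar> \<le> real N" for i using component_le_norm_cart[of \<xi> i] N by linarith
  thus ?thesis using assms by (intro that[of N]) (simp add: lattice_box_def)
qed

lemma sum_lattice_box_prod:
  fixes h :: "real \<Rightarrow> real"
  shows "(\<Sum>\<xi>\<in>(lattice_box N :: (real^'n) set). \<Prod>i\<in>UNIV. h (\<xi> $ i))
    = (\<Sum>k\<in>{- int N..int N}. h (of_int k)) ^ CARD('n)"
proof -
  have inj: "inj_on (vec_lambda :: ('n \<Rightarrow> real) \<Rightarrow> real^'n) A" for A by (auto simp: inj_on_def vec_lambda_inject)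
  have "(\<Sum>\<xi>\<in>(lattice_box N :: (real^'n) set). \<Prod>i\<in>UNIV. h (\<xi> $ i))
    = (\<Sum>f\<in>UNIV \<rightarrow>\<^sub>E real_of_int ` {- int N..int N}. \<Prod>i\<in>(UNIV::'n set). h (f i))"
    unfolding lattice_box_eq_image by (subst sum.reindex[OF inj]) simp
  also have "\<dots> = (\<Prod>i\<in>(UNIV::'n set). \<Sum>y\<in>real_of_int ` {- int N..int N}. h y)"
    by (rule prod_sum_PiE[symmetric]) auto
  also have "(\<Sum>y\<in>real_of_int ` {- int N..int N}. h y) = (\<Sum>k\<in>{- int N..int N}. h (of_int k))"
    by (subst sum.reindex) (auto simp: inj_on_def)
  finally show ?thesis by simp
qed

lemma lattice_box_neg: "\<xi> \<in> lattice_box N \<Longrightarrow> - \<xi> \<in> lattice_box N"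
  by (auto simp: lattice_box_def)

lemma lattice_boxD: "\<xi> \<in> lattice_box N \<Longrightarrow> \<xi> \<in> lattice"
  by (simp add: lattice_box_def)

lemma continuous_on_fourier_sum: "continuous_on S (fourier_sum f N)"
  unfolding fourier_sum_def by (intro continuous_intros)

lemma integrable_wave_mult: "integrable torus f \<Longrightarrow> integrable torus (\<lambda>x. wave \<xi> \<theta> x * f x)"
  by (intro integrable_torus_mult_continuous continuous_intros)

lemma fourier_neg: "fourier f (- \<xi>) \<theta> = fourier f \<xi> (- \<theta>)"
proof -
  have "wave (- \<xi>) \<theta> x = wave \<xi> (- \<theta>) x" for x
    using cos_minus[of "2 * pi * (\<xi> \<bullet> x) - \<theta>"] by (simp add: wave_def)
  thus ?thesis by (simp add: fourier_def)
qed

lemma fourier_phase: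
  assumes f: "integrable torus f"
  shows "fourier f \<xi> \<theta> = cos \<theta> * fourier f \<xi> 0 - sin \<theta> * fourier f \<xi> (- (pi/2))"
proof -
  have w: "wave \<xi> \<theta> x = cos \<theta> * wave \<xi> 0 x - sin \<theta> * wave \<xi> (- (pi/2)) x" for x
    using wave_shift_phase[of \<xi> 0 \<theta> x] by simp
  have "wave \<xi> \<theta> x * f x = cos \<theta> * (wave \<xi> 0 x * f x) - sin \<theta> * (wave \<xi> (- (pi/2)) x * f x)" for x
    by (simp only: w left_diff_distrib mult.assoc)
  thus ?thesis using integrable_wave_mult[OF f] by (simp add: fourier_def)
qed

lemma integral_wave_mult:
  assumes "\<xi> \<in> lattice" "\<eta> \<in> lattice"
  shows "(\<integral>x. wave \<xi> \<theta> x * wave \<eta> \<tau> x \<partial>torus)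
    = ((if \<xi> = - \<eta> then cos (\<theta> + \<tau>) else 0) + (if \<xi> = \<eta> then cos (\<theta> - \<tau>) else 0)) / 2"
proof -
  have i: "integrable torus (wave \<zeta> \<sigma>)" for \<zeta> :: "real^'n" and \<sigma>
    by (intro integrable_torus_continuous continuous_intros)
  have "(\<integral>x. wave \<xi> \<theta> x * wave \<eta> \<tau> x \<partial>torus)
     = ((\<integral>x. wave (\<xi> + \<eta>) (\<theta> + \<tau>) x \<partial>torus) + (\<integral>x. wave (\<xi> - \<eta>) (\<theta> - \<tau>) x \<partial>torus)) / 2"
    unfolding wave_mult by (simp add: Bochner_Integration.integral_add[OF i i])
  moreover have "\<xi> + \<eta> = 0 \<longleftrightarrow> \<xi> = - \<eta>" by (simp add: eq_neg_iff_add_eq_0)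
  ultimately show ?thesis using assms by (simp add: integral_wave)
qed

text \<open>A partial sum over a symmetric box of frequencies reproduces the coefficients in the box: the
  two frequencies \<open>\<eta>\<close> and \<open>- \<eta>\<close> each contribute one half.\<close>

lemma fourier_fourier_sum:
  fixes f :: "real^'n \<Rightarrow> real"
  assumes f: "integrable torus f" and \<eta>: "\<eta> \<in> lattice_box N"
  shows "fourier (fourier_sum f N) \<eta> \<theta> = fourier f \<eta> \<theta>"
proof -
  have i: "integrable torus (\<lambda>x. wave \<xi> \<sigma> x * wave \<eta> \<theta> x)" for \<xi> \<sigma>
    by (intro integrable_torus_continuous continuous_intros)
  define a b :: "real^'n \<Rightarrow> real" where "a = (\<lambda>\<xi>. fourier f \<xi> 0)" and "b = (\<lambda>\<xi>. fourier f \<xi> (- (pi/2)))"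
  have "wave \<eta> \<theta> x * fourier_sum f N x
     = (\<Sum>\<xi>\<in>lattice_box N. a \<xi> * (wave \<xi> 0 x * wave \<eta> \<theta> x) + b \<xi> * (wave \<xi> (- (pi/2)) x * wave \<eta> \<theta> x))" for x
    unfolding fourier_sum_def sum_distrib_left a_def b_def
    by (intro sum.cong refl) (simp add: algebra_simps)
  hence "fourier (fourier_sum f N) \<eta> \<theta>
     = (\<Sum>\<xi>\<in>lattice_box N. a \<xi> * (\<integral>x. wave \<xi> 0 x * wave \<eta> \<theta> x \<partial>torus)
          + b \<xi> * (\<integral>x. wave \<xi> (- (pi/2)) x * wave \<eta> \<theta> x \<partial>torus))"
    using i by (simp add: fourier_def)
  also have "\<dots> = (\<Sum>\<xi>\<in>lattice_box N. (if \<xi> = - \<eta> then (a \<xi> * cos \<theta> + b \<xi> * sin \<theta>) / 2 else 0)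
       + (if \<xi> = \<eta> then (a \<xi> * cos \<theta> - b \<xi> * sin \<theta>) / 2 else 0))"
  proof (intro sum.cong refl)
    fix \<xi> :: "real^'n" assume \<xi>: "\<xi> \<in> lattice_box N"
    have c: "cos (- (pi/2) + \<theta>) = sin \<theta>" "cos (- (pi/2) - \<theta>) = - sin \<theta>"
      by (simp_all add: cos_add cos_diff)
    show "a \<xi> * (\<integral>x. wave \<xi> 0 x * wave \<eta> \<theta> x \<partial>torus) + b \<xi> * (\<integral>x. wave \<xi> (- (pi/2)) x * wave \<eta> \<theta> x \<partial>torus)
      = (if \<xi> = - \<eta> then (a \<xi> * cos \<theta> + b \<xi> * sin \<theta>) / 2 else 0)
       + (if \<xi> = \<eta> then (a \<xi> * cos \<theta> - b \<xi> * sin \<theta>) / 2 else 0)"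
      unfolding integral_wave_mult[OF lattice_boxD[OF \<xi>] lattice_boxD[OF \<eta>]] c
      by (cases "\<xi> = \<eta>"; cases "\<xi> = - \<eta>") (simp_all add: field_simps)
  qed
  also have "\<dots> = (a (- \<eta>) * cos \<theta> + b (- \<eta>) * sin \<theta>) / 2 + (a \<eta> * cos \<theta> - b \<eta> * sin \<theta>) / 2"
    using \<eta> lattice_box_neg[OF \<eta>] by (simp add: sum.distrib)
  also have "a (- \<eta>) = a \<eta>" by (simp add: a_def fourier_neg)
  also have "b (- \<eta>) = - b \<eta>"
    unfolding b_def fourier_neg using fourier_phase[OF f, of \<eta> "pi/2"] by simp
  finally show ?thesis unfolding fourier_phase[OF f, of \<eta> \<theta>] a_def b_def by (simp add: algebra_simps)
qed

text \<open>The partial sum is the orthogonal projection, so the squared norm of the difference is the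
  difference of the squared norms.\<close>

lemma bessel:
  assumes f: "integrable torus f" and f2: "integrable torus (\<lambda>x. (f x)\<^sup>2)"
  shows "(\<Sum>\<xi>\<in>lattice_box N. (fourier f \<xi> 0)\<^sup>2 + (fourier f \<xi> (- (pi/2)))\<^sup>2) \<le> (\<integral>x. (f x)\<^sup>2 \<partial>torus)"
proof -
  define P where "P = fourier_sum f N"
  have Pc: "continuous_on (cbox 0 1) P" unfolding P_def by (rule continuous_on_fourier_sum)
  have proj: "(\<integral>x. P x * h x \<partial>torus) = (\<Sum>\<xi>\<in>lattice_box N. fourier f \<xi> 0 * fourier h \<xi> 0
     + fourier f \<xi> (- (pi/2)) * fourier h \<xi> (- (pi/2)))" if h: "integrable torus h" for h
  proof -
    have "P x * h x = (\<Sum>\<xi>\<in>lattice_box N. fourier f \<xi> 0 * (wave \<xi> 0 x * h x)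
       + fourier f \<xi> (- (pi/2)) * (wave \<xi> (- (pi/2)) x * h x))" for x
      unfolding P_def fourier_sum_def sum_distrib_right by (intro sum.cong refl) (simp add: algebra_simps)
    thus ?thesis using integrable_wave_mult[OF h] by (simp add: fourier_def)
  qed
  have Pi: "integrable torus P" "integrable torus (\<lambda>x. P x * P x)"
    by (intro integrable_torus_continuous continuous_intros Pc)+
  have fP: "integrable torus (\<lambda>x. P x * f x)" by (intro integrable_torus_mult_continuous Pc f)
  define S where "S = (\<Sum>\<xi>\<in>lattice_box N. (fourier f \<xi> 0)\<^sup>2 + (fourier f \<xi> (- (pi/2)))\<^sup>2)"
  have 1: "(\<integral>x. P x * f x \<partial>torus) = S" unfolding proj[OF f] S_def by (simp add: power2_eq_square)
  have "(\<integral>x. P x * P x \<partial>torus) = (\<Sum>\<xi>\<in>lattice_box N. fourier f \<xi> 0 * fourier P \<xi> 0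
     + fourier f \<xi> (- (pi/2)) * fourier P \<xi> (- (pi/2)))" by (rule proj[OF Pi(1)])
  also have "\<dots> = S"
    unfolding S_def P_def
    by (intro sum.cong refl) (simp add: fourier_fourier_sum[OF f] power2_eq_square)
  finally have 2: "(\<integral>x. P x * P x \<partial>torus) = S" .
  have "0 \<le> (\<integral>x. (f x - P x)\<^sup>2 \<partial>torus)" by (intro Bochner_Integration.integral_nonneg) auto
  also have "(\<lambda>x. (f x - P x)\<^sup>2) = (\<lambda>x. (f x)\<^sup>2 - 2 * (P x * f x) + P x * P x)"
    by (simp add: fun_eq_iff power2_eq_square algebra_simps)
  also have "(\<integral>x. (f x)\<^sup>2 - 2 * (P x * f x) + P x * P x \<partial>torus) = (\<integral>x. (f x)\<^sup>2 \<partial>torus) - 2 * S + S"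
    using f2 fP Pi by (simp add: 1 2)
  finally show ?thesis by (simp add: S_def)
qed

lemma Lp_torus_1_integrable: "f \<in> Lp_torus 1 \<Longrightarrow> integrable torus f"
  by (auto simp: Lp_torus_def powr_one_gt_zero_iff intro: integrable_norm_cancel)

lemma Lp_torus_2D:
  assumes "f \<in> Lp_torus 2"
  shows "integrable torus (\<lambda>x. (f x)\<^sup>2)" "integrable torus f"
proof -
  have p: "\<bar>y\<bar> powr 2 = y\<^sup>2" for y :: real by (cases "y = 0") (auto simp: powr_numeral)
  show 2: "integrable torus (\<lambda>x. (f x)\<^sup>2)" using assms by (simp add: Lp_torus_def p)
  show "integrable torus f"
  proof (rule Bochner_Integration.integrable_bound)
    show "integrable torus (\<lambda>x. 1 + (f x)\<^sup>2)" using 2 by auto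
    show "f \<in> borel_measurable torus" using assms by (simp add: Lp_torus_def)
    have "\<bar>y\<bar> \<le> 1 + y\<^sup>2" for y :: real
      using zero_le_power2[of "\<bar>y\<bar> - 1/2"] by (simp add: power2_eq_square algebra_simps abs_if split: if_splits)
    thus "AE x in torus. norm (f x) \<le> norm (1 + (f x)\<^sup>2)" by (simp add: abs_of_nonneg)
  qed
qed

text \<open>An even number of derivatives reproduces a wave up to a factor.\<close>

lemma weak_deriv_fourier:
  assumes w: "is_weak_deriv (replicate (2 * k) i) f h" and \<xi>: "\<xi> \<in> lattice"
  shows "(2 * pi * \<xi> $ i) ^ (2 * k) * \<bar>fourier f \<xi> \<theta>\<bar> = \<bar>fourier h \<xi> \<theta>\<bar>"
proof -
  have wv: "wave \<xi> (\<theta> + real (2 * k) * (pi/2)) x = (-1) ^ k * wave \<xi> \<theta> x" for x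
  proof -
    have "wave \<xi> (\<theta> + real (2 * k) * (pi/2)) x = cos ((2 * pi * (\<xi> \<bullet> x) + \<theta>) + real k * pi)"
      by (simp add: wave_def add.assoc)
    also have "\<dots> = (-1) ^ k * wave \<xi> \<theta> x" unfolding cos_add[of "2 * pi * (\<xi> \<bullet> x) + \<theta>"] by (simp add: wave_def)
    finally show ?thesis .
  qed
  have "(\<integral>x. f x * multi_deriv (replicate (2 * k) i) (wave \<xi> \<theta>) x \<partial>torus) = (\<integral>x. h x * wave \<xi> \<theta> x \<partial>torus)"
    using w wave_test[OF \<xi>, of \<theta>] unfolding is_weak_deriv_def by simp
  moreover have "f x * multi_deriv (replicate (2 * k) i) (wave \<xi> \<theta>) x
     = ((2 * pi * \<xi> $ i) ^ (2 * k) * (-1) ^ k) * (wave \<xi> \<theta> x * f x)" for x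
    unfolding multi_deriv_wave length_replicate wv by (simp add: mult_ac)
  ultimately have "(\<integral>x. ((2 * pi * \<xi> $ i) ^ (2 * k) * (-1) ^ k) * (wave \<xi> \<theta> x * f x) \<partial>torus)
     = (\<integral>x. h x * wave \<xi> \<theta> x \<partial>torus)" by (simp only:)
  hence "((2 * pi * \<xi> $ i) ^ (2 * k) * (-1) ^ k) * fourier f \<xi> \<theta> = fourier h \<xi> \<theta>"
    unfolding fourier_def integral_mult_right_zero by (simp add: mult.commute)
  hence "\<bar>fourier h \<xi> \<theta>\<bar> = \<bar>((2 * pi * \<xi> $ i) ^ (2 * k) * (-1) ^ k) * fourier f \<xi> \<theta>\<bar>" by simp
  also have "\<dots> = \<bar>(2 * pi * \<xi> $ i) ^ (2 * k)\<bar> * \<bar>(-1) ^ k\<bar> * \<bar>fourier f \<xi> \<theta>\<bar>" by (simp only: abs_mult)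
  also have "\<bar>(2 * pi * \<xi> $ i) ^ (2 * k)\<bar> = (2 * pi * \<xi> $ i) ^ (2 * k)"
    by (intro abs_of_nonneg) (simp add: power_mult)
  also have "\<bar>(-1) ^ k :: real\<bar> = 1" by (simp add: power_abs)
  finally show ?thesis by simp
qed

text \<open>The multi-dimensional lattice sum is dominated by a product of one-dimensional ones.\<close>

lemma lattice_weight_summable:
  assumes k: "4 * real k > real CARD('n) + 6"
  obtains M where "\<And>N. (\<Sum>\<xi>\<in>(lattice_box N :: (real^'n) set).
    (1 + norm \<xi>) ^ 4 / (1 + (\<Sum>i\<in>UNIV. (\<xi> $ i) ^ (4 * k)))) \<le> M"
proof -
  define d where "d = real CARD('n)"
  have d: "d \<ge> 1" unfolding d_def by (simp add: Suc_leI)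
  define s where "s = (4 * real k - 4) / d"
  have s: "s > 1" using k d by (simp add: s_def d_def[symmetric] field_simps)
  have k1: "4 \<le> 4 * k" using k by (cases k) auto
  define h where "h = (\<lambda>y::real. (1 + \<bar>y\<bar>) powr (- s))"
  define C where "C = d ^ 4 * 2 ^ (4 * k)"
  have C: "C \<ge> 0" using d by (simp add: C_def)
  have ptw: "(1 + norm \<xi>) ^ 4 / (1 + (\<Sum>i\<in>UNIV. (\<xi> $ i) ^ (4 * k))) \<le> C * (\<Prod>i\<in>UNIV. h (\<xi> $ i))" for \<xi> :: "real^'n"
  proof -
    \<comment> \<open>All norms of \<open>\<xi>\<close> are comparable to the largest coordinate, and each factor of the product is at
      least its value there.\<close>
    define m where "m = Max (range (\<lambda>i. \<bar>\<xi> $ i\<bar>))"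
    have le: "\<bar>\<xi> $ i\<bar> \<le> m" for i unfolding m_def by (intro Max_ge) auto
    have "m \<in> range (\<lambda>i. \<bar>\<xi> $ i\<bar>)" unfolding m_def by (intro Max_in) auto
    then obtain j where j: "m = \<bar>\<xi> $ j\<bar>" by blast
    have m0: "m \<ge> 0" by (simp add: j)
    have "norm \<xi> \<le> (\<Sum>i\<in>UNIV. \<bar>\<xi> $ i\<bar>)" by (rule norm_le_l1_cart)
    also have "\<dots> \<le> (\<Sum>i\<in>(UNIV::'n set). m)" by (intro sum_mono le)
    also have "\<dots> = d * m" by (simp add: d_def)
    finally have "1 + norm \<xi> \<le> d * (1 + m)" using d by (simp add: distrib_left)
    hence "(1 + norm \<xi>) ^ 4 \<le> (d * (1 + m)) ^ 4" by (intro power_mono) auto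
    hence num: "(1 + norm \<xi>) ^ 4 \<le> d ^ 4 * (1 + m) ^ 4" by (simp only: power_mult_distrib)
    have "(1 + m) ^ (4 * k) \<le> (2 * max 1 m) ^ (4 * k)" using m0 by (intro power_mono) auto
    also have "\<dots> = 2 ^ (4 * k) * (max 1 m) ^ (4 * k)" by (simp only: power_mult_distrib)
    also have "(max 1 m) ^ (4 * k) \<le> 1 + m ^ (4 * k)" using m0 by (auto simp: max_def)
    also have "m ^ (4 * k) = (\<xi> $ j) ^ (4 * k)" unfolding j by (simp add: power_mult)
    also have "(\<xi> $ j) ^ (4 * k) \<le> (\<Sum>i\<in>UNIV. (\<xi> $ i) ^ (4 * k))"
      by (intro member_le_sum) (auto simp: power_mult)
    finally have den: "(1 + m) ^ (4 * k) \<le> 2 ^ (4 * k) * (1 + (\<Sum>i\<in>UNIV. (\<xi> $ i) ^ (4 * k)))" by simp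
    define W where "W = 1 + (\<Sum>i\<in>UNIV. (\<xi> $ i) ^ (4 * k))"
    have "0 \<le> (\<Sum>i\<in>UNIV. (\<xi> $ i) ^ (4 * k))" by (intro sum_nonneg) (auto simp: power_mult)
    hence W: "W \<ge> 1" by (simp add: W_def)
    have pos: "(1 + m) ^ (4 * k) > 0" using m0 by simp
    have "(1 + norm \<xi>) ^ 4 / W \<le> d ^ 4 * (1 + m) ^ 4 / W" using num W by (intro divide_right_mono) auto
    also have "\<dots> \<le> d ^ 4 * (1 + m) ^ 4 * (2 ^ (4 * k) / (1 + m) ^ (4 * k))"
    proof -
      have "(1 + m) ^ (4 * k) \<le> 2 ^ (4 * k) * W" using den unfolding W_def .
      hence "1 / W \<le> 2 ^ (4 * k) / (1 + m) ^ (4 * k)"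
        using W pos by (simp add: divide_simps mult.commute)
      hence "d ^ 4 * (1 + m) ^ 4 * (1 / W) \<le> d ^ 4 * (1 + m) ^ 4 * (2 ^ (4 * k) / (1 + m) ^ (4 * k))"
        using m0 d by (intro mult_left_mono) auto
      thus ?thesis by simp
    qed
    also have "\<dots> = C * ((1 + m) ^ 4 / (1 + m) ^ (4 * k))" by (simp add: C_def)
    also have "(1 + m) ^ 4 / (1 + m) ^ (4 * k) = (1 + m) powr (4 - 4 * real k)"
      using m0 powr_diff[of "1 + m" 4 "4 * real k"] powr_realpow[of "1 + m" "4 * k"] by simp
    also have "(1 + m) powr (4 - 4 * real k) = (\<Prod>i\<in>(UNIV::'n set). (1 + m) powr (- s))"
    proof -
      have "(\<Prod>i\<in>(UNIV::'n set). (1 + m) powr (- s)) = (1 + m) powr (d * (- s))"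
        using m0 by (simp add: d_def powr_power mult.commute)
      also have "d * (- s) = 4 - 4 * real k" using d by (simp add: s_def)
      finally show ?thesis ..
    qed
    also have "C * \<dots> \<le> C * (\<Prod>i\<in>UNIV. h (\<xi> $ i))"
      unfolding h_def using s le m0 C by (intro mult_left_mono prod_mono conjI powr_mono2') auto
    finally show ?thesis by (simp add: W_def)
  qed
  have "summable (\<lambda>n. real n powr (- s))" using s by (simp add: summable_real_powr_iff)
  hence sm: "summable (\<lambda>n. real (Suc n) powr (- s))" by (subst summable_Suc_iff)
  define Z where "Z = (\<Sum>n. real (Suc n) powr (- s))"
  have one: "(\<Sum>k\<in>{- int N..int N}. h (of_int k)) \<le> 2 * Z" for N
  proof -
    have half: "(\<Sum>n\<in>{..N}. h (real n)) \<le> Z"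
    proof -
      have "(\<Sum>n\<in>{..N}. h (real n)) = (\<Sum>n\<in>{..N}. real (Suc n) powr (- s))" by (simp add: h_def add.commute)
      also have "\<dots> \<le> Z" unfolding Z_def by (rule sum_le_suminf[OF sm]) auto
      finally show ?thesis .
    qed
    have h0: "h y \<ge> 0" for y by (simp add: h_def)
    have "{- int N..int N} \<subseteq> int ` {..N} \<union> (\<lambda>n. - int n) ` {..N}"
    proof
      fix x assume x: "x \<in> {- int N..int N}"
      show "x \<in> int ` {..N} \<union> (\<lambda>n. - int n) ` {..N}"
      proof (cases "x \<ge> 0")
        case True
        hence "x = int (nat x)" "nat x \<in> {..N}" using x by auto
        thus ?thesis by blast
      next
        case False
        hence "x = - int (nat (- x))" "nat (- x) \<in> {..N}" using x by auto
        thus ?thesis by blast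
      qed
    qed
    hence "(\<Sum>k\<in>{- int N..int N}. h (of_int k)) \<le> (\<Sum>k\<in>int ` {..N} \<union> (\<lambda>n. - int n) ` {..N}. h (of_int k))"
      by (intro sum_mono2) (auto simp: h0)
    also have "\<dots> \<le> (\<Sum>k\<in>int ` {..N}. h (of_int k)) + (\<Sum>k\<in>(\<lambda>n. - int n) ` {..N}. h (of_int k))"
      by (subst sum.union_inter[symmetric]) (auto intro!: sum_nonneg h0)
    also have "\<dots> = (\<Sum>n\<in>{..N}. h (real n)) + (\<Sum>n\<in>{..N}. h (real n))"
      by (subst (1 2) sum.reindex) (auto simp: inj_on_def h_def)
    also have "\<dots> \<le> 2 * Z" using half by simp
    finally show ?thesis .
  qed
  have "(\<Sum>\<xi>\<in>(lattice_box N :: (real^'n) set). (1 + norm \<xi>) ^ 4 / (1 + (\<Sum>i\<in>UNIV. (\<xi> $ i) ^ (4 * k))))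
      \<le> C * (2 * Z) ^ CARD('n)" for N
  proof -
    have "(\<Sum>\<xi>\<in>(lattice_box N :: (real^'n) set). (1 + norm \<xi>) ^ 4 / (1 + (\<Sum>i\<in>UNIV. (\<xi> $ i) ^ (4 * k))))
      \<le> (\<Sum>\<xi>\<in>(lattice_box N :: (real^'n) set). C * (\<Prod>i\<in>UNIV. h (\<xi> $ i)))" by (intro sum_mono ptw)
    also have "\<dots> = C * (\<Sum>k\<in>{- int N..int N}. h (of_int k)) ^ CARD('n)"
      by (simp add: sum_distrib_left[symmetric] sum_lattice_box_prod)
    also have "\<dots> \<le> C * (2 * Z) ^ CARD('n)"
      using one[of N] C by (intro mult_left_mono power_mono) (auto intro!: sum_nonneg simp: h_def)
    finally show ?thesis .
  qed
  thus ?thesis by (rule that)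
qed

definition amplitude :: "(real^'n \<Rightarrow> real) \<Rightarrow> real^'n \<Rightarrow> real" where
  "amplitude f \<xi> = \<bar>fourier f \<xi> 0\<bar> + \<bar>fourier f \<xi> (- (pi/2))\<bar>"

text \<open>Bessel's inequality for \<open>f\<close> and its pure derivatives of order \<open>2k\<close> bounds a weighted sum of squares
  of the coefficients. The arithmetic-geometric mean inequality against the summable weight turns it
  into a bound on the sum of the coefficients times the squared frequency.\<close>

lemma sobolev_fourier_decay:
  fixes f :: "real^'n \<Rightarrow> real"
  assumes f: "f \<in> sobolev_torus (2 * k) 2" and k: "4 * real k > real CARD('n) + 6"
  obtains M where "\<And>N. (\<Sum>\<xi>\<in>lattice_box N. amplitude f \<xi> * (1 + norm \<xi>)\<^sup>2) \<le> M"
proof -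
  have fL: "f \<in> Lp_torus 2" using f by (simp add: sobolev_torus_def)
  have "\<exists>h. h \<in> Lp_torus 2 \<and> is_weak_deriv (replicate (2 * k) i) f h" for i
  proof -
    have "\<And>js. length js \<le> 2 * k \<Longrightarrow> \<exists>h\<in>Lp_torus 2. is_weak_deriv js f h"
      using f by (simp add: sobolev_torus_def)
    from this[of "replicate (2 * k) i"] show ?thesis by auto
  qed
  then obtain h where h: "\<And>i. h i \<in> Lp_torus 2" "\<And>i. is_weak_deriv (replicate (2 * k) i) f (h i)" by metis
  define E where "E = (\<lambda>f (\<xi>::real^'n). (fourier f \<xi> 0)\<^sup>2 + (fourier f \<xi> (- (pi/2)))\<^sup>2)"
  define W where "W = (\<lambda>\<xi>::real^'n. 1 + (\<Sum>i\<in>UNIV. (\<xi> $ i) ^ (4 * k)))"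
  have W: "W \<xi> \<ge> 1" for \<xi> unfolding W_def by (simp add: sum_nonneg power_mult)
  define M1 where "M1 = (\<integral>x. (f x)\<^sup>2 \<partial>torus) + (\<Sum>i\<in>UNIV. \<integral>x. (h i x)\<^sup>2 \<partial>torus)"
  have EW: "(\<Sum>\<xi>\<in>lattice_box N. E f \<xi> * W \<xi>) \<le> M1" for N
  proof -
    have "E f \<xi> * (\<xi> $ i) ^ (4 * k) \<le> E (h i) \<xi>" if \<xi>: "\<xi> \<in> lattice_box N" for \<xi> i
    proof -
      have c: "(fourier f \<xi> \<theta>)\<^sup>2 * (\<xi> $ i) ^ (4 * k) \<le> (fourier (h i) \<xi> \<theta>)\<^sup>2" for \<theta>
      proof -
        have nn: "(\<xi> $ i) ^ (2 * k) \<ge> 0" by (simp add: power_mult)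
        have "(1::real) \<le> (2 * pi) ^ (2 * k)" using pi_ge_two by (intro one_le_power) linarith
        hence "1 * (\<xi> $ i) ^ (2 * k) \<le> (2 * pi) ^ (2 * k) * (\<xi> $ i) ^ (2 * k)"
          using nn by (intro mult_right_mono)
        hence "(\<xi> $ i) ^ (2 * k) \<le> (2 * pi * \<xi> $ i) ^ (2 * k)" by (simp only: power_mult_distrib mult_1)
        hence "(\<xi> $ i) ^ (2 * k) * \<bar>fourier f \<xi> \<theta>\<bar> \<le> \<bar>fourier (h i) \<xi> \<theta>\<bar>"
          unfolding weak_deriv_fourier[OF h(2)[of i] lattice_boxD[OF \<xi>], of \<theta>, symmetric]
          by (intro mult_right_mono) auto
        hence "((\<xi> $ i) ^ (2 * k) * \<bar>fourier f \<xi> \<theta>\<bar>)\<^sup>2 \<le> \<bar>fourier (h i) \<xi> \<theta>\<bar>\<^sup>2"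
          using nn by (intro power_mono) auto
        moreover have "((\<xi> $ i) ^ (2 * k))\<^sup>2 = (\<xi> $ i) ^ (4 * k)" by (simp add: power_mult[symmetric])
        ultimately show ?thesis by (simp add: power_mult_distrib mult.commute)
      qed
      show ?thesis unfolding E_def using c[of 0] c[of "- (pi/2)"] by (simp add: distrib_right)
    qed
    hence "(\<Sum>\<xi>\<in>lattice_box N. E f \<xi> * W \<xi>) \<le> (\<Sum>\<xi>\<in>lattice_box N. E f \<xi> + (\<Sum>i\<in>UNIV. E (h i) \<xi>))"
      unfolding W_def distrib_left sum_distrib_left by (intro sum_mono add_mono) auto
    also have "\<dots> = (\<Sum>\<xi>\<in>lattice_box N. E f \<xi>) + (\<Sum>i\<in>UNIV. \<Sum>\<xi>\<in>lattice_box N. E (h i) \<xi>)"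
      by (simp add: sum.distrib sum.swap[of _ UNIV])
    also have "\<dots> \<le> M1"
      unfolding M1_def E_def by (intro add_mono sum_mono bessel Lp_torus_2D fL h)
    finally show ?thesis .
  qed
  obtain M2 where M2: "\<And>N. (\<Sum>\<xi>\<in>(lattice_box N :: (real^'n) set). (1 + norm \<xi>) ^ 4 / W \<xi>) \<le> M2"
    unfolding W_def using lattice_weight_summable[OF k] by blast
  have "(\<Sum>\<xi>\<in>lattice_box N. amplitude f \<xi> * (1 + norm \<xi>)\<^sup>2) \<le> M1 / 2 + M2" for N
  proof -
    have "amplitude f \<xi> * (1 + norm \<xi>)\<^sup>2 \<le> E f \<xi> * W \<xi> / 2 + (1 + norm \<xi>) ^ 4 / W \<xi>" for \<xi>
    proof -
      define w where "w = (1 + norm \<xi>)\<^sup>2"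
      have W0: "W \<xi> > 0" using W[of \<xi>] by simp
      have am: "\<bar>y\<bar> * w \<le> y\<^sup>2 * W \<xi> / 2 + w\<^sup>2 / W \<xi> / 2" for y
      proof -
        have "0 \<le> (\<bar>y\<bar> * W \<xi> - w)\<^sup>2" by simp
        hence "2 * (\<bar>y\<bar> * w) * W \<xi> \<le> y\<^sup>2 * (W \<xi>)\<^sup>2 + w\<^sup>2"
          by (simp add: power2_eq_square algebra_simps)
        hence "2 * (\<bar>y\<bar> * w) \<le> (y\<^sup>2 * (W \<xi>)\<^sup>2 + w\<^sup>2) / W \<xi>" using W0 by (simp add: pos_le_divide_eq)
        also have "\<dots> = y\<^sup>2 * W \<xi> + w\<^sup>2 / W \<xi>" using W0 by (simp add: add_divide_distrib power2_eq_square)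
        finally show ?thesis by simp
      qed
      have "w\<^sup>2 = (1 + norm \<xi>) ^ 4" by (simp add: w_def power_mult[symmetric])
      thus ?thesis using am[of "fourier f \<xi> 0"] am[of "fourier f \<xi> (- (pi/2))"]
        by (simp add: amplitude_def E_def w_def[symmetric] distrib_right add_divide_distrib)
    qed
    hence "(\<Sum>\<xi>\<in>lattice_box N. amplitude f \<xi> * (1 + norm \<xi>)\<^sup>2)
       \<le> (\<Sum>\<xi>\<in>lattice_box N. E f \<xi> * W \<xi> / 2 + (1 + norm \<xi>) ^ 4 / W \<xi>)" by (intro sum_mono)
    also have "\<dots> = (\<Sum>\<xi>\<in>lattice_box N. E f \<xi> * W \<xi>) / 2 + (\<Sum>\<xi>\<in>lattice_box N. (1 + norm \<xi>) ^ 4 / W \<xi>)"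
      by (simp add: sum.distrib sum_divide_distrib)
    also have "\<dots> \<le> M1 / 2 + M2" using EW[of N] M2[of N] by simp
    finally show ?thesis .
  qed
  thus ?thesis by (rule that)
qed

lemma lattice_sum_converges:
  fixes c :: "real^'n \<Rightarrow> 'x \<Rightarrow> real" and b :: "real^'n \<Rightarrow> real"
  assumes c: "\<And>\<xi> x. \<bar>c \<xi> x\<bar> \<le> b \<xi>" and M: "\<And>N. (\<Sum>\<xi>\<in>lattice_box N. b \<xi>) \<le> M"
  obtains F e where "\<And>N x. \<bar>(\<Sum>\<xi>\<in>lattice_box N. c \<xi> x) - F x\<bar> \<le> e N" "e \<longlonglongrightarrow> 0"
    "\<And>x. (\<lambda>N. \<Sum>\<xi>\<in>lattice_box N. c \<xi> x) \<longlonglongrightarrow> F x" "\<And>N x. \<bar>\<Sum>\<xi>\<in>lattice_box N. c \<xi> x\<bar> \<le> M"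
proof -
  have b0: "b \<xi> \<ge> 0" for \<xi> using c[of \<xi> undefined] by linarith
  define S where "S = (\<lambda>N. \<Sum>\<xi>\<in>lattice_box N. b \<xi>)"
  define P where "P = (\<lambda>N x. \<Sum>\<xi>\<in>lattice_box N. c \<xi> x)"
  have "incseq S" unfolding S_def incseq_def
    by (intro allI impI sum_mono2 lattice_box_mono) (auto simp: b0)
  then obtain s where s: "S \<longlonglongrightarrow> s" and Ss: "\<And>N. S N \<le> s"
    using incseq_convergent[of S M] M by (auto simp: S_def)
  have diff: "\<bar>P K x - P N x\<bar> \<le> S K - S N" if "N \<le> K" for K N x
  proof -
    have "P K x - P N x = (\<Sum>\<xi>\<in>lattice_box K - lattice_box N. c \<xi> x)"
      unfolding P_def using lattice_box_mono[OF that] by (subst sum_diff) auto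
    also have "\<bar>\<dots>\<bar> \<le> (\<Sum>\<xi>\<in>lattice_box K - lattice_box N. b \<xi>)"
      by (rule order_trans[OF sum_abs sum_mono]) (rule c)
    also have "\<dots> = S K - S N"
      unfolding S_def using lattice_box_mono[OF that] by (subst sum_diff) auto
    finally show ?thesis .
  qed
  have conv: "convergent (\<lambda>N. P N x)" for x
  proof (rule Cauchy_convergent, rule CauchyI')
    fix \<epsilon> :: real assume "\<epsilon> > 0"
    from order_tendstoD(1)[OF s, of "s - \<epsilon>"] \<open>\<epsilon> > 0\<close> obtain N0 where N0: "\<And>N. N \<ge> N0 \<Longrightarrow> s - \<epsilon> < S N"
      by (auto simp: eventually_sequentially)
    have "dist (P m x) (P n x) < \<epsilon>" if "m \<ge> N0" "n > m" for m n
      using diff[of m n x] that N0[of m] Ss[of n] by (simp add: dist_real_def abs_minus_commute)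
    thus "\<exists>M. \<forall>m\<ge>M. \<forall>n>m. dist (P m x) (P n x) < \<epsilon>" by blast
  qed
  define F where "F = (\<lambda>x. lim (\<lambda>N. P N x))"
  have PF: "(\<lambda>N. P N x) \<longlonglongrightarrow> F x" for x using conv unfolding F_def by (simp add: convergent_LIMSEQ_iff)
  have "\<bar>P N x - F x\<bar> \<le> s - S N" for N x
  proof -
    have "\<forall>\<^sub>F K in sequentially. \<bar>P N x - P K x\<bar> \<le> s - S N"
      using eventually_ge_at_top[of N]
    proof eventually_elim
      case (elim K)
      show ?case using diff[OF elim, of x] Ss[of K] by (simp add: abs_minus_commute)
    qed
    moreover have "(\<lambda>K. \<bar>P N x - P K x\<bar>) \<longlonglongrightarrow> \<bar>P N x - F x\<bar>" by (intro tendsto_intros PF)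
    ultimately show ?thesis by (intro tendsto_upperbound[of _ _ sequentially]) auto
  qed
  moreover have "(\<lambda>N. s - S N) \<longlonglongrightarrow> 0" using tendsto_diff[OF tendsto_const s, of s] by simp
  moreover have "\<bar>P N x\<bar> \<le> M" for N x
    unfolding P_def by (rule order_trans[OF order_trans[OF sum_abs sum_mono] M]) (rule c)
  ultimately show ?thesis using PF by (intro that[of F "\<lambda>N. s - S N"]) (simp_all add: P_def)
qed

lemma periodic_limit:
  assumes "\<And>N. periodic (p N)" "\<And>x. (\<lambda>N. p N x) \<longlonglongrightarrow> F x"
  shows "periodic F"
  unfolding periodic_def
proof (intro allI)
  fix i x
  have "(\<lambda>N. p N x) \<longlonglongrightarrow> F (x + axis i 1)"
    using assms(2)[of "x + axis i 1"] assms(1) by (simp add: periodic_def)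
  thus "F (x + axis i 1) = F x" using assms(2) by (rule LIMSEQ_unique)
qed

lemma tendsto_integral_mult_bounded:
  fixes m :: "real^'n \<Rightarrow> real"
  assumes m: "integrable torus m" and h: "\<And>N. h N \<in> borel_measurable torus"
    and conv: "\<And>x. x \<in> cbox 0 1 \<Longrightarrow> (\<lambda>N. h N x) \<longlonglongrightarrow> l x"
    and B: "\<And>N x. x \<in> cbox 0 1 \<Longrightarrow> \<bar>h N x\<bar> \<le> B"
  shows "(\<lambda>N. \<integral>x. h N x * m x \<partial>torus) \<longlonglongrightarrow> (\<integral>x. l x * m x \<partial>torus)" "integrable torus (\<lambda>x. l x * m x)"
    "l \<in> borel_measurable torus"
proof -
  note [measurable] = h
  have mm [measurable]: "m \<in> borel_measurable torus" using m by auto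
  show lm [measurable]: "l \<in> borel_measurable torus"
    by (rule borel_measurable_LIMSEQ_metric[OF h]) (use conv in simp)
  have w: "integrable torus (\<lambda>x. B * \<bar>m x\<bar>)" using m by auto
  have c: "AE x in torus. (\<lambda>N. h N x * m x) \<longlonglongrightarrow> l x * m x"
    using AE_torus_cube by eventually_elim (intro tendsto_intros conv)
  have b: "AE x in torus. norm (h N x * m x) \<le> B * \<bar>m x\<bar>" for N
    using AE_torus_cube by eventually_elim (simp add: abs_mult mult_right_mono B)
  show "(\<lambda>N. \<integral>x. h N x * m x \<partial>torus) \<longlonglongrightarrow> (\<integral>x. l x * m x \<partial>torus)"
    by (rule integral_dominated_convergence[OF _ _ w c b]) measurable
  show "integrable torus (\<lambda>x. l x * m x)"
    by (rule integrable_dominated_convergence[OF _ _ w c b]) measurable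
qed

lemma integral_torus_cong_AE:
  fixes f h :: "real^'n \<Rightarrow> real"
  assumes ae: "AE x in torus. f x = h x" and h: "h \<in> borel_measurable torus"
  shows "(\<integral>x. f x \<partial>torus) = (\<integral>x. h x \<partial>torus)"
proof -
  let ?i = "\<lambda>(f::real^'n \<Rightarrow> real) x. if x \<in> cbox 0 1 then f x else 0"
  have "?i h \<in> borel_measurable lebesgue"
    using h unfolding torus_def by (subst borel_measurable_if) auto
  moreover have "AE x in lebesgue. x \<in> cbox 0 1 \<longrightarrow> f x = h x"
    using ae unfolding torus_def by (subst (asm) AE_restrict_space_iff) auto
  hence "AE x in lebesgue. ?i h x = ?i f x" by eventually_elim auto
  ultimately have "?i f \<in> borel_measurable lebesgue" by (rule borel_measurable_AE)
  hence "f \<in> borel_measurable torus"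
    unfolding torus_def by (subst (asm) borel_measurable_if) auto
  thus ?thesis using ae h by (intro integral_cong_AE) auto
qed

lemma C1_wave_pair:
  assumes "\<xi> \<in> lattice"
  shows "C1_torus (\<lambda>x. a * wave \<xi> \<theta> x + b * wave \<xi> \<tau> x)
    (\<lambda>x. (2 * pi * (a * wave \<xi> (\<theta> + pi/2) x + b * wave \<xi> (\<tau> + pi/2) x)) *\<^sub>R \<xi>)"
proof -
  have "a *\<^sub>R ((2 * pi * y) *\<^sub>R \<xi>) + b *\<^sub>R ((2 * pi * z) *\<^sub>R \<xi>) = (2 * pi * (a * y + b * z)) *\<^sub>R \<xi>" for y z
    by (simp add: algebra_simps)
  thus ?thesis
    using C1_torus_add[OF C1_torus_scale[OF wave_C1[OF assms], of a \<theta>] C1_torus_scale[OF wave_C1[OF assms], of b \<tau>]]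
    by (simp only:)
qed

lemma fourier_sum_limit_AE_eq:
  assumes f: "integrable torus f" and conv: "\<And>x. (\<lambda>N. fourier_sum f N x) \<longlonglongrightarrow> F x"
    and B: "\<And>N x. \<bar>fourier_sum f N x\<bar> \<le> B"
  shows "AE x in torus. f x = F x"
proof -
  have m: "fourier_sum f N \<in> borel_measurable torus" for N
    using integrable_torus_continuous[OF continuous_on_fourier_sum, of f N] by auto
  note lim = tendsto_integral_mult_bounded[OF _ m conv B]
  have Fi: "integrable torus F" using lim(2)[of "\<lambda>_. 1"] by simp
  have "(\<integral>x. wave \<eta> \<theta> x * (f x - F x) \<partial>torus) = 0" if \<eta>: "\<eta> \<in> lattice" for \<eta> \<theta>
  proof -
    have wi: "integrable torus (wave \<eta> \<theta>)" by (intro integrable_torus_continuous continuous_intros)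
    obtain N0 where N0: "\<eta> \<in> lattice_box N0" using lattice_box_exhausts[OF \<eta>] by blast
    have "\<forall>\<^sub>F N in sequentially. (\<integral>x. fourier_sum f N x * wave \<eta> \<theta> x \<partial>torus) = fourier f \<eta> \<theta>"
      using eventually_ge_at_top[of N0]
    proof eventually_elim
      case (elim N)
      hence "\<eta> \<in> lattice_box N" using N0 lattice_box_mono by blast
      from fourier_fourier_sum[OF f this, of \<theta>] show ?case by (simp add: fourier_def mult.commute)
    qed
    hence "(\<lambda>N. \<integral>x. fourier_sum f N x * wave \<eta> \<theta> x \<partial>torus) \<longlonglongrightarrow> fourier f \<eta> \<theta>" by (rule tendsto_eventually)
    from LIMSEQ_unique[OF this lim(1)[OF wi]]
    have "fourier f \<eta> \<theta> = (\<integral>x. F x * wave \<eta> \<theta> x \<partial>torus)" .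
    thus ?thesis using integrable_wave_mult[OF f] integrable_wave_mult[OF Fi]
      by (simp add: fourier_def right_diff_distrib mult.commute)
  qed
  from AE_zero_if_orthogonal_waves[OF _ this] f Fi have "AE x in torus. f x - F x = 0" by auto
  thus ?thesis by eventually_elim simp
qed

text \<open>Functions in the Sobolev space are limits of their Fourier sums, with uniform control of the
  derivatives up to second order; this replaces the embedding into a space of classical functions.\<close>

lemma sobolev_trigonometric_approximation:
  fixes f :: "real^'n \<Rightarrow> real"
  assumes f: "f \<in> sobolev_torus (2 * k) 2" and k: "4 * real k > real CARD('n) + 6"
  obtains p :: "nat \<Rightarrow> real^'n \<Rightarrow> real" and Dp :: "nat \<Rightarrow> real^'n \<Rightarrow> real^'n" and D2p :: "nat \<Rightarrow> real^'n \<Rightarrow> real^'n^'n"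
    and F DF D2F e B where
    "\<And>N. C1_torus (p N) (Dp N)" "\<And>N j. C1_torus (\<lambda>x. Dp N x $ j) (\<lambda>x. D2p N x $ j)"
    "\<And>x. (\<lambda>N. p N x) \<longlonglongrightarrow> F x" "\<And>x. (\<lambda>N. Dp N x) \<longlonglongrightarrow> DF x" "\<And>j x. (\<lambda>N. D2p N x $ j) \<longlonglongrightarrow> D2F x $ j"
    "\<And>N x. \<bar>p N x - F x\<bar> \<le> e N" "e \<longlonglongrightarrow> 0"
    "\<And>N x. \<bar>p N x\<bar> \<le> B" "\<And>N x. norm (Dp N x) \<le> B" "\<And>N x j. norm (D2p N x $ j) \<le> B"
    "AE x in torus. f x = F x"
proof -
  obtain M where M: "\<And>N. (\<Sum>\<xi>\<in>lattice_box N. amplitude f \<xi> * (1 + norm \<xi>)\<^sup>2) \<le> M"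
    using sobolev_fourier_decay[OF f k] by blast
  define a b where "a = (\<lambda>\<xi>. fourier f \<xi> 0)" and "b = (\<lambda>\<xi>. fourier f \<xi> (- (pi/2)))"
  \<comment> \<open>The term of frequency \<open>\<xi>\<close> with both phases advanced by \<open>\<theta>\<close>; every derivative advances the phase
    by a quarter period.\<close>
  define s where "s = (\<lambda>\<theta> (\<xi>::real^'n) x. a \<xi> * wave \<xi> \<theta> x + b \<xi> * wave \<xi> (- (pi/2) + \<theta>) x)"
  have amp0: "amplitude f \<xi> \<ge> 0" for \<xi> by (simp add: amplitude_def)
  have s: "\<bar>s \<theta> \<xi> x\<bar> \<le> amplitude f \<xi>" for \<theta> \<xi> x
  proof -
    have "\<bar>c * wave \<xi> \<sigma> x\<bar> \<le> \<bar>c\<bar>" for c \<sigma> using mult_left_mono[OF abs_wave_le[of \<xi> \<sigma> x], of "\<bar>c\<bar>"] by (simp add: abs_mult)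
    from this[of "a \<xi>" \<theta>] this[of "b \<xi>" "- (pi/2) + \<theta>"] show ?thesis
      by (simp add: s_def amplitude_def a_def b_def)
  qed
  define b2 where "b2 = (\<lambda>\<xi>::real^'n. amplitude f \<xi> * (1 + norm \<xi>)\<^sup>2)"
  have bp: "t * amplitude f \<xi> \<le> b2 \<xi>" if "t \<le> (1 + norm \<xi>)\<^sup>2" for t \<xi>
    unfolding b2_def using mult_right_mono[OF that amp0[of \<xi>]] by (simp add: mult.commute)
  have one: "1 \<le> (1 + norm \<xi>)\<^sup>2" "\<bar>\<xi> $ j\<bar> \<le> (1 + norm \<xi>)\<^sup>2" "\<bar>\<xi> $ j\<bar> * \<bar>\<xi> $ l\<bar> \<le> (1 + norm \<xi>)\<^sup>2" for \<xi> :: "real^'n" and j l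
  proof -
    have n: "\<bar>\<xi> $ j\<bar> \<le> 1 + norm \<xi>" for j using component_le_norm_cart[of \<xi> j] by linarith
    show 1: "1 \<le> (1 + norm \<xi>)\<^sup>2" by (intro one_le_power) simp
    show "\<bar>\<xi> $ j\<bar> * \<bar>\<xi> $ l\<bar> \<le> (1 + norm \<xi>)\<^sup>2" unfolding power2_eq_square by (intro mult_mono n) auto
    have "1 * (1 + norm \<xi>) \<le> (1 + norm \<xi>) * (1 + norm \<xi>)" by (intro mult_right_mono) auto
    thus "\<bar>\<xi> $ j\<bar> \<le> (1 + norm \<xi>)\<^sup>2" using n[of j] by (simp add: power2_eq_square)
  qed
  have c0: "\<bar>s 0 \<xi> x\<bar> \<le> b2 \<xi>" for \<xi> x using s[of 0 \<xi> x] bp[OF one(1)[of \<xi>]] by simp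
  define c1 where "c1 = (\<lambda>\<xi> (j, x). (2 * pi) * (\<xi> $ j * s (pi/2) \<xi> x))"
  have c1: "\<bar>c1 \<xi> y\<bar> \<le> (2 * pi) * b2 \<xi>" for \<xi> y
  proof (cases y)
    case (Pair j x)
    have "\<bar>\<xi> $ j\<bar> * \<bar>s (pi/2) \<xi> x\<bar> \<le> \<bar>\<xi> $ j\<bar> * amplitude f \<xi>" by (intro mult_left_mono s) auto
    also have "\<dots> \<le> b2 \<xi>" by (rule bp[OF one(2)])
    finally show ?thesis by (simp add: c1_def Pair abs_mult)
  qed
  define c2 where "c2 = (\<lambda>\<xi> (j, l, x). (2 * pi)\<^sup>2 * (\<xi> $ j * \<xi> $ l * s (pi/2 + pi/2) \<xi> x))"
  have c2: "\<bar>c2 \<xi> y\<bar> \<le> (2 * pi)\<^sup>2 * b2 \<xi>" for \<xi> y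
  proof (cases y)
    case (fields j l x)
    have "\<bar>\<xi> $ j\<bar> * \<bar>\<xi> $ l\<bar> * \<bar>s (pi/2 + pi/2) \<xi> x\<bar> \<le> \<bar>\<xi> $ j\<bar> * \<bar>\<xi> $ l\<bar> * amplitude f \<xi>" by (intro mult_left_mono s) auto
    also have "\<dots> \<le> b2 \<xi>" by (rule bp[OF one(3)])
    finally show ?thesis by (simp add: c2_def fields abs_mult)
  qed
  have M1: "(\<Sum>\<xi>\<in>lattice_box N. (2 * pi) * b2 \<xi>) \<le> (2 * pi) * M" for N
    unfolding sum_distrib_left[symmetric] using M[of N] by (simp add: b2_def)
  have M2: "(\<Sum>\<xi>\<in>lattice_box N. (2 * pi)\<^sup>2 * b2 \<xi>) \<le> (2 * pi)\<^sup>2 * M" for N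
    unfolding sum_distrib_left[symmetric] using M[of N] by (intro mult_left_mono) (auto simp: b2_def)
  have Mb: "(\<Sum>\<xi>\<in>lattice_box N. b2 \<xi>) \<le> M" for N using M[of N] by (simp add: b2_def)
  obtain F e where F: "\<And>N x. \<bar>(\<Sum>\<xi>\<in>lattice_box N. s 0 \<xi> x) - F x\<bar> \<le> e N" "e \<longlonglongrightarrow> 0"
    "\<And>x. (\<lambda>N. \<Sum>\<xi>\<in>lattice_box N. s 0 \<xi> x) \<longlonglongrightarrow> F x" "\<And>N x. \<bar>\<Sum>\<xi>\<in>lattice_box N. s 0 \<xi> x\<bar> \<le> M"
    by (rule lattice_sum_converges[of "s 0" b2 M, OF c0 Mb]) blast
  obtain F1 e1 where F1': "\<And>N y. \<bar>(\<Sum>\<xi>\<in>lattice_box N. c1 \<xi> y) - F1 y\<bar> \<le> e1 N" "e1 \<longlonglongrightarrow> 0"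
     and F1: "\<And>y. (\<lambda>N. \<Sum>\<xi>\<in>lattice_box N. c1 \<xi> y) \<longlonglongrightarrow> F1 y"
     "\<And>N y. \<bar>\<Sum>\<xi>\<in>lattice_box N. c1 \<xi> y\<bar> \<le> (2 * pi) * M"
    by (rule lattice_sum_converges[of c1 "\<lambda>\<xi>. (2 * pi) * b2 \<xi>", OF c1 M1]) blast
  obtain F2 e2 where F2': "\<And>N y. \<bar>(\<Sum>\<xi>\<in>lattice_box N. c2 \<xi> y) - F2 y\<bar> \<le> e2 N" "e2 \<longlonglongrightarrow> 0"
     and F2: "\<And>y. (\<lambda>N. \<Sum>\<xi>\<in>lattice_box N. c2 \<xi> y) \<longlonglongrightarrow> F2 y"
     "\<And>N y. \<bar>\<Sum>\<xi>\<in>lattice_box N. c2 \<xi> y\<bar> \<le> (2 * pi)\<^sup>2 * M"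
    by (rule lattice_sum_converges[of c2 "\<lambda>\<xi>. (2 * pi)\<^sup>2 * b2 \<xi>", OF c2 M2]) blast
  define p where "p = (\<lambda>N x. \<Sum>\<xi>\<in>lattice_box N. s 0 \<xi> x)"
  define Dp where "Dp = (\<lambda>N x. \<Sum>\<xi>\<in>lattice_box N. (2 * pi * s (pi/2) \<xi> x) *\<^sub>R \<xi>)"
  define D2p where "D2p = (\<lambda>N x. \<chi> j. \<Sum>\<xi>\<in>lattice_box N. (2 * pi * (2 * pi * \<xi> $ j * s (pi/2 + pi/2) \<xi> x)) *\<^sub>R \<xi>)"
  have ps: "p N = fourier_sum f N" for N
    by (simp add: p_def fourier_sum_def s_def a_def b_def fun_eq_iff)
  have Dpj: "Dp N x $ j = (\<Sum>\<xi>\<in>lattice_box N. c1 \<xi> (j, x))" for N x j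
    by (simp add: Dp_def c1_def mult_ac)
  have D2pj: "D2p N x $ j $ l = (\<Sum>\<xi>\<in>lattice_box N. c2 \<xi> (j, l, x))" for N x j l
    by (simp add: D2p_def c2_def power2_eq_square mult_ac)
  have C1: "C1_torus (p N) (Dp N)" for N
    unfolding p_def Dp_def s_def
  proof (intro C1_torus_sum finite_lattice_box)
    fix \<xi> :: "real^'n" assume "\<xi> \<in> lattice_box N"
    from C1_wave_pair[OF lattice_boxD[OF this], of "a \<xi>" 0 "b \<xi>" "- (pi/2) + 0"]
    show "C1_torus (\<lambda>x. a \<xi> * wave \<xi> 0 x + b \<xi> * wave \<xi> (- (pi/2) + 0) x)
      (\<lambda>x. (2 * pi * (a \<xi> * wave \<xi> (pi/2) x + b \<xi> * wave \<xi> (- (pi/2) + pi/2) x)) *\<^sub>R \<xi>)" by simp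
  qed
  have C2: "C1_torus (\<lambda>x. Dp N x $ j) (\<lambda>x. D2p N x $ j)" for N j
  proof -
    have "C1_torus (\<lambda>x. \<Sum>\<xi>\<in>lattice_box N. c1 \<xi> (j, x)) (\<lambda>x. \<Sum>\<xi>\<in>lattice_box N. (2 * pi * (2 * pi * \<xi> $ j * s (pi/2 + pi/2) \<xi> x)) *\<^sub>R \<xi>)"
    proof (intro C1_torus_sum finite_lattice_box)
      fix \<xi> :: "real^'n" assume "\<xi> \<in> lattice_box N"
      from C1_wave_pair[OF lattice_boxD[OF this], of "2 * pi * \<xi> $ j * a \<xi>" "pi/2" "2 * pi * \<xi> $ j * b \<xi>" "- (pi/2) + pi/2"]
      show "C1_torus (\<lambda>x. c1 \<xi> (j, x)) (\<lambda>x. (2 * pi * (2 * pi * \<xi> $ j * s (pi/2 + pi/2) \<xi> x)) *\<^sub>R \<xi>)"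
        by (simp add: c1_def s_def distrib_left mult.assoc add.assoc)
    qed
    thus ?thesis by (simp add: Dpj D2p_def)
  qed
  define M' where "M' = real CARD('n) * ((2 * pi) * M) + real CARD('n) * ((2 * pi)\<^sup>2 * M) + M"
  have M0: "M \<ge> 0" using F(4)[where N = 0 and x = 0] by linarith
  have nD: "norm (Dp N x) \<le> real CARD('n) * ((2 * pi) * M)" for N x
  proof -
    have "norm (Dp N x) \<le> (\<Sum>j\<in>UNIV. \<bar>Dp N x $ j\<bar>)" by (rule norm_le_l1_cart)
    also have "\<dots> \<le> (\<Sum>j\<in>(UNIV::'n set). (2 * pi) * M)" unfolding Dpj by (intro sum_mono F1)
    finally show ?thesis by simp
  qed
  have nD2: "norm (D2p N x $ j) \<le> real CARD('n) * ((2 * pi)\<^sup>2 * M)" for N x j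
  proof -
    have "norm (D2p N x $ j) \<le> (\<Sum>l\<in>UNIV. \<bar>D2p N x $ j $ l\<bar>)" by (rule norm_le_l1_cart)
    also have "\<dots> \<le> (\<Sum>j\<in>(UNIV::'n set). (2 * pi)\<^sup>2 * M)" unfolding D2pj by (intro sum_mono F2)
    finally show ?thesis by simp
  qed
  have nn: "0 \<le> real CARD('n) * ((2 * pi) * M)" "0 \<le> real CARD('n) * ((2 * pi)\<^sup>2 * M)" using M0 by auto
  show ?thesis
  proof (rule that[of p Dp D2p F "\<lambda>x. \<chi> j. F1 (j, x)" "\<lambda>x. \<chi> j. \<chi> l. F2 (j, l, x)" e M', OF C1 C2])
    show "(\<lambda>N. p N x) \<longlonglongrightarrow> F x" "\<bar>p N x - F x\<bar> \<le> e N" for x N using F by (auto simp: p_def)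
    show "(\<lambda>N. Dp N x) \<longlonglongrightarrow> (\<chi> j. F1 (j, x))" for x
      by (rule vec_tendstoI) (simp add: Dpj F1)
    show "(\<lambda>N. D2p N x $ j) \<longlonglongrightarrow> (\<chi> j. \<chi> l. F2 (j, l, x)) $ j" for x j
      by (rule vec_tendstoI) (simp add: D2pj F2)
    show "\<bar>p N x\<bar> \<le> M'" for N x using F(4)[where N = N and x = x] nn unfolding p_def M'_def by linarith
    show "norm (Dp N x) \<le> M'" for N x using nD[where N = N and x = x] nn M0 unfolding M'_def by linarith
    show "norm (D2p N x $ j) \<le> M'" for N x j using nD2[where N = N and x = x and j = j] nn M0 unfolding M'_def by linarith
    have fL: "integrable torus f" using f by (auto simp: sobolev_torus_def intro: Lp_torus_2D)
    show "AE x in torus. f x = F x"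
      by (rule fourier_sum_limit_AE_eq[OF fL]) (use F(3,4) ps in \<open>auto simp: p_def fun_eq_iff\<close>)
  qed (rule F)
qed

section \<open>Weak derivatives of limits\<close>

lemma weak_deriv_unique:
  assumes "h \<in> Lp_torus 1" "h' \<in> Lp_torus 1" "is_weak_deriv js f h" "is_weak_deriv js f h'"
  shows "AE x in torus. h x = h' x"
proof -
  note i = assms(1,2)[THEN Lp_torus_1_integrable]
  have "(\<integral>x. wave \<xi> \<theta> x * (h x - h' x) \<partial>torus) = 0" if \<xi>: "\<xi> \<in> lattice" for \<xi> \<theta>
  proof -
    have "(-1) ^ length js * (\<integral>x. h x * wave \<xi> \<theta> x \<partial>torus) = (-1) ^ length js * (\<integral>x. h' x * wave \<xi> \<theta> x \<partial>torus)"
      using assms(3,4) wave_test[OF \<xi>, of \<theta>] unfolding is_weak_deriv_def by metis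
    hence "(\<integral>x. h x * wave \<xi> \<theta> x \<partial>torus) = (\<integral>x. h' x * wave \<xi> \<theta> x \<partial>torus)" by simp
    thus ?thesis using integrable_wave_mult[OF i(1)] integrable_wave_mult[OF i(2)]
      by (simp add: right_diff_distrib mult.commute)
  qed
  from AE_zero_if_orthogonal_waves[OF _ this] i have "AE x in torus. h x - h' x = 0" by auto
  thus ?thesis by eventually_elim simp
qed

text \<open>Integration by parts passes to bounded pointwise limits, which gives a weak derivative of the limit;
  uniqueness carries this over to the chosen representative.\<close>

lemma weak_partial_limit:
  fixes f :: "real^'n \<Rightarrow> real"
  assumes p: "\<And>N. C1_torus (p N) (Dp N)" and F: "\<And>x. (\<lambda>N. p N x) \<longlonglongrightarrow> F x"
    and G: "\<And>x. (\<lambda>N. Dp N x $ j) \<longlonglongrightarrow> G x" and B: "\<And>N x. \<bar>p N x\<bar> \<le> B" "\<And>N x. \<bar>Dp N x $ j\<bar> \<le> B"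
    and f: "f \<in> borel_measurable torus" "AE x in torus. f x = F x"
  shows "AE x in torus. weak_partial j f x = G x" "weak_partial j f \<in> Lp_torus 1"
proof -
  have m: "p N \<in> borel_measurable torus" "(\<lambda>x. Dp N x $ j) \<in> borel_measurable torus" for N
  proof -
    have "integrable torus (p N)" "integrable torus (\<lambda>x. Dp N x $ j)"
      by (intro integrable_torus_continuous continuous_intros C1_torusD[OF p])+
    thus "p N \<in> borel_measurable torus" "(\<lambda>x. Dp N x $ j) \<in> borel_measurable torus" by auto
  qed
  note lp = tendsto_integral_mult_bounded[OF _ m(1) F B(1)]
  note lD = tendsto_integral_mult_bounded[OF _ m(2) G B(2)]
  have Gi: "integrable torus G" using lD(2)[of "\<lambda>_. 1"] by simp
  have "periodic G" by (rule periodic_limit[OF C1_torus_gradient_component_periodic[OF p] G])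
  hence GL: "G \<in> Lp_torus 1" using Gi by (auto simp: Lp_torus_def)
  have Fm: "F \<in> borel_measurable torus" using lp(3)[of "\<lambda>_. 1"] by simp
  have "is_weak_deriv [j] f G"
    unfolding is_weak_deriv_def
  proof
    fix \<psi> :: "real^'n \<Rightarrow> real" assume "\<psi> \<in> test_torus"
    hence \<psi>: "C1_torus \<psi> (gradient \<psi>)" by (rule test_torus_C1)
    have e: "multi_deriv [j] \<psi> x = gradient \<psi> x $ j" for x by (simp add: multi_deriv_def gradient_def)
    have i: "integrable torus \<psi>" "integrable torus (\<lambda>x. gradient \<psi> x $ j)"
      by (intro integrable_torus_continuous continuous_intros C1_torusD[OF \<psi>])+
    have "(\<lambda>N. \<integral>x. p N x * gradient \<psi> x $ j \<partial>torus) \<longlonglongrightarrow> - (\<integral>x. G x * \<psi> x \<partial>torus)"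
      unfolding integration_by_parts_torus[OF p \<psi>] by (intro tendsto_minus lD(1) i)
    from LIMSEQ_unique[OF lp(1)[OF i(2)] this]
    have "(\<integral>x. F x * gradient \<psi> x $ j \<partial>torus) = - (\<integral>x. G x * \<psi> x \<partial>torus)" .
    moreover have "(\<integral>x. f x * gradient \<psi> x $ j \<partial>torus) = (\<integral>x. F x * gradient \<psi> x $ j \<partial>torus)"
      using f(2) i(2) by (intro integral_cong_AE borel_measurable_times f Fm) auto
    ultimately show "(\<integral>x. f x * multi_deriv [j] \<psi> x \<partial>torus) = (-1) ^ length [j] * (\<integral>x. G x * \<psi> x \<partial>torus)"
      by (simp add: e)
  qed
  hence wd: "weak_partial j f \<in> Lp_torus 1 \<and> is_weak_deriv [j] f (weak_partial j f)"
    unfolding weak_partial_def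
    by (intro someI[of "\<lambda>h. h \<in> Lp_torus 1 \<and> is_weak_deriv [j] f h" G] conjI GL)
  thus "weak_partial j f \<in> Lp_torus 1" by blast
  show "AE x in torus. weak_partial j f x = G x"
    using wd GL \<open>is_weak_deriv [j] f G\<close> by (intro weak_deriv_unique[of _ _ "[j]" f]) auto
qed

lemma continuous_nonneg_if_AE:
  fixes h :: "real^'n \<Rightarrow> real"
  assumes h: "continuous_on UNIV h" and ae: "AE x in torus. 0 \<le> h x" and x: "x \<in> cbox 0 1"
  shows "0 \<le> h x"
proof -
  define C where "C = {x. 0 \<le> h x}"
  have C: "closed C" unfolding C_def by (intro closed_Collect_le continuous_intros h)
  have "AE x in lebesgue. x \<in> cbox 0 1 \<longrightarrow> 0 \<le> h x"
    using ae unfolding torus_def by (subst (asm) AE_restrict_space_iff) auto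
  hence ae': "AE x \<in> box 0 1 in lebesgue. x \<in> C"
    by eventually_elim (use box_subset_cbox in \<open>auto simp: C_def\<close>)
  have "box 0 1 \<subseteq> C" using mem_closed_if_AE_lebesgue_open[OF open_box C ae'] by blast
  hence "closure (box 0 1) \<subseteq> C" by (intro closure_minimal C)
  moreover have "box 0 (1::real^'n) \<noteq> {}" by (auto simp: interval_ne_empty_cart)
  ultimately show ?thesis using x by (auto simp: closure_box C_def)
qed

context mean_field_game begin

section \<open>Passage to Sobolev test functions\<close>

lemma bounded_on_compact:
  fixes h :: "'a::topological_space \<Rightarrow> 'b::real_normed_vector"
  assumes "continuous_on UNIV h" "compact S"
  obtains B where "\<And>p. p \<in> S \<Longrightarrow> norm (h p) \<le> B"
proof -
  have "bounded (h ` S)"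
    by (intro compact_imp_bounded compact_continuous_image assms(2) continuous_on_subset[OF assms(1)]) auto
  thus ?thesis using that by (auto simp: bounded_iff)
qed

text \<open>The test functions are approximated by trigonometric polynomials; a constant tending to zero
  keeps the approximations of the density non-negative. All terms of the operator converge pointwise
  and boundedly.\<close>

lemma minty_solution_weak_solution:
  assumes k: "2 * real k > real CARD('n) / 2 + 3"
    and m: "m \<in> Lp_torus 1 \<inter> nonneg_torus" "integrable torus m"
    and u: "u \<in> Lp_torus 1" "integrable torus u"
    and minty: "\<And>t. classical t \<Longrightarrow> minty t m u \<le> 0"
  shows "weak_solution k H g \<phi> V m u"
  unfolding weak_solution_def
proof (intro conjI ballI m(1) u(1))
  fix w v :: "real^'n \<Rightarrow> real"
  assume w: "w \<in> sobolev_torus (2 * k) 2 \<inter> nonneg_torus" and v: "v \<in> sobolev_torus (2 * k) 2"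
  have k4: "4 * real k > real CARD('n) + 6" using k by simp
  have w': "w \<in> sobolev_torus (2 * k) 2" using w by blast
  obtain p Dp D2p W DW D2W e B where
    p: "\<And>N. C1_torus (p N) (Dp N)" "\<And>N j. C1_torus (\<lambda>x. Dp N x $ j) (\<lambda>x. D2p N x $ j)"
    and pl: "\<And>x. (\<lambda>N. p N x) \<longlonglongrightarrow> W x" "\<And>x. (\<lambda>N. Dp N x) \<longlonglongrightarrow> DW x" "\<And>j x. (\<lambda>N. D2p N x $ j) \<longlonglongrightarrow> D2W x $ j"
    and e: "\<And>N x. \<bar>p N x - W x\<bar> \<le> e N" "e \<longlonglongrightarrow> 0"
    and pB: "\<And>N x. \<bar>p N x\<bar> \<le> B" "\<And>N x. norm (Dp N x) \<le> B" "\<And>N x j. norm (D2p N x $ j) \<le> B"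
    and wW: "AE x in torus. w x = W x"
    by (rule sobolev_trigonometric_approximation[OF w' k4]) blast
  obtain q Dq D2q Q DQ D2Q e' B' where
    q: "\<And>N. C1_torus (q N) (Dq N)" "\<And>N j. C1_torus (\<lambda>x. Dq N x $ j) (\<lambda>x. D2q N x $ j)"
    and ql: "\<And>x. (\<lambda>N. q N x) \<longlonglongrightarrow> Q x" "\<And>x. (\<lambda>N. Dq N x) \<longlonglongrightarrow> DQ x" "\<And>j x. (\<lambda>N. D2q N x $ j) \<longlonglongrightarrow> D2Q x $ j"
    and e': "\<And>N x. \<bar>q N x - Q x\<bar> \<le> e' N" "e' \<longlonglongrightarrow> 0"
    and qB: "\<And>N x. \<bar>q N x\<bar> \<le> B'" "\<And>N x. norm (Dq N x) \<le> B'" "\<And>N x j. norm (D2q N x $ j) \<le> B'"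
    and vQ: "AE x in torus. v x = Q x"
    by (rule sobolev_trigonometric_approximation[OF v k4]) blast
  define t where "t = (\<lambda>N. Test_Pair (\<lambda>x. p N x + e N) (Dp N) (q N) (Dq N) (D2q N))"
  have W0: "AE x in torus. 0 \<le> W x" using w wW by (auto simp: nonneg_torus_def elim: eventually_elim2)
  have t: "classical (t N)" for N
  proof -
    have C: "C1_torus (\<lambda>x. p N x + e N) (Dp N)" using C1_torus_add[OF p(1) C1_torus_const, of N "e N"] by simp
    have "AE x in torus. 0 \<le> p N x + e N"
      using W0
    proof eventually_elim
      case (elim x)
      thus ?case using e(1)[where N = N and x = x] by linarith
    qed
    hence "0 \<le> p N x + e N" if "x \<in> cbox 0 1" for x
      by (rule continuous_nonneg_if_AE[OF C1_torusD(4)[OF C] _ that])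
    thus ?thesis using C q by (simp add: classical_def t_def)
  qed
  obtain E where E: "\<And>N. \<bar>e N\<bar> \<le> E"
    using convergent_imp_Bseq[OF convergentI[OF e(2)]] by (auto simp: Bseq_def)
  define L where "L = B + E"
  have L: "\<bar>dens (t N) x\<bar> \<le> L" for N x
    using pB(1)[where N = N and x = x] E[of N] by (simp add: t_def L_def)
  have densl: "(\<lambda>N. dens (t N) x) \<longlonglongrightarrow> W x" for x
    using tendsto_add[OF pl(1)[of x] e(2)] by (simp add: t_def)
  have Wn: "0 \<le> W x" if x: "x \<in> cbox 0 1" for x
    using t x by (intro tendsto_lowerbound[OF densl]) (auto simp: classical_def)
  have dl: "(\<lambda>N. ddens (t N) x) \<longlonglongrightarrow> DW x" "(\<lambda>N. val (t N) x) \<longlonglongrightarrow> Q x" "(\<lambda>N. dval (t N) x) \<longlonglongrightarrow> DQ x"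
    "(\<lambda>N. ddval (t N) x $ j) \<longlonglongrightarrow> D2Q x $ j" for x j
    using pl ql by (auto simp: t_def)
  have dB: "norm (ddens (t N) x) \<le> B" "\<bar>val (t N) x\<bar> \<le> B'" "norm (dval (t N) x) \<le> B'" "norm (ddval (t N) x $ j) \<le> B'" for N x j
    using pB qB by (auto simp: t_def)
  have ball: "dval (t N) x \<in> cball 0 B'" for N x using dB(3) by simp
  note H' = class_C2_derivatives[OF H(1)]
  have comp: "(\<lambda>N. h (dval (t N) x)) \<longlonglongrightarrow> h (DQ x)" if "continuous_on UNIV h" for h :: "real^'n \<Rightarrow> 'z::topological_space" and x
    by (rule continuous_on_tendsto_compose[OF that dl(3)]) auto
  obtain BH where BH: "\<And>N x. norm (H (dval (t N) x)) \<le> BH"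
    using bounded_on_compact[OF H'(3) compact_cball] ball by metis
  obtain BG where BG: "\<And>N x. norm (gradient H (dval (t N) x)) \<le> BG"
    using bounded_on_compact[OF H'(4) compact_cball] ball by metis
  have "\<exists>B2. \<forall>N x. norm (gradient (partial_deriv j H) (dval (t N) x)) \<le> B2" for j
    using bounded_on_compact[OF H'(5)[of j] compact_cball] ball by metis
  then obtain B2 where B2: "\<And>j N x. norm (gradient (partial_deriv j H) (dval (t N) x)) \<le> B2 j" by metis
  obtain BV where BV: "\<And>x. x \<in> cbox 0 1 \<Longrightarrow> norm (V x) \<le> BV"
    using bounded_on_compact[OF V_cont compact_cbox] by blast
  obtain B\<phi> where B\<phi>: "\<And>x. x \<in> cbox 0 1 \<Longrightarrow> norm (\<phi> x) \<le> B\<phi>"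
    using bounded_on_compact[OF \<phi>_cont compact_cbox] by blast
  \<comment> \<open>Pointwise limits of \<open>hjb (t N)\<close>, \<open>flux_deriv j (t N)\<close> and \<open>fpk (t N)\<close>.\<close>
  define hl where "hl = (\<lambda>x. - Q x - H (DQ x) + g (W x) - V x)"
  define fl where "fl = (\<lambda>j x. gradient H (DQ x) $ j *\<^sub>R DW x
     + W x *\<^sub>R (\<Sum>l\<in>UNIV. gradient (partial_deriv j H) (DQ x) $ l *\<^sub>R (D2Q x $ l)))"
  define kl where "kl = (\<lambda>x. W x - (\<Sum>j\<in>UNIV. fl j x $ j) - \<phi> x)"
  have flux: "(\<lambda>N. flux_deriv j (t N) x) \<longlonglongrightarrow> fl j x" for j x
    unfolding flux_deriv_def fl_def by (intro tendsto_intros comp H' densl dl)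
  have hjbl: "(\<lambda>N. hjb (t N) x) \<longlonglongrightarrow> hl x" if x: "x \<in> cbox 0 1" for x
  proof -
    have "(\<lambda>N. g (dens (t N) x)) \<longlonglongrightarrow> g (W x)"
      using t x Wn[OF x] by (intro continuous_on_tendsto_compose[OF g(2) densl]) (auto simp: classical_def)
    thus ?thesis unfolding hjb_def hl_def by (intro tendsto_intros comp H' dl)
  qed
  have fpkl: "(\<lambda>N. fpk (t N) x) \<longlonglongrightarrow> kl x" for x
    unfolding fpk_def kl_def by (intro tendsto_intros densl flux)
  have hjbB: "\<bar>hjb (t N) x\<bar> \<le> B' + BH + g L + BV" if x: "x \<in> cbox 0 1" for N x
  proof -
    have d: "0 \<le> dens (t N) x" "dens (t N) x \<le> L" using t[of N] x L[of N x] by (auto simp: classical_def)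
    have "0 \<le> g (dens (t N) x)" using g(1) d by simp
    moreover have "g (dens (t N) x) \<le> g L" using mono_onD[OF g(3), of "dens (t N) x" L] d by simp
    moreover have "\<bar>val (t N) x\<bar> \<le> B'" by (rule dB)
    moreover have "\<bar>H (dval (t N) x)\<bar> \<le> BH" using BH unfolding real_norm_def .
    moreover have "\<bar>V x\<bar> \<le> BV" using BV[OF x] by simp
    ultimately show ?thesis by (simp add: hjb_def abs_le_iff)
  qed
  define BF where "BF = (\<lambda>j. BG * B + L * (\<Sum>l\<in>(UNIV::'n set). B2 j * B'))"
  have fluxB: "norm (flux_deriv j (t N) x) \<le> BF j" for j N x
  proof -
    have 1: "\<bar>gradient H (dval (t N) x) $ j\<bar> \<le> BG"
      using order_trans[OF component_le_norm_cart BG] .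
    have 2: "norm (gradient (partial_deriv j H) (dval (t N) x) $ l *\<^sub>R (ddval (t N) x $ l)) \<le> B2 j * B'" for l
    proof -
      have a: "\<bar>gradient (partial_deriv j H) (dval (t N) x) $ l\<bar> \<le> B2 j"
        by (rule order_trans[OF component_le_norm_cart B2])
      show ?thesis unfolding norm_scaleR
        by (intro mult_mono a dB(4) order_trans[OF abs_ge_zero a] norm_ge_zero)
    qed
    have "norm (flux_deriv j (t N) x) \<le> \<bar>gradient H (dval (t N) x) $ j\<bar> * norm (ddens (t N) x)
        + \<bar>dens (t N) x\<bar> * norm (\<Sum>l\<in>UNIV. gradient (partial_deriv j H) (dval (t N) x) $ l *\<^sub>R (ddval (t N) x $ l))"
      unfolding flux_deriv_def by (rule order_trans[OF norm_triangle_ineq]) simp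
    also have "\<dots> \<le> BF j"
      unfolding BF_def
    proof (intro add_mono mult_mono 1 dB(1) L)
      show "norm (\<Sum>l\<in>UNIV. gradient (partial_deriv j H) (dval (t N) x) $ l *\<^sub>R (ddval (t N) x $ l)) \<le> (\<Sum>l\<in>(UNIV::'n set). B2 j * B')"
        by (intro sum_norm_le 2)
    qed (use order_trans[OF abs_ge_zero 1] order_trans[OF abs_ge_zero L[of N x]] in auto)
    finally show ?thesis .
  qed
  have fpkB: "\<bar>fpk (t N) x\<bar> \<le> L + (\<Sum>j\<in>UNIV. BF j) + B\<phi>" if x: "x \<in> cbox 0 1" for N x
  proof -
    have "\<bar>\<Sum>j\<in>UNIV. flux_deriv j (t N) x $ j\<bar> \<le> (\<Sum>j\<in>UNIV. BF j)"
      by (rule order_trans[OF sum_abs sum_mono]) (rule order_trans[OF component_le_norm_cart fluxB])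
    thus ?thesis using L[of N x] B\<phi>[OF x] by (simp add: fpk_def abs_le_iff)
  qed
  \<comment> \<open>The limits agree almost everywhere with the weak expressions in the variational inequality.\<close>
  have wm: "w \<in> borel_measurable torus" "v \<in> borel_measurable torus"
    using w v by (auto simp: sobolev_torus_def Lp_torus_def)
  have grad: "AE x in torus. weak_partial j v x = DQ x $ j" "weak_partial j v \<in> Lp_torus 1" for j
  proof -
    have l: "(\<lambda>N. Dq N x $ j) \<longlonglongrightarrow> DQ x $ j" for x by (intro tendsto_vec_nth ql)
    have b: "\<bar>q N x\<bar> \<le> B'" "\<bar>Dq N x $ j\<bar> \<le> B'" for N x
      using qB(1) order_trans[OF component_le_norm_cart qB(2)] by auto
    note wp = weak_partial_limit[of q Dq Q j "\<lambda>x. DQ x $ j" B' v, OF q(1) ql(1) l b wm(2) vQ]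
    show "AE x in torus. weak_partial j v x = DQ x $ j" "weak_partial j v \<in> Lp_torus 1" by (rule wp)+
  qed
  have wg: "AE x in torus. weak_gradient v x = DQ x"
  proof -
    have "AE x in torus. \<forall>j. weak_partial j v x = DQ x $ j" using grad(1) by (subst AE_all_countable) auto
    thus ?thesis by eventually_elim (simp add: weak_gradient_def vec_eq_iff)
  qed
  have wgm [measurable]: "weak_gradient v \<in> borel_measurable torus"
  proof (rule borel_measurable_euclidean_space[THEN iffD2], rule ballI)
    fix i :: "real^'n" assume "i \<in> Basis"
    then obtain j where "i = axis j 1" by (auto simp: Basis_vec_def)
    thus "(\<lambda>x. weak_gradient v x \<bullet> i) \<in> borel_measurable torus"
      using grad(2)[of j] by (simp add: inner_axis weak_gradient_def Lp_torus_def)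
  qed
  have dv: "AE x in torus. weak_partial j (\<lambda>y. (w y *\<^sub>R gradient H (weak_gradient v y)) $ j) x = fl j x $ j" for j
  proof (rule weak_partial_limit(1))
    show "C1_torus (\<lambda>x. dens (t N) x * gradient H (dval (t N) x) $ j) (flux_deriv j (t N))" for N
      by (rule flux_C1[OF t])
    show "(\<lambda>N. dens (t N) x * gradient H (dval (t N) x) $ j) \<longlonglongrightarrow> W x * gradient H (DQ x) $ j" for x
      by (intro tendsto_intros densl comp H')
    show "(\<lambda>N. flux_deriv j (t N) x $ j) \<longlonglongrightarrow> fl j x $ j" for x
      by (intro tendsto_intros flux)
    show "\<bar>dens (t N) x * gradient H (dval (t N) x) $ j\<bar> \<le> max (L * BG) (BF j)" for N x
    proof -
      have "\<bar>dens (t N) x\<bar> * \<bar>gradient H (dval (t N) x) $ j\<bar> \<le> L * BG"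
        using order_trans[OF abs_ge_zero L[of N x]]
        by (intro mult_mono L order_trans[OF component_le_norm_cart BG]) auto
      thus ?thesis by (simp add: abs_mult le_max_iff_disj)
    qed
    show "\<bar>flux_deriv j (t N) x $ j\<bar> \<le> max (L * BG) (BF j)" for N x
      using order_trans[OF component_le_norm_cart fluxB, of j N x j] by (simp add: le_max_iff_disj)
    have cj: "continuous_on UNIV (\<lambda>p. gradient H p $ j)" by (intro continuous_intros H')
    have "(\<lambda>y. gradient H (weak_gradient v y) $ j) \<in> borel_measurable torus"
      using measurable_compose[OF wgm borel_measurable_continuous_onI[OF cj]] .
    thus "(\<lambda>y. (w y *\<^sub>R gradient H (weak_gradient v y)) $ j) \<in> borel_measurable torus"
      using wm(1) by simp
    show "AE x in torus. (w x *\<^sub>R gradient H (weak_gradient v x)) $ j = W x * gradient H (DQ x) $ j"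
      using wW wg by eventually_elim simp
  qed
  have wd: "AE x in torus. weak_div (\<lambda>y. w y *\<^sub>R gradient H (weak_gradient v y)) x = (\<Sum>j\<in>UNIV. fl j x $ j)"
  proof -
    have "AE x in torus. \<forall>j. weak_partial j (\<lambda>y. (w y *\<^sub>R gradient H (weak_gradient v y)) $ j) x = fl j x $ j"
      using dv by (subst AE_all_countable) auto
    thus ?thesis by eventually_elim (simp add: weak_div_def)
  qed
  have hm: "hjb (t N) \<in> borel_measurable torus" and km: "fpk (t N) \<in> borel_measurable torus"
    and dm: "dens (t N) \<in> borel_measurable torus" and vm: "val (t N) \<in> borel_measurable torus" for N
  proof -
    have "integrable torus (hjb (t N))" "integrable torus (fpk (t N))" "integrable torus (dens (t N))" "integrable torus (val (t N))"
      by (intro integrable_torus_continuous hjb_cont fpk_cont classical_cont t)+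
    thus "hjb (t N) \<in> borel_measurable torus" "fpk (t N) \<in> borel_measurable torus"
      "dens (t N) \<in> borel_measurable torus" "val (t N) \<in> borel_measurable torus" by auto
  qed
  note lim1 = tendsto_integral_mult_bounded[OF m(2) hm hjbl hjbB]
  note lim2 = tendsto_integral_mult_bounded[OF u(2) km fpkl fpkB]
  have b3: "\<bar>hjb (t N) x * dens (t N) x\<bar> \<le> (B' + BH + g L + BV) * L" if "x \<in> cbox 0 1" for N x
    unfolding abs_mult using hjbB[OF that, of N] by (intro mult_mono L) (auto intro: order_trans[OF abs_ge_zero])
  have b4: "\<bar>fpk (t N) x * val (t N) x\<bar> \<le> (L + (\<Sum>j\<in>UNIV. BF j) + B\<phi>) * B'" if "x \<in> cbox 0 1" for N x
    unfolding abs_mult using fpkB[OF that, of N] by (intro mult_mono dB) (auto intro: order_trans[OF abs_ge_zero])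
  have l3: "(\<lambda>N. hjb (t N) x * dens (t N) x) \<longlonglongrightarrow> hl x * W x" "(\<lambda>N. fpk (t N) x * val (t N) x) \<longlonglongrightarrow> kl x * Q x"
    if "x \<in> cbox 0 1" for x
    by (intro tendsto_mult hjbl fpkl densl dl that)+
  have m3: "(\<lambda>x. hjb (t N) x * dens (t N) x) \<in> borel_measurable torus" "(\<lambda>x. fpk (t N) x * val (t N) x) \<in> borel_measurable torus" for N
    by (intro borel_measurable_times hm dm km vm)+
  have one: "integrable torus (\<lambda>x::real^'n. 1::real)" by simp
  note lim3 = tendsto_integral_mult_bounded[OF one m3(1) l3(1) b3]
  note lim4 = tendsto_integral_mult_bounded[OF one m3(2) l3(2) b4]
  have eqN: "minty (t N) m u = (\<integral>x. hjb (t N) x * m x \<partial>torus) + (\<integral>x. fpk (t N) x * u x \<partial>torus)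
      - ((\<integral>x. hjb (t N) x * dens (t N) x * 1 \<partial>torus) + (\<integral>x. fpk (t N) x * val (t N) x * 1 \<partial>torus))" for N
    using minty_affine[OF t m(2) u(2), of N] by (simp add: minty_const_def)
  have "(\<lambda>N. minty (t N) m u) \<longlonglongrightarrow> (\<integral>x. hl x * m x \<partial>torus) + (\<integral>x. kl x * u x \<partial>torus)
      - ((\<integral>x. hl x * W x * 1 \<partial>torus) + (\<integral>x. kl x * Q x * 1 \<partial>torus))"
    unfolding eqN by (intro tendsto_intros lim1(1) lim2(1) lim3(1) lim4(1))
  hence "(\<integral>x. hl x * m x \<partial>torus) + (\<integral>x. kl x * u x \<partial>torus)
      - ((\<integral>x. hl x * W x * 1 \<partial>torus) + (\<integral>x. kl x * Q x * 1 \<partial>torus)) \<le> 0"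
    by (rule tendsto_upperbound) (use minty[OF t] in auto)
  hence le: "(\<integral>x. hl x * (m x - W x) \<partial>torus) + (\<integral>x. kl x * (u x - Q x) \<partial>torus) \<le> 0"
    using lim1(2) lim2(2) lim3(2) lim4(2) by (simp add: right_diff_distrib)
  have i1: "AE x in torus. (- v x - H (weak_gradient v x) + g (w x) - V x) * (m x - w x) = hl x * (m x - W x)"
    using wW vQ wg by eventually_elim (simp add: hl_def)
  have i2: "AE x in torus. (w x - weak_div (\<lambda>y. w y *\<^sub>R gradient H (weak_gradient v y)) x - \<phi> x) * (u x - v x) = kl x * (u x - Q x)"
    using wW vQ wd by eventually_elim (simp add: kl_def)
  have mm: "m \<in> borel_measurable torus" "u \<in> borel_measurable torus" using m(2) u(2) by auto
  have Wm: "W \<in> borel_measurable torus"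
    by (rule tendsto_integral_mult_bounded(3)[OF one dm densl L])
  have Qm: "Q \<in> borel_measurable torus"
    by (rule tendsto_integral_mult_bounded(3)[OF one vm dl(2) dB(2)])
  have "(\<lambda>x. hl x * (m x - W x)) \<in> borel_measurable torus" "(\<lambda>x. kl x * (u x - Q x)) \<in> borel_measurable torus"
    using lim1(3) borel_measurable_LIMSEQ_real[OF fpkl km] mm Wm Qm
    by (simp_all add: borel_measurable_times borel_measurable_diff)
  thus "(\<integral>x. (- v x - H (weak_gradient v x) + g (w x) - V x) * (m x - w x) \<partial>torus) +
        (\<integral>x. (w x - weak_div (\<lambda>y. w y *\<^sub>R gradient H (weak_gradient v y)) x - \<phi> x) * (u x - v x) \<partial>torus) \<le> 0"
    using le by (simp only: integral_torus_cong_AE[OF i1] integral_torus_cong_AE[OF i2])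
qed

end

theorem theorem4p4:
  fixes H :: "real^'n \<Rightarrow> real" and g :: "real \<Rightarrow> real"
    and \<phi> V :: "real^'n \<Rightarrow> real" and \<alpha> :: real and k :: nat
  assumes k: "2 * real k > real CARD('n) / 2 + 3"
    and V: "V \<in> cont_torus"
    and A1_H: "class_C 2 H" "convex_on UNIV H"
    and A1_g: "\<forall>s\<ge>0. g s \<ge> 0" "continuous_on {0..} g" "mono_on {0..} g"
    and A1_\<phi>: "\<phi> \<in> cont_torus" "\<forall>x. \<phi> x > 0" "(\<integral>x. \<phi> x \<partial>torus) = 1"
    and A2: "\<alpha> > 1"
      "\<exists>C>0. \<forall>p. - H p + gradient H p \<bullet> p \<ge> 1 / C * norm p powr \<alpha> - C"
    and A3: "\<exists>C>0. \<forall>p. H p \<ge> 1 / C * norm p powr \<alpha> - C"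
    and A4: "\<forall>\<delta>\<in>{0<..<1}. \<exists>C>0. \<forall>m \<in> (Lp_torus 1 \<inter> nonneg_torus :: (real^'n \<Rightarrow> real) set).
      (\<integral>\<^sup>+x. ennreal (m x) \<partial>torus) + (\<integral>\<^sup>+x. ennreal (g (m x)) \<partial>torus)
        \<le> ennreal \<delta> * (\<integral>\<^sup>+x. ennreal (m x * g (m x)) \<partial>torus) + ennreal C"
    and A5: "\<forall>m :: nat \<Rightarrow> real^'n \<Rightarrow> real.
      (\<forall>j. m j \<in> Lp_torus 1 \<inter> nonneg_torus) \<and>
      (SUP j. \<integral>\<^sup>+x. ennreal (m j x * g (m j x)) \<partial>torus) < \<infinity> \<longrightarrow>
      (\<exists>r l. strict_mono r \<and> l \<in> Lp_torus 1 \<and> weakly_converges_L1 (m \<circ> r) l)"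
  shows "\<exists>m u. m \<in> Lp_torus 1 \<inter> nonneg_torus \<and> u \<in> sobolev_torus 1 \<alpha> \<and>
    weak_solution k H g \<phi> V m u"
proof -
  interpret mean_field_game H g \<phi> V \<alpha>
    by unfold_locales (fact assms)+
  obtain m u where m: "m \<in> Lp_torus 1 \<inter> nonneg_torus" "integrable torus m"
    and u: "u \<in> Lp_torus 1" "integrable torus u" and sob: "u \<in> sobolev_torus 1 \<alpha>"
    and minty: "\<And>t. classical t \<Longrightarrow> minty t m u \<le> 0"
    using exists_minty_solution by blast
  have "weak_solution k H g \<phi> V m u"
    by (rule minty_solution_weak_solution[OF k m u minty])
  thus ?thesis using m(1) sob by blast
qed

end
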